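(* Assume a group $G$ is decomposed as a finite graph $T$ of groups that satisfies the following. (1) For each vertex $v$ of $T$ the vertex group $G_v$ is finitely generated and undistorted in $G$. Moreover, any strongly quasiconvex, infinite subgroup of $G_v$ is of finite index in $G_v$. (2) Each edge group is infinite. Then, if $H$ is a strongly quasiconvex, torsion free subgroup of $G$ of infinite index, then $H$ is a free subgroup.
   Context: A subset $A$ of a geodesic metric space $X$ is Morse if for every $k\ge 1$, $c\ge 0$ there is $M=M(k,c)$ such that every $(k,c)$-quasi-geodesic with endpoints on $A$ is contained in the $M$-neighborhood of $A$. A subgroup $H$ of a finitely generated group $G$ is strongly quasiconvex if it is a Morse subset of the Cayley graph of $G$ for some (equivalently any) finite generating set. A finitely generated subgroup is undistorted if its inclusion induces a quasi-isometric embedding of Cayley graphs (with respect to finite generating sets). *)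

theory Defs
  imports Complex_Main "HOL-Algebra.Generated_Groups" "Graph_Theory.Graph_Theory"
begin

section \<open>Quasi-geodesics and Morse subsets\<close>

text \<open>Metric spaces are given by a carrier set and a distance function.\<close>

definition quasi_isometric_embedding ::
    "real \<Rightarrow> real \<Rightarrow> 'p set \<Rightarrow> ('p \<Rightarrow> 'p \<Rightarrow> real) \<Rightarrow> 'q set \<Rightarrow> ('q \<Rightarrow> 'q \<Rightarrow> real) \<Rightarrow> ('p \<Rightarrow> 'q) \<Rightarrow> bool" where
  "quasi_isometric_embedding k c X dX Y dY f \<longleftrightarrow>
     f \<in> X \<rightarrow> Y \<and>
     (\<forall>x\<in>X. \<forall>x'\<in>X. dX x x' / k - c \<le> dY (f x) (f x') \<and> dY (f x) (f x') \<le> k * dX x x' + c)"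

definition quasi_geodesic ::
    "'p set \<Rightarrow> ('p \<Rightarrow> 'p \<Rightarrow> real) \<Rightarrow> real \<Rightarrow> real \<Rightarrow> real \<Rightarrow> real \<Rightarrow> (real \<Rightarrow> 'p) \<Rightarrow> bool" where
  "quasi_geodesic X d k c a b \<gamma> \<longleftrightarrow> a \<le> b \<and> quasi_isometric_embedding k c {a..b} dist X d \<gamma>"

definition Morse_subset :: "'p set \<Rightarrow> ('p \<Rightarrow> 'p \<Rightarrow> real) \<Rightarrow> 'p set \<Rightarrow> bool" where
  "Morse_subset X d A \<longleftrightarrow>
     A \<subseteq> X \<and>
     (\<forall>k\<ge>1. \<forall>c\<ge>0. \<exists>M. \<forall>a b \<gamma>.
        quasi_geodesic X d k c a b \<gamma> \<and> \<gamma> a \<in> A \<and> \<gamma> b \<in> A \<longrightarrow>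
        (\<forall>t\<in>{a..b}. \<exists>y\<in>A. d (\<gamma> t) y \<le> M))"

section \<open>Cayley graphs as metric spaces\<close>

text \<open>The geometric realization of a graph with vertex set \<open>V\<close> and (symmetric) adjacency relation
  \<open>E\<close>.  Points are written in barycentric coordinates: the point at parameter \<open>t \<in> [0,1]\<close> of the edge
  from \<open>u\<close> to \<open>v\<close> is the function with value \<open>1 - t\<close> at \<open>u\<close> and \<open>t\<close> at \<open>v\<close>; the case \<open>u = v\<close> is the
  vertex \<open>u\<close>.  Since \<open>E\<close> is a relation, the graph is simple: a loop is identified with its
  base vertex, and there are no multiple edges.\<close>

definition edge_point :: "'a \<Rightarrow> 'a \<Rightarrow> real \<Rightarrow> 'a \<Rightarrow> real" where
  "edge_point u v t = (\<lambda>w. (1 - t) * of_bool (w = u) + t * of_bool (w = v))"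

abbreviation vertex_point :: "'a \<Rightarrow> 'a \<Rightarrow> real" where
  "vertex_point u \<equiv> edge_point u u 0"

definition realization :: "'a set \<Rightarrow> 'a rel \<Rightarrow> ('a \<Rightarrow> real) set" where
  "realization V E = {edge_point u v t | u v t. (u, v) \<in> E \<union> Id_on V \<and> 0 \<le> t \<and> t \<le> 1}"

definition edge_distance :: "'a rel \<Rightarrow> 'a \<Rightarrow> 'a \<Rightarrow> nat" where
  "edge_distance E u v = (LEAST n. (u, v) \<in> E ^^ n)"

text \<open>The path metric with all edges of length 1.  A geodesic between two points either stays
  inside one edge or leaves the edge of \<open>x\<close> through an end \<open>u\<close>, at distance \<open>1 - x u\<close> from \<open>x\<close>,
  and enters the edge of \<open>y\<close> through an end \<open>v\<close>.\<close>

definition realization_dist :: "'a rel \<Rightarrow> ('a \<Rightarrow> real) \<Rightarrow> ('a \<Rightarrow> real) \<Rightarrow> real" where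
  "realization_dist E x y = Inf
     ({\<bar>s - t\<bar> | s t. \<exists>u v. (u, v) \<in> E\<^sup>= \<and> 0 \<le> s \<and> s \<le> 1 \<and> 0 \<le> t \<and> t \<le> 1 \<and>
                    x = edge_point u v s \<and> y = edge_point u v t} \<union>
      {(1 - x u) + real (edge_distance E u v) + (1 - y v) | u v. 0 < x u \<and> 0 < y v})"

definition generating_set :: "('a, 'm) monoid_scheme \<Rightarrow> 'a set \<Rightarrow> bool" where
  "generating_set G S \<longleftrightarrow> S \<subseteq> carrier G \<and> generate G S = carrier G"

definition finitely_generated :: "('a, 'm) monoid_scheme \<Rightarrow> bool" where
  "finitely_generated G \<longleftrightarrow> (\<exists>S. finite S \<and> generating_set G S)"

definition cayley_edges :: "('a, 'm) monoid_scheme \<Rightarrow> 'a set \<Rightarrow> 'a rel" where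
  "cayley_edges G S = {(g, h). g \<in> carrier G \<and> h \<in> carrier G \<and>
                               (\<exists>s\<in>S. h = g \<otimes>\<^bsub>G\<^esub> s \<or> g = h \<otimes>\<^bsub>G\<^esub> s)}"

definition cayley_graph :: "('a, 'm) monoid_scheme \<Rightarrow> 'a set \<Rightarrow> ('a \<Rightarrow> real) set" where
  "cayley_graph G S = realization (carrier G) (cayley_edges G S)"

definition cayley_dist :: "('a, 'm) monoid_scheme \<Rightarrow> 'a set \<Rightarrow> ('a \<Rightarrow> real) \<Rightarrow> ('a \<Rightarrow> real) \<Rightarrow> real" where
  "cayley_dist G S = realization_dist (cayley_edges G S)"

section \<open>Properties of groups and subgroups\<close>

definition strongly_quasiconvex :: "('a, 'm) monoid_scheme \<Rightarrow> 'a set \<Rightarrow> bool" where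
  "strongly_quasiconvex G H \<longleftrightarrow>
     subgroup H G \<and>
     (\<exists>S. finite S \<and> generating_set G S \<and>
          Morse_subset (cayley_graph G S) (cayley_dist G S) (vertex_point ` H))"

text \<open>The inclusion is a map on vertices; it induces a map of Cayley graphs by extension over the
  edges, which is well defined only up to bounded error.\<close>

definition undistorted :: "('a, 'm) monoid_scheme \<Rightarrow> 'a set \<Rightarrow> bool" where
  "undistorted G H \<longleftrightarrow>
     subgroup H G \<and>
     (\<exists>S T. finite S \<and> generating_set G S \<and> finite T \<and> generating_set (G\<lparr>carrier := H\<rparr>) T \<and>
        (\<exists>k\<ge>1. \<exists>c\<ge>0. \<exists>f. (\<forall>h\<in>H. f (vertex_point h) = vertex_point h) \<and>
           quasi_isometric_embedding k c
             (cayley_graph (G\<lparr>carrier := H\<rparr>) T) (cayley_dist (G\<lparr>carrier := H\<rparr>) T)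
             (cayley_graph G S) (cayley_dist G S) f))"

definition finite_index :: "('a, 'm) monoid_scheme \<Rightarrow> 'a set \<Rightarrow> bool" where
  "finite_index G H \<longleftrightarrow> finite (rcosets\<^bsub>G\<^esub> H)"

definition torsion_free :: "('a, 'm) monoid_scheme \<Rightarrow> bool" where
  "torsion_free G \<longleftrightarrow> (\<forall>x\<in>carrier G. \<forall>n::nat. 0 < n \<and> x [^]\<^bsub>G\<^esub> n = \<one>\<^bsub>G\<^esub> \<longrightarrow> x = \<one>\<^bsub>G\<^esub>)"

section \<open>Presentations, free groups\<close>

text \<open>The monoid with generators \<open>A\<close> and defining relations \<open>u = v\<close> for \<open>(u, v) \<in> R\<close>: words over \<open>A\<close>
  modulo the congruence generated by \<open>R\<close>.  It is used below only in cases where the relations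
  provide an inverse for every generator, so that it is the group with this presentation.\<close>

definition rewrite_step :: "'l set \<Rightarrow> ('l list \<times> 'l list) set \<Rightarrow> 'l list rel" where
  "rewrite_step A R = {(p @ u @ q, p @ v @ q) | p q u v. (u, v) \<in> R \<and>
                         p \<in> lists A \<and> q \<in> lists A \<and> u \<in> lists A \<and> v \<in> lists A}"

definition word_congruence :: "'l set \<Rightarrow> ('l list \<times> 'l list) set \<Rightarrow> 'l list rel" where
  "word_congruence A R = (rewrite_step A R \<union> (rewrite_step A R)\<inverse>)\<^sup>* \<inter> (lists A \<times> lists A)"

definition presented_monoid :: "'l set \<Rightarrow> ('l list \<times> 'l list) set \<Rightarrow> 'l list set monoid" where
  "presented_monoid A R =
     \<lparr>carrier = lists A // word_congruence A R,
      monoid.mult = (\<lambda>X Y. \<Union>x\<in>X. \<Union>y\<in>Y. word_congruence A R `` {x @ y}),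
      one = word_congruence A R `` {[]}\<rparr>"

text \<open>\<open>(b, True)\<close> is the basis element \<open>b\<close>, and \<open>(b, False)\<close> its inverse.\<close>

definition free_group :: "'b set \<Rightarrow> ('b \<times> bool) list set monoid" where
  "free_group B = presented_monoid (B \<times> UNIV) {([(b, x), (b, \<not> x)], []) | b x. b \<in> B}"

text \<open>The basis can be taken inside the group, so its type is no restriction.\<close>

definition is_free_group :: "('a, 'm) monoid_scheme \<Rightarrow> bool" where
  "is_free_group G \<longleftrightarrow> (\<exists>B. B \<subseteq> carrier G \<and> free_group B \<cong> G)"

section \<open>Graphs of groups\<close>

text \<open>The underlying graph is given with an orientation: each geometric edge occurs once in
  \<^term>\<open>arcs T\<close>.  Loops and multiple edges are allowed.  Connectedness of a
  \<^typ>\<open>('v, 'e) pre_digraph\<close> is weak connectedness (and includes that there is a vertex), but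
  \<^const>\<open>Digraph_Component.tree\<close> only forbids directed cycles; so we define trees through
  the graph in which every arc may be traversed in both directions.\<close>

definition bidirected :: "('v, 'e) pre_digraph \<Rightarrow> ('v, 'e \<times> bool) pre_digraph" where
  "bidirected T =
     \<lparr>verts = verts T, arcs = arcs T \<times> UNIV,
      tail = (\<lambda>(e, x). if x then tail T e else head T e),
      head = (\<lambda>(e, x). if x then head T e else tail T e)\<rparr>"

text \<open>\<^const>\<open>pre_digraph.cycle\<close> visits no vertex twice; distinctness of the underlying arcs
  excludes going back and forth along one arc.\<close>

definition unoriented_tree :: "('v, 'e) pre_digraph \<Rightarrow> bool" where
  "unoriented_tree T \<longleftrightarrow>
     Digraph_Component.connected T \<and>
     \<not> (\<exists>p. pre_digraph.cycle (bidirected T) p \<and> distinct (map fst p))"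

definition maximal_subtree :: "('v, 'e) pre_digraph \<Rightarrow> ('v, 'e) pre_digraph \<Rightarrow> bool" where
  "maximal_subtree T' T \<longleftrightarrow> unoriented_tree T' \<and> spanning T' T"

record ('v, 'e, 'g, 'h) group_graph =
  graph :: "('v, 'e) pre_digraph"
  vgroup :: "'v \<Rightarrow> 'g monoid"
  egroup :: "'e \<Rightarrow> 'h monoid"
  to_tail :: "'e \<Rightarrow> 'h \<Rightarrow> 'g"
  to_head :: "'e \<Rightarrow> 'h \<Rightarrow> 'g"

locale graph_of_groups =
  fixes T :: "('v, 'e, 'g, 'h) group_graph"
  assumes wf: "wf_digraph (graph T)"
    and connected: "Digraph_Component.connected (graph T)"
    and group_vgroup: "v \<in> verts (graph T) \<Longrightarrow> group (vgroup T v)"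
    and group_egroup: "e \<in> arcs (graph T) \<Longrightarrow> group (egroup T e)"
    and to_tail: "e \<in> arcs (graph T) \<Longrightarrow> to_tail T e \<in> mon (egroup T e) (vgroup T (tail (graph T) e))"
    and to_head: "e \<in> arcs (graph T) \<Longrightarrow> to_head T e \<in> mon (egroup T e) (vgroup T (head (graph T) e))"

text \<open>The fundamental group of a graph of groups with respect to a maximal subtree: generated by the
  vertex groups and the edges (\<open>Edge e False\<close> is the inverse of \<open>Edge e True\<close>), where the edges
  conjugate the two copies of their edge groups into each other and those in the tree are trivial.\<close>

datatype ('v, 'e, 'g) letter = Vert 'v 'g | Edge 'e bool

definition pi1_letters :: "('v, 'e, 'g, 'h) group_graph \<Rightarrow> ('v, 'e, 'g) letter set" where
  "pi1_letters T =
     {Vert v g | v g. v \<in> verts (graph T) \<and> g \<in> carrier (vgroup T v)} \<union>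
     {Edge e x | e x. e \<in> arcs (graph T)}"

definition pi1_relations ::
    "('v, 'e, 'g, 'h) group_graph \<Rightarrow> ('v, 'e) pre_digraph \<Rightarrow>
     (('v, 'e, 'g) letter list \<times> ('v, 'e, 'g) letter list) set" where
  "pi1_relations T T' =
     {([Vert v \<one>\<^bsub>vgroup T v\<^esub>], []) | v. v \<in> verts (graph T)} \<union>
     {([Vert v g, Vert v h], [Vert v (g \<otimes>\<^bsub>vgroup T v\<^esub> h)]) | v g h.
        v \<in> verts (graph T) \<and> g \<in> carrier (vgroup T v) \<and> h \<in> carrier (vgroup T v)} \<union>
     {([Edge e x, Edge e (\<not> x)], []) | e x. e \<in> arcs (graph T)} \<union>
     {([Vert (tail (graph T) e) (to_tail T e a), Edge e True],
       [Edge e True, Vert (head (graph T) e) (to_head T e a)]) | e a.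
        e \<in> arcs (graph T) \<and> a \<in> carrier (egroup T e)} \<union>
     {([Edge e True], []) | e. e \<in> arcs T'}"

definition fundamental_group ::
    "('v, 'e, 'g, 'h) group_graph \<Rightarrow> ('v, 'e) pre_digraph \<Rightarrow> ('v, 'e, 'g) letter list set monoid" where
  "fundamental_group T T' = presented_monoid (pi1_letters T) (pi1_relations T T')"

definition vgroup_to_pi1 ::
    "('v, 'e, 'g, 'h) group_graph \<Rightarrow> ('v, 'e) pre_digraph \<Rightarrow> 'v \<Rightarrow> 'g \<Rightarrow> ('v, 'e, 'g) letter list set" where
  "vgroup_to_pi1 T T' v g = word_congruence (pi1_letters T) (pi1_relations T T') `` {[Vert v g]}"

end

(* If H contains infinitely many elements of some conjugate of a vertex group, then, since that vertex
   group is undistorted, the intersection pulls back to an infinite strongly quasiconvex subgroup of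
   it, which has finite index by (1). Since the edge groups are infinite, this propagates through the
   Bass-Serre tree to all conjugates of all vertex groups. Every g in G is then the midpoint of
   arbitrarily long quasi-geodesics with uniform constants inside the coset g G_v, whose ends stay
   at bounded distance from H; so the Morse property puts g within a uniform distance of H, and H has
   finite index, a contradiction. Hence H, being torsion free, meets all conjugates of the vertex
   groups trivially and acts freely on the Bass-Serre tree.

   The structure theory of graphs of groups enters only through two facts. The tree is simply
   connected, i.e. edge labellings invariant under the edge groups have potentials; this follows from
   the presentation by extending a cocycle from the generators. And the vertex groups, which are
   countable, embed: all of them act freely on the natural numbers with infinitely many orbits, the
   two actions of an edge group are isomorphic, and the isomorphisms make the fundamental group
   act. *)

theory Submission
  imports Defs "HOL-Algebra.Bij"
begin

section \<open>Word metrics\<close>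

text \<open>The long quasi-geodesics in a coset \<open>g G_v\<close> have ends within some distance
  R of H, but R depends on g, whereas the Morse property asks for endpoints on H and gives a bound
  that depends on the constants of the path. This is the main obstacle. Each end is therefore joined
  to H by a geodesic that leaves the path at a point nearest to its target. Such a detour triples
  the multiplicative constant, however long it is; two of them lead from k to 9 k. If the path is
  long compared with R, both detours leave it away from the midpoint g. The embedding of the vertex
  groups is needed because undistortedness concerns their images in G, while condition (1) concerns
  the vertex groups themselves: word lengths are carried back through the inverse of the embedding.
  Infinitely many orbits are required of the actions on the natural numbers because a free action of
  an edge group with countably many orbits is determined up to isomorphism by their number, and
  restriction to a subgroup preserves having infinitely many. Quasi-geodesics need not be
  continuous, so all metric arguments can run on group elements and integer times, with bounded
  additive errors.\<close>

locale fg_group = group G for G (structure) +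
  fixes S :: "'a set"
  assumes finite_S: "finite S" and generating: "generating_set G S"
begin

abbreviation E :: "'a rel" where "E \<equiv> cayley_edges G S"
abbreviation d :: "'a \<Rightarrow> 'a \<Rightarrow> nat" where "d \<equiv> edge_distance (cayley_edges G S)"

lemma S_subset: "S \<subseteq> carrier G"
  using generating by (simp add: generating_set_def)

lemma E_carrier: "E \<subseteq> carrier G \<times> carrier G"
  by (auto simp: cayley_edges_def)

lemma sym_E: "sym E"
  by (auto simp: cayley_edges_def sym_def)

lemma E_translate:
  assumes "(g, h) \<in> E" "x \<in> carrier G"
  shows "(x \<otimes> g, x \<otimes> h) \<in> E"
proof -
  from assms obtain s where s: "s \<in> S" "h = g \<otimes> s \<or> g = h \<otimes> s" "g \<in> carrier G" "h \<in> carrier G"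
    by (auto simp: cayley_edges_def)
  then have "x \<otimes> h = (x \<otimes> g) \<otimes> s \<or> x \<otimes> g = (x \<otimes> h) \<otimes> s"
    using assms S_subset by (auto simp: m_assoc)
  then show ?thesis using s assms by (auto simp: cayley_edges_def)
qed

lemma relpow_carrier:
  assumes "(g, h) \<in> E ^^ n" "g \<in> carrier G"
  shows "h \<in> carrier G"
  using assms by (induction n arbitrary: h) (use E_carrier in \<open>auto elim!: relcompE\<close>)

lemma relpow_translate:
  assumes "(g, h) \<in> E ^^ n" "x \<in> carrier G"
  shows "(x \<otimes> g, x \<otimes> h) \<in> E ^^ n"
  using assms by (induction n arbitrary: h) (auto intro: E_translate relcompI)

lemma relpow_sym:
  assumes "(g, h) \<in> E ^^ n"
  shows "(h, g) \<in> E ^^ n"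
  using assms
proof (induction n arbitrary: h)
  case (Suc n)
  then obtain k where "(g, k) \<in> E ^^ n" "(k, h) \<in> E" by auto
  then show ?case using Suc.IH sym_E relpow_Suc_I2[of h k E g n] by (auto dest: symD)
qed auto

lemma reachable_one:
  assumes "g \<in> carrier G"
  shows "\<exists>n. (\<one>, g) \<in> E ^^ n"
proof -
  have "g \<in> generate G S" using assms generating by (simp add: generating_set_def)
  then show ?thesis
  proof induction
    case one
    have "(\<one>, \<one>) \<in> E ^^ 0" by simp
    then show ?case by blast
  next
    case (incl h)
    then have "(\<one>, h) \<in> E ^^ 1" using S_subset by (force simp: cayley_edges_def)
    then show ?case by blast
  next
    case (inv h)
    then have "\<one> = inv h \<otimes> h" "h \<in> carrier G" using S_subset by auto
    then have "(\<one>, inv h) \<in> E ^^ 1" using inv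
      by (auto simp: cayley_edges_def intro!: bexI[of _ h])
    then show ?case by blast
  next
    case (eng h1 h2)
    then obtain n m where *: "(\<one>, h1) \<in> E ^^ n" "(\<one>, h2) \<in> E ^^ m" by blast
    have "h1 \<in> carrier G" using *(1) relpow_carrier by auto
    then have "(h1, h1 \<otimes> h2) \<in> E ^^ m" using relpow_translate[OF *(2)] by force
    then have "(\<one>, h1 \<otimes> h2) \<in> E ^^ (n + m)" using *(1) by (auto simp: relpow_add)
    then show ?case by blast
  qed
qed

lemma reachable:
  assumes "g \<in> carrier G" "h \<in> carrier G"
  shows "\<exists>n. (g, h) \<in> E ^^ n"
proof -
  obtain n where "(\<one>, inv g \<otimes> h) \<in> E ^^ n" using reachable_one assms by blast
  from relpow_translate[OF this assms(1)] have "(g, h) \<in> E ^^ n"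
    using assms by (simp add: m_assoc[symmetric])
  then show ?thesis ..
qed

lemma d_relpow: "g \<in> carrier G \<Longrightarrow> h \<in> carrier G \<Longrightarrow> (g, h) \<in> E ^^ d g h"
  unfolding edge_distance_def using reachable by (rule LeastI_ex)

lemma d_le: "(g, h) \<in> E ^^ n \<Longrightarrow> d g h \<le> n"
  unfolding edge_distance_def by (rule Least_le)

lemma d_refl [simp]: "d g g = 0"
  using d_le[of g g 0] by simp

lemma d_commute: "d g h = d h g"
  unfolding edge_distance_def using relpow_sym by metis

lemma d_triangle:
  assumes "g \<in> carrier G" "h \<in> carrier G" "k \<in> carrier G"
  shows "d g k \<le> d g h + d h k"
  using d_relpow[OF assms(1,2)] d_relpow[OF assms(2,3)] by (intro d_le) (auto simp: relpow_add)

lemma d_translate: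
  assumes "g \<in> carrier G" "h \<in> carrier G" "x \<in> carrier G"
  shows "d (x \<otimes> g) (x \<otimes> h) = d g h"
proof (rule antisym)
  show "d (x \<otimes> g) (x \<otimes> h) \<le> d g h"
    using assms d_relpow relpow_translate d_le by metis
  have "(inv x \<otimes> (x \<otimes> g), inv x \<otimes> (x \<otimes> h)) \<in> E ^^ d (x \<otimes> g) (x \<otimes> h)"
    using assms by (intro relpow_translate d_relpow) auto
  then show "d g h \<le> d (x \<otimes> g) (x \<otimes> h)"
    using assms by (intro d_le) (simp add: m_assoc[symmetric])
qed

lemma d_inv:
  assumes "g \<in> carrier G" "h \<in> carrier G"
  shows "d g h = d \<one> (inv g \<otimes> h)"
  using d_translate[of g h "inv g"] assms by simp

lemma d_mult_right:
  assumes "g \<in> carrier G" "x \<in> carrier G"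
  shows "d g (g \<otimes> x) = d \<one> x"
  using d_translate[of \<one> x g] assms by simp

lemma finite_ball:
  assumes "g \<in> carrier G"
  shows "finite {h. (g, h) \<in> E ^^ n}"
proof (induction n)
  case (Suc n)
  have "finite (E `` {h})" for h
  proof (rule finite_subset)
    show "E `` {h} \<subseteq> (\<lambda>s. h \<otimes> s) ` S \<union> (\<lambda>s. h \<otimes> inv s) ` S"
    proof
      fix k assume "k \<in> E `` {h}"
      then obtain s where "s \<in> S" "k = h \<otimes> s \<or> h = k \<otimes> s" "h \<in> carrier G" "k \<in> carrier G"
        by (auto simp: cayley_edges_def)
      moreover from this have "h = k \<otimes> s \<Longrightarrow> k = h \<otimes> inv s"
        using S_subset by (auto simp: m_assoc)
      ultimately show "k \<in> (\<lambda>s. h \<otimes> s) ` S \<union> (\<lambda>s. h \<otimes> inv s) ` S" by blast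
    qed
  qed (simp add: finite_S)
  then have "finite (\<Union>h\<in>{h. (g, h) \<in> E ^^ n}. E `` {h})" using Suc by blast
  moreover have "{h. (g, h) \<in> E ^^ Suc n} = (\<Union>h\<in>{h. (g, h) \<in> E ^^ n}. E `` {h})" by auto
  ultimately show ?case by simp
qed simp

lemma finite_d_ball:
  assumes "g \<in> carrier G"
  shows "finite {h \<in> carrier G. d g h \<le> n}"
proof (rule finite_subset)
  show "{h \<in> carrier G. d g h \<le> n} \<subseteq> (\<Union>m\<in>{..n}. {h. (g, h) \<in> E ^^ m})"
    using d_relpow[OF assms] by auto
qed (use finite_ball assms in auto)

text \<open>Countability is what later lets a vertex group act freely on the natural
  numbers.\<close>

lemma countable_carrier: "countable (carrier G)"
proof -
  have "countable (\<Union>n. {h. (\<one>, h) \<in> E ^^ n})"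
    using finite_ball by (intro countable_UN) (auto intro: countable_finite)
  then show ?thesis
    by (rule countable_subset[rotated]) (use reachable_one in auto)
qed

text \<open>A shortest edge path works: if two of its points were closer than their indices say, the
  triangle inequality would make the endpoints closer than \<open>d g h\<close>.\<close>

lemma geodesic_exists:
  assumes "g \<in> carrier G" "h \<in> carrier G"
  shows "\<exists>p. p 0 = g \<and> p (d g h) = h \<and> (\<forall>i\<le>d g h. p i \<in> carrier G) \<and>
           (\<forall>i j. i \<le> j \<and> j \<le> d g h \<longrightarrow> d (p i) (p j) = j - i)"
proof -
  obtain p where p: "p 0 = g" "p (d g h) = h" "\<And>i. i < d g h \<Longrightarrow> (p i, p (Suc i)) \<in> E"
    using d_relpow[OF assms] unfolding relpow_fun_conv by auto
  have pow: "(p i, p j) \<in> E ^^ (j - i)" if "i \<le> j" "j \<le> d g h" for i j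
    using that
  proof (induction j rule: dec_induct)
    case (step n)
    then show ?case using p(3)[of n] by (auto simp: Suc_diff_le)
  qed simp
  have car: "p i \<in> carrier G" if "i \<le> d g h" for i
    using pow[of 0 i] that relpow_carrier p(1) assms(1) by auto
  have "d (p i) (p j) = j - i" if ij: "i \<le> j" "j \<le> d g h" for i j
  proof (rule antisym)
    show "d (p i) (p j) \<le> j - i" using pow ij d_le by blast
    have "d g h \<le> d (p 0) (p i) + (d (p i) (p j) + d (p j) (p (d g h)))"
      using d_triangle[of "p 0" "p i" "p (d g h)"] d_triangle[of "p i" "p j" "p (d g h)"]
        car ij p(1,2) assms by force
    moreover have "d (p 0) (p i) \<le> i" using d_le[OF pow[of 0 i]] ij by simp
    moreover have "d (p j) (p (d g h)) \<le> d g h - j" using d_le[OF pow[of j "d g h"]] ij by simp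
    ultimately show "j - i \<le> d (p i) (p j)" using ij by linarith
  qed
  then show ?thesis using p(1,2) car by blast
qed

section \<open>Points of the Cayley graph compared with the vertices in their support\<close>

lemma cayley_graphE:
  assumes "p \<in> cayley_graph G S"
  obtains u v t where "p = edge_point u v t" "(u, v) \<in> E \<union> Id_on (carrier G)" "0 \<le> t" "t \<le> 1"
  using assms by (auto simp: cayley_graph_def realization_def)

lemma vertex_point_mem: "u \<in> carrier G \<Longrightarrow> vertex_point u \<in> cayley_graph G S"
  unfolding cayley_graph_def realization_def by force

lemma support_nonempty:
  assumes "p \<in> cayley_graph G S"
  shows "\<exists>u. 0 < p u"
proof -
  obtain u v t where *: "p = edge_point u v t" "0 \<le> t" "t \<le> 1"
    using assms by (rule cayley_graphE)
  then show ?thesis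
    by (cases "t = 0") (auto simp: edge_point_def intro: exI[of _ u] exI[of _ v])
qed

lemma support_carrier:
  assumes "p \<in> cayley_graph G S" "0 < p u"
  shows "u \<in> carrier G"
  using assms(1)
proof (rule cayley_graphE)
  fix a b t assume *: "p = edge_point a b t" "(a, b) \<in> E \<union> Id_on (carrier G)"
  have "u = a \<or> u = b" using assms(2) unfolding * by (auto simp: edge_point_def of_bool_def split: if_splits)
  then show ?thesis using * E_carrier by auto
qed

lemma cayley_graph_point_le_1:
  assumes "p \<in> cayley_graph G S"
  shows "p u \<le> 1"
  using assms by (rule cayley_graphE) (auto simp: edge_point_def)

lemma support_edge_le_1:
  assumes "(a, b) \<in> E\<^sup>=" "0 < edge_point a b s u" "0 < edge_point a b t v"
  shows "d u v \<le> 1"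
proof -
  have "u \<in> {a, b}" "v \<in> {a, b}"
    using assms(2,3) by (auto simp: edge_point_def of_bool_def split: if_splits)
  moreover have "d a b \<le> 1" using assms(1) d_le[of a b 1] by auto
  ultimately show ?thesis using d_commute by auto
qed

lemma support_le_1:
  assumes "p \<in> cayley_graph G S" "0 < p u" "0 < p v"
  shows "d u v \<le> 1"
  using assms(1)
proof (rule cayley_graphE)
  fix a b t assume "p = edge_point a b t" "(a, b) \<in> E \<union> Id_on (carrier G)"
  then show ?thesis using support_edge_le_1[of a b t u t v] assms by auto
qed

text \<open>A point is within 1 of every vertex in its support, which accounts for the error 2. From
  above, the detour through \<open>u\<close> and \<open>v\<close> is one of the candidates in the
  infimum. From below, two points of one edge have adjacent or equal support vertices, and a detour
  through other support vertices \<open>u'\<close>, \<open>v'\<close> changes the word distance by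
  at most 2.\<close>

lemma cayley_dist_approx:
  assumes p: "p \<in> cayley_graph G S" "0 < p u" and q: "q \<in> cayley_graph G S" "0 < q v"
  shows "\<bar>cayley_dist G S p q - real (d u v)\<bar> \<le> 2"
proof -
  let ?A = "{\<bar>s - t\<bar> | s t. \<exists>u v. (u, v) \<in> E\<^sup>= \<and> 0 \<le> s \<and> s \<le> 1 \<and> 0 \<le> t \<and> t \<le> 1 \<and>
                    p = edge_point u v s \<and> q = edge_point u v t}"
  let ?B = "{(1 - p u) + real (d u v) + (1 - q v) | u v. 0 < p u \<and> 0 < q v}"
  have dist: "cayley_dist G S p q = Inf (?A \<union> ?B)"
    by (simp add: cayley_dist_def realization_dist_def)
  have mem: "(1 - p u) + real (d u v) + (1 - q v) \<in> ?A \<union> ?B" using p q by blast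
  have "bdd_below (?A \<union> ?B)"
  proof (rule bdd_belowI[of _ 0])
    fix x assume "x \<in> ?A \<union> ?B"
    then show "0 \<le> x"
    proof
      assume "x \<in> ?B"
      then obtain u v where "x = (1 - p u) + real (d u v) + (1 - q v)" by blast
      then show ?thesis using cayley_graph_point_le_1[OF p(1), of u] cayley_graph_point_le_1[OF q(1), of v] by simp
    qed auto
  qed
  then have "Inf (?A \<union> ?B) \<le> (1 - p u) + real (d u v) + (1 - q v)"
    by (rule cInf_lower[OF mem])
  then have upper: "cayley_dist G S p q \<le> real (d u v) + 2" using dist p q by simp
  have "real (d u v) - 2 \<le> Inf (?A \<union> ?B)"
  proof (rule cInf_greatest)
    fix x assume "x \<in> ?A \<union> ?B"
    then show "real (d u v) - 2 \<le> x"
    proof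
      assume "x \<in> ?A"
      then obtain s t a b where "x = \<bar>s - t\<bar>" "(a, b) \<in> E\<^sup>=" "p = edge_point a b s" "q = edge_point a b t"
        by blast
      then show ?thesis using support_edge_le_1[of a b s u t v] p(2) q(2) by simp
    next
      assume "x \<in> ?B"
      then obtain u' v' where x: "x = (1 - p u') + real (d u' v') + (1 - q v')" and
          pos: "0 < p u'" "0 < q v'" by blast
      have car: "u \<in> carrier G" "v \<in> carrier G" "u' \<in> carrier G" "v' \<in> carrier G"
        using p q pos support_carrier by blast+
      have "d u v \<le> d u u' + (d u' v' + d v' v)"
        using d_triangle[of u u' v] d_triangle[of u' v' v] car by linarith
      moreover have "d u u' \<le> 1" "d v' v \<le> 1" using p q pos support_le_1 by blast+
      ultimately show ?thesis using x cayley_graph_point_le_1[OF p(1), of u'] cayley_graph_point_le_1[OF q(1), of v'] by simp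
    qed
  qed (use mem in blast)
  then show ?thesis using upper dist by linarith
qed

lemma cayley_dist_vertex:
  assumes "g \<in> carrier G" "h \<in> carrier G"
  shows "\<bar>cayley_dist G S (vertex_point g) (vertex_point h) - real (d g h)\<bar> \<le> 2"
  using assms by (intro cayley_dist_approx vertex_point_mem) (auto simp: edge_point_def)

end

text \<open>Homomorphisms are Lipschitz because a generator moves its image by a bounded amount. The
  sum over \<open>S\<close> stands in for the maximum, and \<open>+ 1\<close> secures
  \<open>L \<ge> 1\<close> for empty \<open>S\<close> too. Applied to the identity, this compares
  two finite generating sets of one group.\<close>

lemma hom_word_dist_le:
  assumes "fg_group A S" "fg_group B U" "f \<in> hom A B"
  shows "\<exists>L\<ge>1. \<forall>g\<in>carrier A. \<forall>h\<in>carrier A.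
           edge_distance (cayley_edges B U) (f g) (f h) \<le> L * edge_distance (cayley_edges A S) g h"
proof -
  interpret A: fg_group A S by fact
  interpret B: fg_group B U by fact
  interpret f: group_hom A B f by unfold_locales fact
  define L where "L = (\<Sum>s\<in>S. B.d \<one>\<^bsub>B\<^esub> (f s)) + 1"
  have step: "B.d (f g) (f h) \<le> L" if gh: "(g, h) \<in> A.E" for g h
  proof -
    have gen: "B.d (f x) (f (x \<otimes>\<^bsub>A\<^esub> s)) \<le> L" if "x \<in> carrier A" "s \<in> S" for x s
    proof -
      have "B.d (f x) (f (x \<otimes>\<^bsub>A\<^esub> s)) = B.d \<one>\<^bsub>B\<^esub> (f s)"
        using that A.S_subset by (simp add: B.d_mult_right subset_iff)
      also have "\<dots> \<le> (\<Sum>s\<in>S. B.d \<one>\<^bsub>B\<^esub> (f s))"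
        using that A.finite_S by (intro member_le_sum) auto
      finally show ?thesis by (simp add: L_def)
    qed
    from gh obtain s where "s \<in> S" "h = g \<otimes>\<^bsub>A\<^esub> s \<or> g = h \<otimes>\<^bsub>A\<^esub> s" "g \<in> carrier A" "h \<in> carrier A"
      by (auto simp: cayley_edges_def)
    then show ?thesis using gen B.d_commute by metis
  qed
  have pow: "B.d (f g) (f h) \<le> L * n" if "(g, h) \<in> A.E ^^ n" "g \<in> carrier A" for g h n
    using that
  proof (induction n arbitrary: h)
    case (Suc n)
    then obtain k where k: "(g, k) \<in> A.E ^^ n" "(k, h) \<in> A.E" by auto
    have "k \<in> carrier A" "h \<in> carrier A" using k A.E_carrier by auto
    then have "B.d (f g) (f h) \<le> B.d (f g) (f k) + B.d (f k) (f h)"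
      using Suc.prems by (intro B.d_triangle) auto
    also have "\<dots> \<le> L * n + L" using Suc k step by (intro add_mono) auto
    finally show ?case by simp
  qed simp
  have "L \<ge> 1" by (simp add: L_def)
  then show ?thesis using pow A.d_relpow by blast
qed

section \<open>Quasi-geodesics in Cayley graphs\<close>

lemma divide_le_self:
  fixes k y :: real
  assumes "1 \<le> k" "0 \<le> y"
  shows "y / k \<le> y"
  using assms frac_le[of y y 1 k] by simp

context fg_group
begin

text \<open>A quasi-geodesic of group elements is, through \<open>vertex_point\<close>, a
  quasi-geodesic of the Cayley graph; continuity is not asked of it. The comparison of distances
  costs 2 in \<open>c\<close> and another 2 in \<open>M\<close>.\<close>

lemma Morse_subset_vertices:
  assumes "H \<subseteq> carrier G"
    and Morse: "Morse_subset (cayley_graph G S) (cayley_dist G S) (vertex_point ` H)"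
  shows "Morse_subset (carrier G) (\<lambda>g h. real (d g h)) H"
  unfolding Morse_subset_def
proof (intro conjI allI impI)
  fix k c :: real assume k: "1 \<le> k" and c: "0 \<le> c"
  then have "0 \<le> c + 2" by simp
  with Morse k obtain M where M: "\<And>a b \<gamma>.
      quasi_geodesic (cayley_graph G S) (cayley_dist G S) k (c + 2) a b \<gamma> \<Longrightarrow>
      \<gamma> a \<in> vertex_point ` H \<Longrightarrow> \<gamma> b \<in> vertex_point ` H \<Longrightarrow>
      \<forall>t\<in>{a..b}. \<exists>y\<in>vertex_point ` H. cayley_dist G S (\<gamma> t) y \<le> M"
    unfolding Morse_subset_def by meson
  have "\<exists>y\<in>H. real (d (\<gamma> t) y) \<le> M + 2"
    if \<gamma>: "quasi_geodesic (carrier G) (\<lambda>g h. real (d g h)) k c a b \<gamma>" "\<gamma> a \<in> H" "\<gamma> b \<in> H"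
      and t: "t \<in> {a..b}" for a b \<gamma> t
  proof -
    have car: "\<gamma> s \<in> carrier G" if "s \<in> {a..b}" for s
      using \<gamma>(1) that by (auto simp: quasi_geodesic_def quasi_isometric_embedding_def)
    have "dist x y / k - (c + 2) \<le> cayley_dist G S (vertex_point (\<gamma> x)) (vertex_point (\<gamma> y)) \<and>
          cayley_dist G S (vertex_point (\<gamma> x)) (vertex_point (\<gamma> y)) \<le> k * dist x y + (c + 2)"
      if xy: "x \<in> {a..b}" "y \<in> {a..b}" for x y
    proof -
      have "dist x y / k - c \<le> d (\<gamma> x) (\<gamma> y)" "d (\<gamma> x) (\<gamma> y) \<le> k * dist x y + c"
        using \<gamma>(1) xy unfolding quasi_geodesic_def quasi_isometric_embedding_def by blast+
      then show ?thesis using cayley_dist_vertex[of "\<gamma> x" "\<gamma> y"] car xy by force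
    qed
    then have "quasi_geodesic (cayley_graph G S) (cayley_dist G S) k (c + 2) a b
        (\<lambda>s. vertex_point (\<gamma> s))"
      using \<gamma>(1) car vertex_point_mem
      by (auto simp: quasi_geodesic_def quasi_isometric_embedding_def)
    from M[OF this] obtain y where "y \<in> H"
      "cayley_dist G S (vertex_point (\<gamma> t)) (vertex_point y) \<le> M" using \<gamma> t by blast
    then show ?thesis
      using cayley_dist_vertex[of "\<gamma> t" y] car[OF t] assms(1) by (intro bexI[of _ y]) auto
  qed
  then show "\<exists>M. \<forall>a b \<gamma>. quasi_geodesic (carrier G) (\<lambda>g h. real (d g h)) k c a b \<gamma> \<and>
      \<gamma> a \<in> H \<and> \<gamma> b \<in> H \<longrightarrow> (\<forall>t\<in>{a..b}. \<exists>y\<in>H. real (d (\<gamma> t) y) \<le> M)"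
    by blast
qed (use assms in auto)

text \<open>Integer times allow a path to be centred at 0, extended at one end, reversed and
  extended again. Pairs with \<open>i \<le> j\<close> suffice since the word metric is
  symmetric.\<close>

definition int_quasi_geodesic :: "real \<Rightarrow> real \<Rightarrow> int \<Rightarrow> int \<Rightarrow> (int \<Rightarrow> 'a) \<Rightarrow> bool" where
  "int_quasi_geodesic k c p q \<gamma> \<longleftrightarrow>
     (\<forall>i\<in>{p..q}. \<gamma> i \<in> carrier G) \<and>
     (\<forall>i j :: int. p \<le> i \<and> i \<le> j \<and> j \<le> q \<longrightarrow>
        (real_of_int j - real_of_int i) / k - c \<le> real (d (\<gamma> i) (\<gamma> j)) \<and>
        real (d (\<gamma> i) (\<gamma> j)) \<le> k * (real_of_int j - real_of_int i) + c)"

text \<open>Rounding alters a time difference by at most 1, which costs k in the upper bound and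
  \<open>1 / k \<le> k\<close> in the lower one.\<close>

lemma int_quasi_geodesic_floor:
  assumes \<gamma>: "int_quasi_geodesic k c p q \<gamma>" and "p \<le> q" "1 \<le> k"
  shows "quasi_geodesic (carrier G) (\<lambda>g h. real (d g h)) k (c + k) (real_of_int p) (real_of_int q) (\<lambda>t. \<gamma> \<lfloor>t\<rfloor>)"
proof -
  have fl: "p \<le> \<lfloor>t\<rfloor>" "\<lfloor>t\<rfloor> \<le> q" if "t \<in> {real_of_int p..real_of_int q}" for t
    using that by (auto simp: le_floor_iff floor_le_iff)
  have le: "dist s t / k - (c + k) \<le> d (\<gamma> \<lfloor>s\<rfloor>) (\<gamma> \<lfloor>t\<rfloor>) \<and> d (\<gamma> \<lfloor>s\<rfloor>) (\<gamma> \<lfloor>t\<rfloor>) \<le> k * dist s t + (c + k)"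
    if st: "s \<in> {real_of_int p..real_of_int q}" "t \<in> {real_of_int p..real_of_int q}" "s \<le> t" for s t
  proof -
    define \<delta> where "\<delta> = real_of_int (\<lfloor>t\<rfloor> - \<lfloor>s\<rfloor>)"
    have "\<lfloor>s\<rfloor> \<le> \<lfloor>t\<rfloor>" using st by (simp add: floor_mono)
    then have *: "\<delta> / k - c \<le> d (\<gamma> \<lfloor>s\<rfloor>) (\<gamma> \<lfloor>t\<rfloor>)" "d (\<gamma> \<lfloor>s\<rfloor>) (\<gamma> \<lfloor>t\<rfloor>) \<le> k * \<delta> + c"
      using \<gamma> fl st unfolding int_quasi_geodesic_def \<delta>_def by (metis of_int_diff)+
    have \<delta>: "dist s t \<le> \<delta> + 1" "\<delta> \<le> dist s t + 1"
      using st(3) by (auto simp: dist_real_def \<delta>_def) linarith+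
    have "dist s t / k \<le> (\<delta> + 1) / k" using \<delta>(1) assms(3) by (simp add: divide_right_mono)
    also have "\<dots> \<le> \<delta> / k + k"
      using order_trans[OF divide_le_self[OF assms(3), of 1] assms(3)] by (simp add: add_divide_distrib)
    finally have 1: "dist s t / k \<le> \<delta> / k + k" .
    have "k * \<delta> \<le> k * (dist s t + 1)" using \<delta>(2) assms(3) by (intro mult_left_mono) auto
    then show ?thesis using * 1 by (auto simp: algebra_simps)
  qed
  have "dist s t / k - (c + k) \<le> d (\<gamma> \<lfloor>s\<rfloor>) (\<gamma> \<lfloor>t\<rfloor>) \<and> d (\<gamma> \<lfloor>s\<rfloor>) (\<gamma> \<lfloor>t\<rfloor>) \<le> k * dist s t + (c + k)"
    if "s \<in> {real_of_int p..real_of_int q}" "t \<in> {real_of_int p..real_of_int q}" for s t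
    using le[of s t] le[of t s] that d_commute[of "\<gamma> \<lfloor>s\<rfloor>"] dist_commute[of s t]
    by (cases "s \<le> t") auto
  then show ?thesis
    using assms(2) fl \<gamma> unfolding quasi_geodesic_def quasi_isometric_embedding_def
    by (auto simp: int_quasi_geodesic_def)
qed

lemma Morse_int_quasi_geodesic:
  assumes "Morse_subset (carrier G) (\<lambda>g h. real (d g h)) H" "1 \<le> k" "0 \<le> c"
  shows "\<exists>M. \<forall>p q \<gamma>. int_quasi_geodesic k c p q \<gamma> \<and> \<gamma> p \<in> H \<and> \<gamma> q \<in> H \<longrightarrow>
           (\<forall>i\<in>{p..q}. \<exists>y\<in>H. real (d (\<gamma> i) y) \<le> M)"
proof -
  have "0 \<le> c + k" using assms by simp
  with assms obtain M where M: "\<And>a b \<gamma>.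
      quasi_geodesic (carrier G) (\<lambda>g h. real (d g h)) k (c + k) a b \<gamma> \<and> \<gamma> a \<in> H \<and> \<gamma> b \<in> H \<longrightarrow>
        (\<forall>t\<in>{a..b}. \<exists>y\<in>H. real (d (\<gamma> t) y) \<le> M)"
    unfolding Morse_subset_def by meson
  have "\<exists>y\<in>H. real (d (\<gamma> i) y) \<le> M"
    if "int_quasi_geodesic k c p q \<gamma>" "\<gamma> p \<in> H" "\<gamma> q \<in> H" "i \<in> {p..q}" for p q \<gamma> i
  proof -
    have "p \<le> q" using that by auto
    from M[of p q "\<lambda>t. \<gamma> \<lfloor>t\<rfloor>"] int_quasi_geodesic_floor[OF that(1) this assms(2)] that
    have "\<forall>t\<in>{real_of_int p..real_of_int q}. \<exists>y\<in>H. real (d (\<gamma> \<lfloor>t\<rfloor>) y) \<le> M" by simp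
    from bspec[OF this, of "real_of_int i"] show ?thesis using that by simp
  qed
  then show ?thesis by blast
qed

lemma int_quasi_geodesic_reverse:
  assumes "int_quasi_geodesic k c p q \<gamma>"
  shows "int_quasi_geodesic k c (- q) (- p) (\<lambda>i. \<gamma> (- i))"
  unfolding int_quasi_geodesic_def
proof (intro conjI ballI allI impI)
  fix i j assume ij: "- q \<le> i \<and> i \<le> j \<and> j \<le> - p"
  then have "p \<le> - j \<and> - j \<le> - i \<and> - i \<le> q" by auto
  with assms have "(real_of_int (- i) - real_of_int (- j)) / k - c \<le> d (\<gamma> (- j)) (\<gamma> (- i))"
      "d (\<gamma> (- j)) (\<gamma> (- i)) \<le> k * (real_of_int (- i) - real_of_int (- j)) + c"
    unfolding int_quasi_geodesic_def by blast+
  then show "(real_of_int j - real_of_int i) / k - c \<le> d (\<gamma> (- i)) (\<gamma> (- j))"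
    "d (\<gamma> (- i)) (\<gamma> (- j)) \<le> k * (real_of_int j - real_of_int i) + c"
    by (simp_all add: d_commute[of "\<gamma> (- i)"])
qed (use assms in \<open>auto simp: int_quasi_geodesic_def\<close>)

text \<open>Leaving \<open>\<gamma>\<close> at a point nearest to \<open>h\<close> makes the constants of the extended path
  independent of the distance from \<open>h\<close> to \<open>\<gamma>\<close>.\<close>

lemma int_quasi_geodesic_extend:
  assumes \<gamma>: "int_quasi_geodesic k c p q \<gamma>" and "1 \<le> k" "0 \<le> c" "p \<le> q" and h: "h \<in> carrier G"
  shows "\<exists>m \<gamma>'. p \<le> m \<and> m \<le> q \<and> d (\<gamma> m) h \<le> d (\<gamma> q) h \<and>
           int_quasi_geodesic (3 * k) c p (m + int (d (\<gamma> m) h)) \<gamma>' \<and>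
           \<gamma>' (m + int (d (\<gamma> m) h)) = h \<and> (\<forall>i. i \<le> m \<longrightarrow> \<gamma>' i = \<gamma> i)"
proof -
  have car: "\<gamma> i \<in> carrier G" if "p \<le> i" "i \<le> q" for i
    using \<gamma> that by (simp add: int_quasi_geodesic_def)
  obtain m where m: "p \<le> m" "m \<le> q" and min: "\<And>i. p \<le> i \<Longrightarrow> i \<le> q \<Longrightarrow> d (\<gamma> m) h \<le> d (\<gamma> i) h"
  proof -
    have "finite {p..q}" "{p..q} \<noteq> {}" using assms(4) by auto
    from ex_min_if_finite[of "(\<lambda>i. d (\<gamma> i) h) ` {p..q}"] this
    obtain m where "m \<in> {p..q}" "\<forall>i\<in>{p..q}. \<not> d (\<gamma> i) h < d (\<gamma> m) h" by auto
    then show ?thesis using that[of m] by force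
  qed
  let ?D = "d (\<gamma> m) h"
  obtain \<delta> where \<delta>: "\<delta> 0 = \<gamma> m" "\<delta> ?D = h" "\<And>i. i \<le> ?D \<Longrightarrow> \<delta> i \<in> carrier G"
      "\<And>i j. i \<le> j \<Longrightarrow> j \<le> ?D \<Longrightarrow> d (\<delta> i) (\<delta> j) = j - i"
    using geodesic_exists[OF car[OF m] h] by blast
  define \<gamma>' where "\<gamma>' = (\<lambda>i. if i \<le> m then \<gamma> i else \<delta> (nat (i - m)))"
  have qg: "(real_of_int j - real_of_int i) / k - c \<le> d (\<gamma> i) (\<gamma> j)" "d (\<gamma> i) (\<gamma> j) \<le> k * (real_of_int j - real_of_int i) + c"
    if "p \<le> i" "i \<le> j" "j \<le> q" for i j
    using \<gamma> that unfolding int_quasi_geodesic_def by blast+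
  have "int_quasi_geodesic (3 * k) c p (m + int ?D) \<gamma>'"
    unfolding int_quasi_geodesic_def
  proof (intro conjI ballI allI impI)
    fix i assume "i \<in> {p..m + int ?D}"
    then show "\<gamma>' i \<in> carrier G" using car m \<delta>(3) by (auto simp: \<gamma>'_def)
  next
    fix i j assume ij: "p \<le> i \<and> i \<le> j \<and> j \<le> m + int ?D"
    have nn: "0 \<le> real_of_int j - real_of_int i" using ij by simp
    have grow: "(real_of_int j - real_of_int i) / (3 * k) \<le> x" if "(real_of_int j - real_of_int i) / k \<le> 3 * x" for x :: real
      using that assms(2) by (simp add: field_simps)
    have k3: "k * (real_of_int j - real_of_int i) \<le> 3 * k * (real_of_int j - real_of_int i)" using nn assms(2) by (simp add: mult_right_mono)
    have "(real_of_int j - real_of_int i) / (3 * k) - c \<le> d (\<gamma>' i) (\<gamma>' j) \<and> d (\<gamma>' i) (\<gamma>' j) \<le> 3 * k * (real_of_int j - real_of_int i) + c"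
    proof -
      consider "j \<le> m" | "m < i" | "i \<le> m" "m < j" by linarith
      then show ?thesis
      proof cases
        case 1
        then have "(real_of_int j - real_of_int i) / k - c \<le> d (\<gamma> i) (\<gamma> j)" "d (\<gamma> i) (\<gamma> j) \<le> k * (real_of_int j - real_of_int i) + c"
          using qg[of i j] ij m by auto
        moreover have "(real_of_int j - real_of_int i) / (3 * k) \<le> (real_of_int j - real_of_int i) / k" using nn assms(2)
          by (intro divide_left_mono) auto
        ultimately show ?thesis using 1 ij k3 by (auto simp: \<gamma>'_def)
      next
        case 2
        then have "d (\<gamma>' i) (\<gamma>' j) = nat (j - m) - nat (i - m)"
          using \<delta>(4)[of "nat (i - m)" "nat (j - m)"] ij by (simp add: \<gamma>'_def nat_le_iff)
        then have "int (d (\<gamma>' i) (\<gamma>' j)) = j - i" using 2 ij by linarith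
        then have "real (d (\<gamma>' i) (\<gamma>' j)) = real_of_int j - real_of_int i" by linarith
        moreover have "(real_of_int j - real_of_int i) \<le> k * (real_of_int j - real_of_int i)"
          using mult_right_mono[OF assms(2) nn] by simp
        moreover have "(real_of_int j - real_of_int i) / (3 * k) \<le> real_of_int j - real_of_int i"
          using divide_le_self[of "3 * k" "real_of_int j - real_of_int i"] nn assms(2) by simp
        ultimately show ?thesis using k3 assms(3) by auto
      next
        case 3
        define n where "n = nat (j - m)"
        have n: "n \<le> ?D" "int n = j - m" using 3 ij by (auto simp: n_def)
        have eq: "\<gamma>' i = \<gamma> i" "\<gamma>' j = \<delta> n" using 3 by (auto simp: \<gamma>'_def n_def)
        have ci: "\<gamma> i \<in> carrier G" "\<gamma> m \<in> carrier G" "\<delta> n \<in> carrier G"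
          using car 3 ij m \<delta>(3) n by auto
        let ?x = "real (d (\<gamma> i) (\<delta> n))"
        have dn: "d (\<gamma> m) (\<delta> n) = n" "d (\<delta> n) h = ?D - n"
          using \<delta>(4)[of 0 n] \<delta>(4)[of n ?D] n \<delta>(1,2) by auto
        have im: "(real_of_int m - real_of_int i) / k - c \<le> d (\<gamma> i) (\<gamma> m)" "d (\<gamma> i) (\<gamma> m) \<le> k * (real_of_int m - real_of_int i) + c"
          using qg[of i m] 3 ij m by auto
        \<comment> \<open>\<open>\<delta> n\<close> has only \<open>?D - n\<close> left to
          \<open>h\<close>, while by the choice of \<open>m\<close> no point of
          \<open>\<gamma>\<close> is closer to \<open>h\<close> than \<open>?D\<close>.\<close>
        have nx: "n \<le> ?x"
          using min[of i] d_triangle[of "\<gamma> i" "\<delta> n" h] ci h dn n 3 ij m by linarith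
        have "d (\<gamma> i) (\<gamma> m) \<le> ?x + n"
          using d_triangle[of "\<gamma> i" "\<delta> n" "\<gamma> m"] ci dn d_commute[of "\<delta> n" "\<gamma> m"] by linarith
        then have "(real_of_int m - real_of_int i) / k \<le> 2 * ?x + c"
          using im(1) nx by (simp only: diff_le_eq)
        moreover have "n / k \<le> ?x"
          using nx divide_le_self[OF assms(2), of n] by simp
        \<comment> \<open>The source of the factor 3: the part along \<open>\<gamma>\<close> is paid
          for by \<open>2 * ?x + c\<close>, the part along the detour by one more
          \<open>?x\<close>.\<close>
        ultimately have "(real_of_int m - real_of_int i) / k + n / k \<le> (2 * ?x + c) + ?x"
          by (rule add_mono)
        moreover have "(real_of_int m - real_of_int i) / k + n / k = (real_of_int j - real_of_int i) / k"
        proof -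
          have "real_of_int j = m + real n" using n(2) by linarith
          then show ?thesis by (simp add: add_divide_distrib[symmetric])
        qed
        ultimately have "(real_of_int j - real_of_int i) / k \<le> 3 * (?x + c / 3)" by simp
        from grow[OF this] have low: "(real_of_int j - real_of_int i) / (3 * k) - c \<le> ?x" using assms(3) by linarith
        have "?x \<le> d (\<gamma> i) (\<gamma> m) + real n"
          using d_triangle[of "\<gamma> i" "\<gamma> m" "\<delta> n"] ci dn by linarith
        also have "\<dots> \<le> k * (real_of_int m - real_of_int i) + c + k * n"
          using im mult_right_mono[OF assms(2), of "real n"] by simp
        also have "\<dots> = k * (real_of_int j - real_of_int i) + c"
        proof -
          have "real n = real_of_int j - m" using n(2) by linarith
          then have "k * real n = k * real_of_int j - k * real_of_int m" by (simp add: right_diff_distrib)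
          then show ?thesis by (simp add: right_diff_distrib)
        qed
        finally show ?thesis using low k3 eq by auto
      qed
    qed
    then show "(real_of_int j - real_of_int i) / (3 * k) - c \<le> d (\<gamma>' i) (\<gamma>' j)" "d (\<gamma>' i) (\<gamma>' j) \<le> 3 * k * (real_of_int j - real_of_int i) + c"
      by blast+
  qed
  moreover have "\<gamma>' (m + int ?D) = h"
  proof (cases "?D = 0")
    case True
    then show ?thesis using \<delta>(1,2) by (simp add: \<gamma>'_def)
  qed (simp add: \<gamma>'_def \<delta>(2))
  moreover have "\<forall>i. i \<le> m \<longrightarrow> \<gamma>' i = \<gamma> i" by (simp add: \<gamma>'_def)
  ultimately show ?thesis using m min[of q] assms(4) by blast
qed

end

section \<open>Strongly quasiconvex subgroups and undistorted subgroups\<close>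

text \<open>\<open>A\<close> is kept as an abstract group with its own word metric, not as a
  subgroup of \<open>G\<close>, because the condition on strongly quasiconvex subgroups is about the
  vertex group itself.\<close>

locale undistorted_map = G?: fg_group G S + A: fg_group A U
  for G (structure) and S and A (structure) and U +
  fixes i :: "'c \<Rightarrow> 'a" and k c :: real and H :: "'a set"
  assumes i_hom: "i \<in> hom A G" and k: "1 \<le> k" and c: "0 \<le> c"
    and qi: "x \<in> carrier A \<Longrightarrow> y \<in> carrier A \<Longrightarrow>
          A.d x y / k - c \<le> G.d (i x) (i y) \<and> G.d (i x) (i y) \<le> k * A.d x y + c"
    and H: "subgroup H G"
    and Morse_H: "Morse_subset (carrier G) (\<lambda>g h. real (G.d g h)) H"
begin

sublocale i: group_hom A G i
  by unfold_locales (rule i_hom)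

sublocale H: subgroup H G
  by (rule H)

text \<open>The stabiliser in \<open>H\<close> of the coset \<open>g \<otimes> i(A)\<close>, which
  is the intersection of \<open>H\<close> with a conjugate of \<open>i(A)\<close>, pulled back to
  \<open>A\<close>.\<close>

definition K :: "'a \<Rightarrow> 'c set" where
  "K g = {x \<in> carrier A. g \<otimes> i x \<otimes> inv g \<in> H}"

lemma subgroup_K:
  assumes g: "g \<in> carrier G"
  shows "subgroup (K g) A"
proof (rule A.subgroupI)
  show "K g \<subseteq> carrier A" by (auto simp: K_def)
  have "\<one>\<^bsub>A\<^esub> \<in> K g" using g by (simp add: K_def)
  then show "K g \<noteq> {}" by blast
next
  fix x assume x: "x \<in> K g"
  then have "inv (g \<otimes> i x \<otimes> inv g) \<in> H" by (auto simp: K_def)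
  then show "inv\<^bsub>A\<^esub> x \<in> K g" using x g by (auto simp: K_def G.inv_mult_group G.m_assoc)
next
  fix x y assume xy: "x \<in> K g" "y \<in> K g"
  then have "(g \<otimes> i x \<otimes> inv g) \<otimes> (g \<otimes> i y \<otimes> inv g) \<in> H"
    by (auto simp: K_def)
  moreover have "inv g \<otimes> (g \<otimes> (i y \<otimes> inv g)) = i y \<otimes> inv g"
    using xy g by (simp add: K_def G.m_assoc[symmetric])
  ultimately show "x \<otimes>\<^bsub>A\<^esub> y \<in> K g" using xy g by (auto simp: K_def G.m_assoc)
qed

text \<open>Right multiplication by \<open>inv g\<close> moves every point by the length of
  \<open>g\<close>. Hence for \<open>x \<in> K g\<close> the point \<open>g \<otimes> i x\<close> of
  the coset is that close to an element of \<open>H\<close>.\<close>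

lemma d_conj_point:
  assumes g: "g \<in> carrier G" and x: "x \<in> carrier G"
  shows "G.d (g \<otimes> x \<otimes> inv g) (g \<otimes> x) = G.d \<one> g"
  using G.d_mult_right[of "g \<otimes> x" "inv g"] G.d_translate[of "inv g" "\<one>" g] g x
  by (simp add: G.d_commute)

text \<open>Only finitely many elements \<open>b\<close> of length at most \<open>n\<close> can lead from a point \<open>g \<otimes> i x\<close> to \<open>H\<close>;
  two points \<open>x\<close> and \<open>\<xi> b\<close> with the same \<open>b\<close> differ by an element of \<open>K g\<close>.\<close>

lemma near_H_imp_near_K:
  assumes g: "g \<in> carrier G"
  shows "\<exists>N. \<forall>x\<in>carrier A. \<forall>y\<in>H. G.d (g \<otimes> i x) y \<le> n \<longrightarrow> (\<exists>z\<in>K g. A.d x z \<le> N)"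
proof -
  define P where "P = (\<lambda>b x. x \<in> carrier A \<and> g \<otimes> i x \<otimes> b \<in> H)"
  define \<xi> where "\<xi> = (\<lambda>b. SOME x. P b x)"
  define B where "B = {b \<in> carrier G. G.d \<one> b \<le> n}"
  define N where "N = (\<Sum>b\<in>B. A.d \<one>\<^bsub>A\<^esub> (inv\<^bsub>A\<^esub> \<xi> b))"
  have fin: "finite B" unfolding B_def by (intro G.finite_d_ball) simp
  have "\<exists>z\<in>K g. A.d x z \<le> N" if x: "x \<in> carrier A" and y: "y \<in> H" "G.d (g \<otimes> i x) y \<le> n" for x y
  proof -
    have y': "y \<in> carrier G" using y by simp
    define b where "b = inv (g \<otimes> i x) \<otimes> y"
    have b: "b \<in> B" using y y' g x G.d_inv[of "g \<otimes> i x" y] by (simp add: B_def b_def)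
    then have bc: "b \<in> carrier G" by (simp add: B_def)
    have xb: "g \<otimes> i x \<otimes> b = y"
      unfolding b_def using g x y' by (simp add: G.m_assoc[symmetric])
    then have "P b x" using x y by (simp add: P_def)
    then have "P b (\<xi> b)" unfolding \<xi>_def by (rule someI)
    then have \<xi>: "\<xi> b \<in> carrier A" "g \<otimes> i (\<xi> b) \<otimes> b \<in> H" by (auto simp: P_def)
    let ?z = "x \<otimes>\<^bsub>A\<^esub> inv\<^bsub>A\<^esub> \<xi> b"
    have eq: "inv (g \<otimes> i (\<xi> b) \<otimes> b) =
        inv b \<otimes> inv i (\<xi> b) \<otimes> inv g"
      using g bc \<xi> by (simp add: G.inv_mult_group G.m_assoc)
    have "(g \<otimes> i x \<otimes> b) \<otimes> inv (g \<otimes> i (\<xi> b) \<otimes> b) \<in> H"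
      using xb y \<xi> by simp
    also have "(g \<otimes> i x \<otimes> b) \<otimes> inv (g \<otimes> i (\<xi> b) \<otimes> b) =
        g \<otimes> i x \<otimes> (b \<otimes> inv b) \<otimes> (inv i (\<xi> b) \<otimes> inv g)"
      unfolding eq using g x bc \<xi> by (simp only: G.m_assoc G.m_closed G.inv_closed i.hom_closed)
    also have "\<dots> = g \<otimes> i ?z \<otimes> inv g"
      using g x bc \<xi> by (simp add: G.m_assoc)
    finally have "?z \<in> K g" using x \<xi> by (simp add: K_def)
    moreover have "A.d x ?z = A.d \<one>\<^bsub>A\<^esub> (inv\<^bsub>A\<^esub> \<xi> b)" using x \<xi> by (simp add: A.d_mult_right)
    moreover have "A.d \<one>\<^bsub>A\<^esub> (inv\<^bsub>A\<^esub> \<xi> b) \<le> N"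
      unfolding N_def using b fin by (intro member_le_sum) auto
    ultimately show ?thesis by (intro bexI[of _ ?z]) simp_all
  qed
  then show ?thesis by blast
qed

text \<open>The errors accumulate as follows: passing from points to support vertices adds 2 to
  \<open>c'\<close>, the embedding \<open>i\<close> turns \<open>(k', c' + 2)\<close> into
  \<open>(k * k', k * (c' + 2) + c)\<close>, left translation by \<open>g\<close> is an isometry,
  and replacing both points by points within \<open>D\<close> adds \<open>2 * D\<close>.\<close>

lemma quasi_geodesic_image:
  assumes g: "g \<in> carrier G" and k': "1 \<le> k'" and c': "0 \<le> c'"
    and \<gamma>: "quasi_geodesic (cayley_graph A U) (cayley_dist A U) k' c' a b \<gamma>"
    and \<rho>: "\<And>t. t \<in> {a..b} \<Longrightarrow> 0 < \<gamma> t (\<rho> t)"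
    and \<eta>: "\<And>t. t \<in> {a..b} \<Longrightarrow> \<eta> t \<in> carrier G \<and> real (G.d (\<eta> t) (g \<otimes> i (\<rho> t))) \<le> D"
  shows "quasi_geodesic (carrier G) (\<lambda>g h. real (G.d g h)) (k * k') (k * (c' + 2) + c + 2 * D) a b \<eta>"
proof -
  have \<gamma>_car: "\<gamma> t \<in> cayley_graph A U" if "t \<in> {a..b}" for t
    using \<gamma> that by (auto simp: quasi_geodesic_def quasi_isometric_embedding_def)
  have \<rho>_car: "\<rho> t \<in> carrier A" if "t \<in> {a..b}" for t
    using A.support_carrier[OF \<gamma>_car \<rho>] that by blast
  have "dist s t / (k * k') - (k * (c' + 2) + c + 2 * D) \<le> G.d (\<eta> s) (\<eta> t) \<and>
      G.d (\<eta> s) (\<eta> t) \<le> k * k' * dist s t + (k * (c' + 2) + c + 2 * D)"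
    if st: "s \<in> {a..b}" "t \<in> {a..b}" for s t
  proof -
    have 1: "dist s t / k' - c' \<le> cayley_dist A U (\<gamma> s) (\<gamma> t)"
        "cayley_dist A U (\<gamma> s) (\<gamma> t) \<le> k' * dist s t + c'"
      using \<gamma> st unfolding quasi_geodesic_def quasi_isometric_embedding_def by blast+
    have 2: "\<bar>cayley_dist A U (\<gamma> s) (\<gamma> t) - A.d (\<rho> s) (\<rho> t)\<bar> \<le> 2"
      using st by (intro A.cayley_dist_approx \<gamma>_car \<rho>)
    let ?a = "real (A.d (\<rho> s) (\<rho> t))" and ?g = "real (G.d (i (\<rho> s)) (i (\<rho> t)))"
    have car: "i (\<rho> s) \<in> carrier G" "i (\<rho> t) \<in> carrier G" using \<rho>_car st by auto
    have 3: "?a / k - c \<le> ?g" "?g \<le> k * ?a + c" using qi \<rho>_car st by blast+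
    have a: "dist s t / k' - (c' + 2) \<le> ?a" "?a \<le> k' * dist s t + (c' + 2)" using 1 2 by linarith+
    let ?p = "g \<otimes> i (\<rho> s)" and ?q = "g \<otimes> i (\<rho> t)"
    have pq: "?g = G.d ?p ?q" using G.d_translate car g by simp
    have "G.d (\<eta> s) (\<eta> t) \<le> G.d (\<eta> s) ?p + (G.d ?p ?q + G.d ?q (\<eta> t))"
      using G.d_triangle[of "\<eta> s" ?p "\<eta> t"] G.d_triangle[of ?p ?q "\<eta> t"] g car \<eta> st by force
    then have up: "real (G.d (\<eta> s) (\<eta> t)) \<le> ?g + 2 * D"
      using \<eta>[OF st(1)] \<eta>[OF st(2)] pq G.d_commute[of ?q "\<eta> t"] by linarith
    have "G.d ?p ?q \<le> G.d ?p (\<eta> s) + (G.d (\<eta> s) (\<eta> t) + G.d (\<eta> t) ?q)"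
      using G.d_triangle[of ?p "\<eta> s" ?q] G.d_triangle[of "\<eta> s" "\<eta> t" ?q] g car \<eta> st by force
    then have low: "?g - 2 * D \<le> real (G.d (\<eta> s) (\<eta> t))"
      using \<eta>[OF st(1)] \<eta>[OF st(2)] pq G.d_commute[of ?p "\<eta> s"] by linarith
    have "k * ?a \<le> k * (k' * dist s t + (c' + 2))" using a(2) k by (intro mult_left_mono) auto
    then have A: "?g \<le> k * k' * dist s t + (k * (c' + 2) + c)" using 3(2) by (simp add: algebra_simps)
    have "(dist s t / k' - (c' + 2)) / k \<le> ?a / k" using a(1) k by (intro divide_right_mono) auto
    then have "dist s t / (k * k') - (c' + 2) / k \<le> ?a / k"
      by (simp add: diff_divide_distrib mult.commute)
    moreover have "(c' + 2) / k \<le> k * (c' + 2)"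
      using order_trans[OF divide_le_self[OF k, of "c' + 2"]] mult_right_mono[OF k, of "c' + 2"] c' by simp
    ultimately have B: "dist s t / (k * k') - (k * (c' + 2) + c) \<le> ?g" using 3(1) by linarith
    show ?thesis using A B up low by linarith
  qed
  then show ?thesis
    using \<gamma> \<eta> by (auto simp: quasi_geodesic_def quasi_isometric_embedding_def)
qed

text \<open>A quasi-geodesic of \<open>A\<close> between points of \<open>K g\<close> is sent by
  \<open>x \<mapsto> g \<otimes> i x\<close> to one of \<open>G\<close> whose ends are near
  \<open>H\<close>. The Morse property keeps it near \<open>H\<close>, and
  \<open>near_H_imp_near_K\<close> translates this back into nearness to \<open>K g\<close> inside
  \<open>A\<close>.\<close>

lemma strongly_quasiconvex_K:
  assumes g: "g \<in> carrier G"
  shows "strongly_quasiconvex A (K g)"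
proof -
  define D where "D = real (G.d \<one> g)"
  have K_sub: "K g \<subseteq> carrier A" by (auto simp: K_def)
  have "\<exists>M. \<forall>a b \<gamma>. quasi_geodesic (cayley_graph A U) (cayley_dist A U) k' c' a b \<gamma> \<and>
      \<gamma> a \<in> vertex_point ` K g \<and> \<gamma> b \<in> vertex_point ` K g \<longrightarrow>
      (\<forall>t\<in>{a..b}. \<exists>y\<in>vertex_point ` K g. cayley_dist A U (\<gamma> t) y \<le> M)"
    if k': "1 \<le> k'" and c': "0 \<le> c'" for k' c'
  proof -
    let ?k = "k * k'" and ?c = "k * (c' + 2) + c + 2 * D"
    have "1 \<le> ?k" using k k' mult_mono[OF k k'] by simp
    moreover have "0 \<le> ?c" using k c c' by (simp add: D_def)
    ultimately obtain M where M: "\<And>a b \<gamma>.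
      quasi_geodesic (carrier G) (\<lambda>g h. real (G.d g h)) ?k ?c a b \<gamma> \<Longrightarrow> \<gamma> a \<in> H \<Longrightarrow> \<gamma> b \<in> H \<Longrightarrow>
        (\<forall>t\<in>{a..b}. \<exists>y\<in>H. real (G.d (\<gamma> t) y) \<le> M)"
      using Morse_H unfolding Morse_subset_def by meson
    \<comment> \<open>The Morse bound \<open>M\<close> will hold for a path \<open>\<eta>\<close>
      that differs from the translated one by up to \<open>D\<close>.\<close>
    obtain N where N: "\<And>x y. x \<in> carrier A \<Longrightarrow> y \<in> H \<Longrightarrow>
        G.d (g \<otimes> i x) y \<le> nat \<lceil>M + D\<rceil> \<Longrightarrow> \<exists>z\<in>K g. A.d x z \<le> N"
      using near_H_imp_near_K[OF g] by blast
    have "\<exists>y\<in>vertex_point ` K g. cayley_dist A U (\<gamma> t) y \<le> real N + 2"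
      if \<gamma>: "quasi_geodesic (cayley_graph A U) (cayley_dist A U) k' c' a b \<gamma>"
        "\<gamma> a \<in> vertex_point ` K g" "\<gamma> b \<in> vertex_point ` K g" and t: "t \<in> {a..b}" for a b \<gamma> t
    proof -
      have \<gamma>_car: "\<gamma> t \<in> cayley_graph A U" if "t \<in> {a..b}" for t
        using \<gamma>(1) that by (auto simp: quasi_geodesic_def quasi_isometric_embedding_def)
      define \<rho> where "\<rho> = (\<lambda>t. SOME u. 0 < \<gamma> t u)"
      have \<rho>: "0 < \<gamma> t (\<rho> t)" if "t \<in> {a..b}" for t
        unfolding \<rho>_def using A.support_nonempty[OF \<gamma>_car[OF that]] by (rule someI_ex)
      have \<rho>_car: "\<rho> t \<in> carrier A" if "t \<in> {a..b}" for t
        using A.support_carrier[OF \<gamma>_car \<rho>] that by blast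
      have ends: "\<rho> s \<in> K g" if "\<gamma> s \<in> vertex_point ` K g" "s \<in> {a..b}" for s
        using \<rho>[OF that(2)] that(1) by (auto simp: edge_point_def split: if_splits)
      \<comment> \<open>The jumps at both ends, of length at most \<open>D\<close>, make the path start and end in \<open>H\<close>.\<close>
      define \<eta> where "\<eta> = (\<lambda>t. if t = a \<or> t = b then g \<otimes> i (\<rho> t) \<otimes> inv g else g \<otimes> i (\<rho> t))"
      have \<eta>: "\<eta> t \<in> carrier G \<and> real (G.d (\<eta> t) (g \<otimes> i (\<rho> t))) \<le> D" if "t \<in> {a..b}" for t
        using \<rho>_car[OF that] g by (auto simp: \<eta>_def D_def d_conj_point)
      have ab: "a \<in> {a..b}" "b \<in> {a..b}" using t by auto
      have "\<eta> a \<in> H" "\<eta> b \<in> H" using ends[OF \<gamma>(2) ab(1)] ends[OF \<gamma>(3) ab(2)]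
        by (auto simp: \<eta>_def K_def)
      from M[OF quasi_geodesic_image[OF g k' c' \<gamma>(1) \<rho> \<eta>] this] t
      obtain y where y: "y \<in> H" "real (G.d (\<eta> t) y) \<le> M" by blast
      have "G.d (g \<otimes> i (\<rho> t)) y \<le> G.d (g \<otimes> i (\<rho> t)) (\<eta> t) + G.d (\<eta> t) y"
        using G.d_triangle \<eta>[OF t] \<rho>_car[OF t] g y(1) by simp
      then have "real (G.d (g \<otimes> i (\<rho> t)) y) \<le> M + D"
        using \<eta>[OF t] y(2) G.d_commute[of "\<eta> t" "g \<otimes> i (\<rho> t)"] by linarith
      then have "G.d (g \<otimes> i (\<rho> t)) y \<le> nat \<lceil>M + D\<rceil>" by linarith
      from N[OF \<rho>_car[OF t] y(1) this] obtain z where z: "z \<in> K g" "A.d (\<rho> t) z \<le> N" by blast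
      then have "z \<in> carrier A" using K_sub by blast
      then have "\<bar>cayley_dist A U (\<gamma> t) (vertex_point z) - A.d (\<rho> t) z\<bar> \<le> 2"
        using \<gamma>_car[OF t] \<rho>[OF t] by (intro A.cayley_dist_approx A.vertex_point_mem) (auto simp: edge_point_def)
      then show ?thesis using z by (intro bexI[of _ "vertex_point z"]) auto
    qed
    then show ?thesis by blast
  qed
  then have "Morse_subset (cayley_graph A U) (cayley_dist A U) (vertex_point ` K g)"
    unfolding Morse_subset_def using K_sub A.vertex_point_mem by (intro conjI) (blast, blast)
  then show ?thesis
    unfolding strongly_quasiconvex_def
    using subgroup_K[OF g] A.finite_S A.generating by blast
qed

text \<open>Write \<open>x = y r\<close> with \<open>y \<in> K g\<close> and \<open>r\<close> one of
  finitely many coset representatives. Then \<open>g \<otimes> i x\<close> is the element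
  \<open>g \<otimes> i y \<otimes> inv g\<close> of \<open>H\<close> times
  \<open>g \<otimes> i r\<close>, so its distance to \<open>H\<close> is bounded in terms of
  \<open>r\<close>. The bound depends on \<open>g\<close>.\<close>

lemma coset_near_H:
  assumes g: "g \<in> carrier G" and fin: "finite_index A (K g)"
  shows "\<exists>R. \<forall>x\<in>carrier A. \<exists>h\<in>H. G.d (g \<otimes> i x) h \<le> R"
proof -
  define r where "r = (\<lambda>C. SOME x. x \<in> carrier A \<and> C = K g #>\<^bsub>A\<^esub> x)"
  define R where "R = (\<Sum>C\<in>rcosets\<^bsub>A\<^esub> K g. G.d (i (r C)) (inv g))"
  have "\<exists>h\<in>H. G.d (g \<otimes> i x) h \<le> R" if x: "x \<in> carrier A" for x
  proof -
    let ?C = "K g #>\<^bsub>A\<^esub> x"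
    have C: "?C \<in> rcosets\<^bsub>A\<^esub> K g" using x by (auto simp: RCOSETS_def)
    have "r ?C \<in> carrier A \<and> ?C = K g #>\<^bsub>A\<^esub> r ?C"
      unfolding r_def by (rule someI[of _ x]) (use x in simp)
    moreover have "x \<in> ?C" using A.rcos_self[OF x] subgroup_K[OF g] by blast
    ultimately obtain y where y: "y \<in> K g" "x = y \<otimes>\<^bsub>A\<^esub> r ?C" "r ?C \<in> carrier A"
      unfolding r_coset_def by blast
    let ?h = "g \<otimes> i y \<otimes> inv g"
    have yc: "y \<in> carrier A" and h: "?h \<in> H" using y by (auto simp: K_def)
    have gx: "g \<otimes> i x = g \<otimes> i y \<otimes> i (r ?C)"
      using i.hom_mult[OF yc y(3)] y(2) g yc y(3) by (simp add: G.m_assoc)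
    have "G.d (g \<otimes> i x) ?h = G.d (i (r ?C)) (inv g)"
      unfolding gx using g yc y(3) by (simp add: G.d_translate)
    also have "\<dots> \<le> R"
      unfolding R_def using C fin by (intro member_le_sum) (auto simp: finite_index_def)
    finally show ?thesis using h by blast
  qed
  then show ?thesis by blast
qed

text \<open>Balls are finite, so an infinite \<open>A\<close> has an element of length greater than
  \<open>2 * n\<close>. A geodesic towards it, translated so that its point of index
  \<open>n\<close> becomes the identity, is mapped into the coset by
  \<open>x \<mapsto> g \<otimes> i x\<close>.\<close>

lemma long_quasi_geodesic:
  assumes inf: "infinite (carrier A)" and g: "g \<in> carrier G"
  shows "\<exists>\<zeta>. int_quasi_geodesic k c (- int n) (int n) \<zeta> \<and> \<zeta> 0 = g \<and>
           (\<forall>j\<in>{- int n..int n}. \<exists>x\<in>carrier A. \<zeta> j = g \<otimes> i x)"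
proof -
  obtain a where a: "a \<in> carrier A" "2 * n < A.d \<one>\<^bsub>A\<^esub> a"
  proof (rule ccontr)
    assume "\<not> thesis"
    then have "carrier A \<subseteq> {a \<in> carrier A. A.d \<one>\<^bsub>A\<^esub> a \<le> 2 * n}" using that by force
    then show False using inf A.finite_d_ball[of "\<one>\<^bsub>A\<^esub>"] finite_subset by blast
  qed
  obtain p where p: "\<And>j. j \<le> A.d \<one>\<^bsub>A\<^esub> a \<Longrightarrow> p j \<in> carrier A"
      "\<And>j l. j \<le> l \<Longrightarrow> l \<le> A.d \<one>\<^bsub>A\<^esub> a \<Longrightarrow> A.d (p j) (p l) = l - j"
    using A.geodesic_exists[OF A.one_closed a(1)] by blast
  define \<sigma> where "\<sigma> = (\<lambda>j. inv\<^bsub>A\<^esub> p n \<otimes>\<^bsub>A\<^esub> p (nat (j + int n)))"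
  define \<zeta> where "\<zeta> = (\<lambda>j. g \<otimes> i (\<sigma> j))"
  have pn: "p n \<in> carrier A" using p(1) a(2) by simp
  have le: "nat (j + int n) \<le> A.d \<one>\<^bsub>A\<^esub> a" if "j \<le> int n" for j
    using that a(2) by linarith
  have \<sigma>: "\<sigma> j \<in> carrier A" if "j \<le> int n" for j
    using pn p(1)[OF le[OF that]] by (simp add: \<sigma>_def)
  have \<zeta>: "\<zeta> j \<in> carrier G" if "j \<le> int n" for j using \<sigma>[OF that] g by (simp add: \<zeta>_def)
  have "int_quasi_geodesic k c (- int n) (int n) \<zeta>"
    unfolding int_quasi_geodesic_def
  proof (intro conjI ballI allI impI)
    fix j l assume jl: "- int n \<le> j \<and> j \<le> l \<and> l \<le> int n"
    have "A.d (\<sigma> j) (\<sigma> l) = nat (l + int n) - nat (j + int n)"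
      unfolding \<sigma>_def using p(2)[of "nat (j + int n)" "nat (l + int n)"] le[of l] le[of j] p(1) pn jl
      by (simp add: A.d_translate nat_mono)
    then have "int (A.d (\<sigma> j) (\<sigma> l)) = l - j" using jl by linarith
    then have A: "real (A.d (\<sigma> j) (\<sigma> l)) = real_of_int l - real_of_int j" by linarith
    have "G.d (\<zeta> j) (\<zeta> l) = G.d (i (\<sigma> j)) (i (\<sigma> l))"
      using \<sigma> jl g by (simp add: \<zeta>_def G.d_translate)
    then show "(real_of_int l - real_of_int j) / k - c \<le> real (G.d (\<zeta> j) (\<zeta> l))"
        "real (G.d (\<zeta> j) (\<zeta> l)) \<le> k * (real_of_int l - real_of_int j) + c"
      using qi[OF \<sigma> \<sigma>, of j l] jl by (simp_all add: A)
  qed (use \<zeta> in auto)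
  moreover have "\<zeta> 0 = g" using pn g by (simp add: \<zeta>_def \<sigma>_def)
  ultimately show ?thesis using \<sigma> by (intro exI[of _ \<zeta>]) (auto simp: \<zeta>_def)
qed

lemma uniformly_near_H:
  assumes inf: "infinite (carrier A)" and fin: "\<And>g. g \<in> carrier G \<Longrightarrow> finite_index A (K g)"
  shows "\<exists>N. \<forall>g\<in>carrier G. \<exists>h\<in>H. G.d g h \<le> N"
proof -
  \<comment> \<open>The path is extended at both ends, and each extension triples the constant.
    \<open>M\<close> is fixed here, before \<open>g\<close>.\<close>
  have "1 \<le> 9 * k" using k by simp
  from Morse_int_quasi_geodesic[OF Morse_H this c] obtain M where M: "\<And>p q \<gamma> j.
      int_quasi_geodesic (9 * k) c p q \<gamma> \<Longrightarrow> \<gamma> p \<in> H \<Longrightarrow> \<gamma> q \<in> H \<Longrightarrow> j \<in> {p..q} \<Longrightarrow>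
      \<exists>y\<in>H. real (G.d (\<gamma> j) y) \<le> M" by blast
  have "\<exists>h\<in>H. real (G.d g h) \<le> M" if g: "g \<in> carrier G" for g
  proof -
    obtain R where R: "\<And>x. x \<in> carrier A \<Longrightarrow> \<exists>h\<in>H. G.d (g \<otimes> i x) h \<le> R"
      using coset_near_H[OF g fin[OF g]] by blast
    \<comment> \<open>\<open>R\<close> depends on \<open>g\<close>, but it only enters into the length \<open>n\<close> and not into \<open>M\<close>.\<close>
    define n where "n = Suc (nat \<lceil>3 * k * (2 * R + c)\<rceil>)"
    have n: "3 * k * (2 * R + c) < n" unfolding n_def by linarith
    obtain \<zeta> where \<zeta>: "int_quasi_geodesic k c (- int n) (int n) \<zeta>" "\<zeta> 0 = g"
        "\<And>j. j \<in> {- int n..int n} \<Longrightarrow> \<exists>x\<in>carrier A. \<zeta> j = g \<otimes> i x"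
      using long_quasi_geodesic[OF inf g] by blast
    \<comment> \<open>The exit point and the old endpoint are both within \<open>R\<close> of
      \<open>h\<close>, so they are at most \<open>2 * R\<close> apart and their times differ by
      less than \<open>n\<close>; thus the detour starts after time 0. The bound
      \<open>3 * k\<close> covers the second end too, where the path has already been extended
      once.\<close>
    have near_end: "0 < m" if qg: "int_quasi_geodesic k' c p (int n) \<gamma>" "1 \<le> k'" "k' \<le> 3 * k"
        and m: "p \<le> m" "m \<le> int n" and h: "h \<in> carrier G" "G.d (\<gamma> m) h \<le> G.d (\<gamma> (int n)) h"
        "G.d (\<gamma> (int n)) h \<le> R" for k' p \<gamma> m h
    proof -
      have car: "\<gamma> m \<in> carrier G" "\<gamma> (int n) \<in> carrier G"
        using qg(1) m unfolding int_quasi_geodesic_def by auto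
      have "(real_of_int (int n) - real_of_int m) / k' - c \<le> G.d (\<gamma> m) (\<gamma> (int n))"
        using qg(1) m unfolding int_quasi_geodesic_def by blast
      also have "\<dots> \<le> 2 * R"
        using G.d_triangle[of "\<gamma> m" h "\<gamma> (int n)"] car h G.d_commute[of h "\<gamma> (int n)"] by linarith
      finally have "(real_of_int (int n) - real_of_int m) / k' \<le> 2 * R + c" by (simp only: diff_le_eq)
      then have "real n - real_of_int m \<le> k' * (2 * R + c)"
        using qg(2) by (simp add: divide_le_eq mult.commute)
      also have "\<dots> \<le> 3 * k * (2 * R + c)" using qg(3) c by (intro mult_right_mono) auto
      finally have "0 < real_of_int m" using n by linarith
      then show ?thesis by simp
    qed
    obtain h where h: "h \<in> H" "G.d (\<zeta> (int n)) h \<le> R" using R \<zeta>(3)[of "int n"] by force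
    then have hc: "h \<in> carrier G" by simp
    have "- int n \<le> int n" by simp
    from int_quasi_geodesic_extend[OF \<zeta>(1) k c this hc] obtain m \<gamma> where m: "- int n \<le> m" "m \<le> int n"
        "G.d (\<zeta> m) h \<le> G.d (\<zeta> (int n)) h" and
      \<gamma>: "int_quasi_geodesic (3 * k) c (- int n) (m + int (G.d (\<zeta> m) h)) \<gamma>"
        "\<gamma> (m + int (G.d (\<zeta> m) h)) = h" "\<And>j. j \<le> m \<Longrightarrow> \<gamma> j = \<zeta> j"
      by blast
    have m0: "0 < m" using near_end[OF \<zeta>(1) k _ m(1,2) hc m(3) h(2)] k by simp
    define q where "q = m + int (G.d (\<zeta> m) h)"
    have q: "0 < q" "\<gamma> q = h" using m0 \<gamma>(2) by (simp_all add: q_def)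
    \<comment> \<open>Reversal fixes time 0 and turns the other end into a final end, so that the
      same extension applies.\<close>
    have rev: "int_quasi_geodesic (3 * k) c (- q) (int n) (\<lambda>j. \<gamma> (- j))"
      using int_quasi_geodesic_reverse[OF \<gamma>(1)] by (simp add: q_def)
    obtain h' where h': "h' \<in> H" "G.d (\<gamma> (- int n)) h' \<le> R"
      using R \<zeta>(3)[of "- int n"] \<gamma>(3)[OF m(1)] by force
    then have hc': "h' \<in> carrier G" by simp
    have k3: "1 \<le> 3 * k" and "- q \<le> int n" using k q by auto
    from int_quasi_geodesic_extend[OF rev k3 c this(2) hc'] obtain m' \<gamma>' where
      m': "- q \<le> m'" "m' \<le> int n" "G.d (\<gamma> (- m')) h' \<le> G.d (\<gamma> (- int n)) h'" and
      \<gamma>': "int_quasi_geodesic (3 * (3 * k)) c (- q) (m' + int (G.d (\<gamma> (- m')) h')) \<gamma>'"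
        "\<gamma>' (m' + int (G.d (\<gamma> (- m')) h')) = h'" "\<And>j. j \<le> m' \<Longrightarrow> \<gamma>' j = \<gamma> (- j)"
      by blast
    have m0': "0 < m'" using near_end[OF rev k3 _ m'(1,2) hc' m'(3) h'(2)] by simp
    have "\<gamma>' 0 = g" using m0 m0' \<gamma>'(3)[of 0] \<gamma>(3)[of 0] \<zeta>(2) by simp
    moreover have "\<gamma>' (- q) = h" using \<gamma>'(3)[OF m'(1)] q(2) by simp
    ultimately show ?thesis
      using M[of "- q" "m' + int (G.d (\<gamma> (- m')) h')" \<gamma>' 0] \<gamma>'(1,2) h(1) h'(1) q(1) m0' by simp
  qed
  moreover have "n \<le> nat \<lceil>M\<rceil>" if "real n \<le> M" for n
    using that by linarith
  ultimately have "\<forall>g\<in>carrier G. \<exists>h\<in>H. G.d g h \<le> nat \<lceil>M\<rceil>" by blast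
  then show ?thesis by blast
qed

text \<open>If every \<open>g\<close> is within \<open>N\<close> of \<open>H\<close>, then every
  right coset of \<open>H\<close> has a representative in the ball of radius \<open>N\<close>, which
  is finite.\<close>

lemma finite_index_if_all_finite_index:
  assumes "infinite (carrier A)" "\<And>g. g \<in> carrier G \<Longrightarrow> finite_index A (K g)"
  shows "finite_index G H"
proof -
  obtain N where N: "\<And>g. g \<in> carrier G \<Longrightarrow> \<exists>h\<in>H. G.d g h \<le> N"
    using uniformly_near_H[OF assms] by blast
  have "rcosets H \<subseteq> (\<lambda>b. H #> b) ` {b \<in> carrier G. G.d \<one> b \<le> N}"
  proof
    fix C assume "C \<in> rcosets H"
    then obtain g where g: "g \<in> carrier G" "C = H #> g" by (auto simp: RCOSETS_def)
    obtain h where h: "h \<in> H" "G.d g h \<le> N" using N g by blast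
    define b where "b = inv h \<otimes> g"
    have b: "b \<in> carrier G" "g = h \<otimes> b"
      using g h by (auto simp: b_def G.m_assoc[symmetric])
    have "G.d \<one> b \<le> N" using G.d_inv[of h g] h g G.d_commute[of g h] by (simp add: b_def)
    moreover have "H #> g = H #> b"
      using b h G.coset_mult_assoc[OF H.subset, of h b] G.coset_join2[OF _ H, of h] by simp
    ultimately show "C \<in> (\<lambda>b. H #> b) ` {b \<in> carrier G. G.d \<one> b \<le> N}" using b g by blast
  qed
  then show ?thesis
    unfolding finite_index_def using G.finite_d_ball[of "\<one>"] by (simp add: finite_subset)
qed

end

section \<open>Presentations\<close>

abbreviation word_class :: "'l set \<Rightarrow> ('l list \<times> 'l list) set \<Rightarrow> 'l list \<Rightarrow> 'l list set" where
  "word_class A R w \<equiv> word_congruence A R `` {w}"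

lemma word_congruence_lists: "(u, v) \<in> word_congruence A R \<Longrightarrow> u \<in> lists A \<and> v \<in> lists A"
  by (auto simp: word_congruence_def)

lemma equiv_word_congruence: "equiv (lists A) (word_congruence A R)"
proof (rule equivI)
  show "refl_on (lists A) (word_congruence A R)"
    by (auto simp: refl_on_def word_congruence_def)
  have "sym ((rewrite_step A R \<union> (rewrite_step A R)\<inverse>)\<^sup>*)"
    by (intro sym_rtrancl) (auto simp: sym_def)
  then show "sym (word_congruence A R)"
    unfolding word_congruence_def sym_def by blast
  show "trans (word_congruence A R)"
    unfolding word_congruence_def trans_def by (blast intro: rtrancl_trans)
qed (auto simp: word_congruence_def)

lemma word_congruence_refl: "w \<in> lists A \<Longrightarrow> (w, w) \<in> word_congruence A R"
  by (simp add: word_congruence_def)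

lemma word_congruence_sym: "(u, v) \<in> word_congruence A R \<Longrightarrow> (v, u) \<in> word_congruence A R"
  using equiv_word_congruence by (meson equivE symD)

lemma word_congruence_trans:
  "(u, v) \<in> word_congruence A R \<Longrightarrow> (v, w) \<in> word_congruence A R \<Longrightarrow> (u, w) \<in> word_congruence A R"
  using equiv_word_congruence by (meson equivE transD)

lemma word_congruence_relation:
  assumes "(u, v) \<in> R" "u \<in> lists A" "v \<in> lists A"
  shows "(u, v) \<in> word_congruence A R"
proof -
  have "([] @ u @ [], [] @ v @ []) \<in> rewrite_step A R"
    unfolding rewrite_step_def using assms by blast
  then show ?thesis using assms by (auto simp: word_congruence_def)
qed

lemma rewrite_step_context:
  assumes "(u, v) \<in> rewrite_step A R" "p \<in> lists A" "q \<in> lists A"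
  shows "(p @ u @ q, p @ v @ q) \<in> rewrite_step A R"
proof -
  obtain p' q' u' v' where *: "u = p' @ u' @ q'" "v = p' @ v' @ q'" "(u', v') \<in> R"
      "p' \<in> lists A" "q' \<in> lists A" "u' \<in> lists A" "v' \<in> lists A"
    using assms(1) by (auto simp: rewrite_step_def)
  have "p @ u @ q = (p @ p') @ u' @ (q' @ q)" "p @ v @ q = (p @ p') @ v' @ (q' @ q)"
    using * by simp_all
  moreover have "p @ p' \<in> lists A" "q' @ q \<in> lists A" using * assms by simp_all
  ultimately show ?thesis using * unfolding rewrite_step_def by blast
qed

lemma word_congruence_context:
  assumes "(u, v) \<in> word_congruence A R" and p: "p \<in> lists A" and q: "q \<in> lists A"
  shows "(p @ u @ q, p @ v @ q) \<in> word_congruence A R"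
proof -
  have "(u, v) \<in> (rewrite_step A R \<union> (rewrite_step A R)\<inverse>)\<^sup>*"
    using assms by (simp add: word_congruence_def)
  then have "(p @ u @ q, p @ v @ q) \<in> (rewrite_step A R \<union> (rewrite_step A R)\<inverse>)\<^sup>*"
  proof induction
    case (step v w)
    then have "(p @ v @ q, p @ w @ q) \<in> rewrite_step A R \<union> (rewrite_step A R)\<inverse>"
      using rewrite_step_context[OF _ p q] by blast
    then show ?case using step.IH by (rule rtrancl_into_rtrancl[rotated])
  qed simp
  then show ?thesis using assms by (simp add: word_congruence_def)
qed

lemma word_congruence_append:
  assumes "(u, u') \<in> word_congruence A R" "(v, v') \<in> word_congruence A R"
  shows "(u @ v, u' @ v') \<in> word_congruence A R"
proof -
  have "(u @ v, u' @ v) \<in> word_congruence A R"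
    using word_congruence_context[OF assms(1), of "[]" v] word_congruence_lists[OF assms(2)] by simp
  moreover have "(u' @ v, u' @ v') \<in> word_congruence A R"
    using word_congruence_context[OF assms(2), of u' "[]"] word_congruence_lists[OF assms(1)] by simp
  ultimately show ?thesis by (rule word_congruence_trans)
qed

lemma word_class_eq_iff:
  assumes "u \<in> lists A" "v \<in> lists A"
  shows "word_class A R u = word_class A R v \<longleftrightarrow> (u, v) \<in> word_congruence A R"
  using eq_equiv_class_iff[OF equiv_word_congruence assms] .

lemma word_class_eqI:
  "(u, v) \<in> word_congruence A R \<Longrightarrow> word_class A R u = word_class A R v"
  by (rule equiv_class_eq[OF equiv_word_congruence])

lemma word_class_mem: "w \<in> lists A \<Longrightarrow> word_class A R w \<in> carrier (presented_monoid A R)"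
  by (simp add: presented_monoid_def quotientI)

lemma presented_monoid_cases:
  assumes "X \<in> carrier (presented_monoid A R)"
  obtains w where "w \<in> lists A" "X = word_class A R w"
  using assms by (auto simp: presented_monoid_def elim!: quotientE)

lemma presented_monoid_one: "\<one>\<^bsub>presented_monoid A R\<^esub> = word_class A R []"
  by (simp add: presented_monoid_def)

lemma presented_monoid_mult:
  assumes "u \<in> lists A" "v \<in> lists A"
  shows "word_class A R u \<otimes>\<^bsub>presented_monoid A R\<^esub> word_class A R v = word_class A R (u @ v)"
proof -
  have "word_class A R (x @ y) = word_class A R (u @ v)"
    if "x \<in> word_class A R u" "y \<in> word_class A R v" for x y
  proof -
    have *: "(x, u) \<in> word_congruence A R" "(y, v) \<in> word_congruence A R"
      using that word_congruence_sym by auto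
    then show ?thesis by (intro word_class_eqI word_congruence_append)
  qed
  moreover have "u \<in> word_class A R u" "v \<in> word_class A R v"
    using assms[THEN word_congruence_refl] by simp_all
  ultimately have "(\<Union>x\<in>word_class A R u. \<Union>y\<in>word_class A R v. word_class A R (x @ y)) = word_class A R (u @ v)"
    by (intro UN_constant_eq[of u] ballI UN_constant_eq[of v])
  then show ?thesis by (simp only: presented_monoid_def monoid.simps)
qed

lemma monoid_presented_monoid: "monoid (presented_monoid A R)" (is "monoid ?P")
proof (rule monoidI)
  fix X Y assume XY: "X \<in> carrier ?P" "Y \<in> carrier ?P"
  obtain u where u: "u \<in> lists A" "X = word_class A R u" using XY(1) by (rule presented_monoid_cases)
  obtain v where v: "v \<in> lists A" "Y = word_class A R v" using XY(2) by (rule presented_monoid_cases)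
  note uv = u v
  then show "X \<otimes>\<^bsub>?P\<^esub> Y \<in> carrier ?P"
    by (simp add: presented_monoid_mult word_class_mem)
  fix Z assume "Z \<in> carrier ?P"
  then obtain w where "w \<in> lists A" "Z = word_class A R w" by (rule presented_monoid_cases)
  then show "X \<otimes>\<^bsub>?P\<^esub> Y \<otimes>\<^bsub>?P\<^esub> Z = X \<otimes>\<^bsub>?P\<^esub> (Y \<otimes>\<^bsub>?P\<^esub> Z)"
    using uv by (simp add: presented_monoid_mult)
next
  fix X assume "X \<in> carrier ?P"
  then obtain u where u: "u \<in> lists A" "X = word_class A R u" by (rule presented_monoid_cases)
  then show "\<one>\<^bsub>?P\<^esub> \<otimes>\<^bsub>?P\<^esub> X = X" "X \<otimes>\<^bsub>?P\<^esub> \<one>\<^bsub>?P\<^esub> = X"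
    using presented_monoid_mult[of "[]" A u R] presented_monoid_mult[of u A "[]" R]
    by (simp_all add: presented_monoid_one)
next
  show "\<one>\<^bsub>?P\<^esub> \<in> carrier ?P"
    unfolding presented_monoid_one by (rule word_class_mem) simp
qed

text \<open>The universal property of a presentation, for right actions on a set.\<close>

lemma fold_word_congruence:
  assumes "(u, v) \<in> word_congruence A R" and x: "x \<in> \<Omega>"
    and closed: "\<And>l x. l \<in> A \<Longrightarrow> x \<in> \<Omega> \<Longrightarrow> act l x \<in> \<Omega>"
    and rel: "\<And>u v x. (u, v) \<in> R \<Longrightarrow> u \<in> lists A \<Longrightarrow> v \<in> lists A \<Longrightarrow> x \<in> \<Omega> \<Longrightarrow>
                 fold act u x = fold act v x"
  shows "fold act u x = fold act v x"
proof -
  have mem: "fold act w x \<in> \<Omega>" if "w \<in> lists A" "x \<in> \<Omega>" for w x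
    using that by (induction w arbitrary: x) (auto intro: closed)
  have rewrite: "fold act u x = fold act v x" if uv: "(u, v) \<in> rewrite_step A R" for u v
  proof -
    obtain p q u' v' where *: "u = p @ u' @ q" "v = p @ v' @ q" "(u', v') \<in> R"
        "p \<in> lists A" "u' \<in> lists A" "v' \<in> lists A"
      using uv by (auto simp: rewrite_step_def)
    show ?thesis using rel[OF *(3,5,6) mem[OF *(4) x]] by (simp add: *(1,2))
  qed
  have "(u, v) \<in> (rewrite_step A R \<union> (rewrite_step A R)\<inverse>)\<^sup>*"
    using assms by (simp add: word_congruence_def)
  then show ?thesis
  proof induction
    case (step v w)
    then have "fold act v x = fold act w x" using rewrite[of v w] rewrite[of w v] by auto
    then show ?case using step.IH by simp
  qed simp
qed

section \<open>Free groups\<close>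

definition free_relations :: "'b set \<Rightarrow> (('b \<times> bool) list \<times> ('b \<times> bool) list) set" where
  "free_relations B = {([(b, x), (b, \<not> x)], []) | b x. b \<in> B}"

abbreviation free_class :: "'b set \<Rightarrow> ('b \<times> bool) list \<Rightarrow> ('b \<times> bool) list set" where
  "free_class B \<equiv> word_class (B \<times> UNIV) (free_relations B)"

lemma free_group_eq: "free_group B = presented_monoid (B \<times> UNIV) (free_relations B)"
  by (simp add: free_group_def free_relations_def)

lemma free_class_mem: "w \<in> lists (B \<times> UNIV) \<Longrightarrow> free_class B w \<in> carrier (free_group B)"
  unfolding free_group_eq by (rule word_class_mem)

lemma free_group_cases:
  assumes "X \<in> carrier (free_group B)"
  obtains w where "w \<in> lists (B \<times> UNIV)" "X = free_class B w"
  using assms unfolding free_group_eq by (rule presented_monoid_cases)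

lemma free_group_mult:
  "u \<in> lists (B \<times> UNIV) \<Longrightarrow> v \<in> lists (B \<times> UNIV) \<Longrightarrow>
    free_class B u \<otimes>\<^bsub>free_group B\<^esub> free_class B v = free_class B (u @ v)"
  unfolding free_group_eq by (rule presented_monoid_mult)

lemma free_group_one: "\<one>\<^bsub>free_group B\<^esub> = free_class B []"
  unfolding free_group_eq by (rule presented_monoid_one)

lemma free_class_cancel:
  assumes "b \<in> B"
  shows "free_class B [(b, x), (b, \<not> x)] = free_class B []"
  using assms by (subst word_class_eq_iff) (auto intro!: word_congruence_relation simp: free_relations_def)

text \<open>The inverse word is the reversed one with all signs flipped; the innermost pair cancels
  in each step of the induction. This turns the presented monoid into a group.\<close>

lemma free_class_inverse:
  assumes "w \<in> lists (B \<times> UNIV)"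
  shows "free_class B (rev (map (\<lambda>(b, x). (b, \<not> x)) w)) \<otimes>\<^bsub>free_group B\<^esub> free_class B w = \<one>\<^bsub>free_group B\<^esub>"
  using assms
proof (induction w)
  case Nil
  then show ?case by (simp add: free_group_mult free_group_one)
next
  case (Cons l w)
  obtain b x where l: "l = (b, x)" by (cases l)
  let ?w = "rev (map (\<lambda>(b, x). (b, \<not> x)) w)"
  have w: "b \<in> B" "w \<in> lists (B \<times> UNIV)" "?w \<in> lists (B \<times> UNIV)"
    using Cons.hyps by (auto simp: l)
  have "([(b, \<not> x), (b, \<not> (\<not> x))], []) \<in> word_congruence (B \<times> UNIV) (free_relations B)"
    using w(1) by (intro word_congruence_relation) (auto simp: free_relations_def)
  from word_congruence_context[OF this w(3,2)]
  have cong: "(?w @ [(b, \<not> x), (b, x)] @ w, ?w @ w) \<in> word_congruence (B \<times> UNIV) (free_relations B)"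
    by simp
  then have "free_class B (?w @ [(b, \<not> x), (b, x)] @ w) = free_class B (?w @ w)"
    by (rule word_class_eqI)
  moreover have "free_class B (?w @ [(b, \<not> x)]) \<otimes>\<^bsub>free_group B\<^esub> free_class B ((b, x) # w) =
      free_class B ((?w @ [(b, \<not> x)]) @ (b, x) # w)"
    using w by (intro free_group_mult) simp_all
  moreover have "free_class B ?w \<otimes>\<^bsub>free_group B\<^esub> free_class B w = free_class B (?w @ w)"
    using w by (intro free_group_mult)
  ultimately show ?case using Cons.IH by (simp add: l)
qed

lemma group_free_group: "group (free_group B)"
proof -
  interpret monoid "free_group B" unfolding free_group_eq by (rule monoid_presented_monoid)
  show ?thesis
  proof (rule groupI)
    fix X assume "X \<in> carrier (free_group B)"
    then obtain w where w: "w \<in> lists (B \<times> UNIV)" "X = free_class B w" by (rule free_group_cases)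
    then have "rev (map (\<lambda>(b, x). (b, \<not> x)) w) \<in> lists (B \<times> UNIV)" by auto
    then show "\<exists>Y\<in>carrier (free_group B). Y \<otimes>\<^bsub>free_group B\<^esub> X = \<one>\<^bsub>free_group B\<^esub>"
      using w free_class_inverse free_class_mem by blast
  qed (auto simp: m_assoc)
qed

lemma free_group_inv_generator:
  assumes "b \<in> B"
  shows "inv\<^bsub>free_group B\<^esub> free_class B [(b, True)] = free_class B [(b, False)]"
proof -
  interpret group "free_group B" by (rule group_free_group)
  have "free_class B [(b, False)] \<otimes>\<^bsub>free_group B\<^esub> free_class B [(b, True)] = \<one>\<^bsub>free_group B\<^esub>"
    using assms free_class_cancel[of b B False] by (simp add: free_group_mult free_group_one)
  then show ?thesis using assms by (intro inv_equality) (auto intro: free_class_mem)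
qed

lemma subgroup_free_group_eq:
  assumes K: "subgroup K (free_group B)" and gen: "\<And>b. b \<in> B \<Longrightarrow> free_class B [(b, True)] \<in> K"
  shows "K = carrier (free_group B)"
proof -
  interpret group "free_group B" by (rule group_free_group)
  interpret K: subgroup K "free_group B" by (rule K)
  have mem: "free_class B w \<in> K" if "w \<in> lists (B \<times> UNIV)" for w
    using that
  proof (induction w)
    case Nil
    then show ?case using K.one_closed by (simp add: free_group_one)
  next
    case (Cons l w)
    obtain b x where l: "l = (b, x)" by (cases l)
    then have b: "b \<in> B" using Cons.hyps by auto
    have "free_class B [(b, x)] \<in> K"
      using gen[OF b] K.m_inv_closed[OF gen[OF b]] free_group_inv_generator[OF b] by (cases x) auto
    moreover have "free_class B (l # w) = free_class B [(b, x)] \<otimes>\<^bsub>free_group B\<^esub> free_class B w"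
      using Cons.hyps b by (subst free_group_mult) (auto simp: l)
    ultimately show ?case using Cons.IH by simp
  qed
  have "X \<in> K" if X: "X \<in> carrier (free_group B)" for X
  proof -
    obtain w where "w \<in> lists (B \<times> UNIV)" "X = free_class B w" using X by (rule free_group_cases)
    then show ?thesis using mem by simp
  qed
  then show ?thesis using K.subset by blast
qed

text \<open>The canonical homomorphism from the free group on a subset of the group. The choice of a
  word is harmless by \<open>free_eval_class\<close>, since inverse pairs evaluate to the
  identity.\<close>

definition free_eval :: "('a, 'm) monoid_scheme \<Rightarrow> ('a \<times> bool) list set \<Rightarrow> 'a" where
  "free_eval G X = fold (\<lambda>(b, x) g. g \<otimes>\<^bsub>G\<^esub> (if x then b else inv\<^bsub>G\<^esub> b)) (SOME w. w \<in> X) \<one>\<^bsub>G\<^esub>"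

lemma (in group) free_eval_class:
  assumes B: "B \<subseteq> carrier G" and w: "w \<in> lists (B \<times> UNIV)"
  shows "free_eval G (free_class B w) = fold (\<lambda>(b, x) g. g \<otimes> (if x then b else inv b)) w \<one>"
proof -
  have "w \<in> free_class B w" using word_congruence_refl[OF w] by simp
  then have "(SOME v. v \<in> free_class B w) \<in> free_class B w" by (rule someI)
  then have "(SOME v. v \<in> free_class B w, w) \<in> word_congruence (B \<times> UNIV) (free_relations B)"
    using word_congruence_sym by auto
  then show ?thesis
    unfolding free_eval_def
    by (rule fold_word_congruence[where \<Omega> = "carrier G"]) (use B in \<open>auto simp: m_assoc subset_iff free_relations_def\<close>)
qed

section \<open>Free actions on trees\<close>

text \<open>Along an edge the value of a potential determines the next one by multiplication, and
  against an edge by right cancellation. The identities about \<Theta> below come from this: both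
  sides are potentials of the same labelling and agree at one point.\<close>

lemma potential_unique:
  assumes "group M" and "(x, y) \<in> (E \<union> E\<inverse>)\<^sup>*" and "x \<in> Y" and "E \<subseteq> Y \<times> Y"
    and f: "\<And>y. y \<in> Y \<Longrightarrow> f y \<in> carrier M" and g: "\<And>y. y \<in> Y \<Longrightarrow> g y \<in> carrier M"
    and c: "\<And>y z. (y, z) \<in> E \<Longrightarrow> c y z \<in> carrier M"
    and eq: "\<And>y z. (y, z) \<in> E \<Longrightarrow> f z = f y \<otimes>\<^bsub>M\<^esub> c y z \<and> g z = g y \<otimes>\<^bsub>M\<^esub> c y z"
    and "f x = g x"
  shows "f y = g y"
proof -
  interpret group M by fact
  have "y \<in> Y \<and> f y = g y" using assms(2)
  proof induction
    case base
    then show ?case using \<open>x \<in> Y\<close> \<open>f x = g x\<close> by simp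
  next
    case (step y z)
    note yY = conjunct1[OF step.IH] and fg = conjunct2[OF step.IH]
    have "(y, z) \<in> E \<or> (z, y) \<in> E" using step.hyps(2) by simp
    then show ?case
    proof
      assume yz: "(y, z) \<in> E"
      then have "z \<in> Y" using \<open>E \<subseteq> Y \<times> Y\<close> by blast
      then show ?thesis using eq[OF yz] fg by metis
    next
      assume zy: "(z, y) \<in> E"
      then have z: "z \<in> Y" using \<open>E \<subseteq> Y \<times> Y\<close> by blast
      have "f z \<otimes>\<^bsub>M\<^esub> c z y = g z \<otimes>\<^bsub>M\<^esub> c z y" using eq[OF zy] fg by metis
      then show ?thesis using right_cancel[OF c[OF zy] f[OF z] g[OF z]] z by blast
    qed
  qed
  then show ?thesis ..
qed

text \<open>The tree is given by a relation \<open>E\<close> on \<open>Y\<close>; simple connectedness is expressed by the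
  existence of potentials.\<close>

locale free_tree_action = group G for G (structure) +
  fixes Y :: "'y set" and act :: "'a \<Rightarrow> 'y \<Rightarrow> 'y" and E :: "'y rel" and y0 :: 'y
  assumes act_closed: "g \<in> carrier G \<Longrightarrow> y \<in> Y \<Longrightarrow> act g y \<in> Y"
    and act_one: "y \<in> Y \<Longrightarrow> act \<one> y = y"
    and act_mult: "g \<in> carrier G \<Longrightarrow> h \<in> carrier G \<Longrightarrow> y \<in> Y \<Longrightarrow> act (g \<otimes> h) y = act g (act h y)"
    and act_free: "g \<in> carrier G \<Longrightarrow> y \<in> Y \<Longrightarrow> act g y = y \<Longrightarrow> g = \<one>"
    and E_subset: "E \<subseteq> Y \<times> Y"
    and E_act: "g \<in> carrier G \<Longrightarrow> (y, z) \<in> E \<Longrightarrow> (act g y, act g z) \<in> E"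
    and y0: "y0 \<in> Y"
    and connected: "y \<in> Y \<Longrightarrow> (y0, y) \<in> (E \<union> E\<inverse>)\<^sup>*"
    and potential: "B \<subseteq> carrier G \<Longrightarrow> (\<And>y z. (y, z) \<in> E \<Longrightarrow> c y z \<in> carrier (free_group B)) \<Longrightarrow>
          \<exists>\<Theta>. (\<forall>y\<in>Y. \<Theta> y \<in> carrier (free_group B)) \<and>
              (\<forall>y z. (y, z) \<in> E \<longrightarrow> \<Theta> z = \<Theta> y \<otimes>\<^bsub>free_group B\<^esub> c y z)"
begin

lemma act_inv_act: "g \<in> carrier G \<Longrightarrow> y \<in> Y \<Longrightarrow> act (inv g) (act g y) = y"
  by (simp add: act_mult[symmetric] act_one)

text \<open>A connected set of vertices with at most one point from each orbit. Since the action is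
  free, the latter can be stated as \<open>g = \<one>\<close> instead of \<open>act g z = z\<close>.
  Connectedness uses only edges inside \<open>Z\<close>.\<close>

definition partial_transversal :: "'y set \<Rightarrow> bool" where
  "partial_transversal Z \<longleftrightarrow> Z \<subseteq> Y \<and> y0 \<in> Z \<and>
     (\<forall>z\<in>Z. (y0, z) \<in> ((E \<inter> Z \<times> Z) \<union> (E \<inter> Z \<times> Z)\<inverse>)\<^sup>*) \<and>
     (\<forall>z\<in>Z. \<forall>g\<in>carrier G. act g z \<in> Z \<longrightarrow> g = \<one>)"

lemma partial_transversalD:
  assumes "partial_transversal Z"
  shows "Z \<subseteq> Y" "y0 \<in> Z"
    and "z \<in> Z \<Longrightarrow> (y0, z) \<in> ((E \<inter> Z \<times> Z) \<union> (E \<inter> Z \<times> Z)\<inverse>)\<^sup>*"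
    and "z \<in> Z \<Longrightarrow> g \<in> carrier G \<Longrightarrow> act g z \<in> Z \<Longrightarrow> g = \<one>"
  using assms unfolding partial_transversal_def by blast+

lemma maximal_partial_transversal:
  "\<exists>Z. partial_transversal Z \<and> (\<forall>Z'. partial_transversal Z' \<and> Z \<subseteq> Z' \<longrightarrow> Z' = Z)"
proof -
  have "partial_transversal {y0}"
    using y0 act_free by (auto simp: partial_transversal_def)
  then have "{Z. partial_transversal Z} \<noteq> {}" by blast
  moreover have "\<Union>C \<in> {Z. partial_transversal Z}"
    if C: "C \<noteq> {}" "subset.chain {Z. partial_transversal Z} C" for C
  proof -
    have good: "\<And>Z. Z \<in> C \<Longrightarrow> partial_transversal Z"
      and chain: "\<And>Z Z'. Z \<in> C \<Longrightarrow> Z' \<in> C \<Longrightarrow> Z \<subseteq> Z' \<or> Z' \<subseteq> Z"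
      using C(2) by (auto simp: subset_chain_def)
    have "(y0, z) \<in> ((E \<inter> \<Union>C \<times> \<Union>C) \<union> (E \<inter> \<Union>C \<times> \<Union>C)\<inverse>)\<^sup>*" if "z \<in> Z" "Z \<in> C" for z Z
    proof -
      have "(y0, z) \<in> ((E \<inter> Z \<times> Z) \<union> (E \<inter> Z \<times> Z)\<inverse>)\<^sup>*"
        using partial_transversalD(3)[OF good] that by blast
      then show ?thesis by (rule rtrancl_mono[THEN subsetD, rotated]) (use that in blast)
    qed
    moreover have "g = \<one>" if z: "z \<in> Z" "Z \<in> C" "act g z \<in> Z'" "Z' \<in> C" and g: "g \<in> carrier G" for g z Z Z'
    proof -
      obtain Z'' where "Z'' \<in> C" "z \<in> Z''" "act g z \<in> Z''" using chain z by blast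
      then show ?thesis using partial_transversalD(4)[OF good _ g] by blast
    qed
    moreover have "\<Union>C \<subseteq> Y" "y0 \<in> \<Union>C" using partial_transversalD(1,2)[OF good] C(1) by blast+
    ultimately show ?thesis unfolding partial_transversal_def mem_Collect_eq by blast
  qed
  ultimately obtain Z where "Z \<in> {Z. partial_transversal Z}"
      "\<forall>Z'\<in>{Z. partial_transversal Z}. Z \<subseteq> Z' \<longrightarrow> Z' = Z"
    using subset_Zorn_nonempty[of "{Z. partial_transversal Z}"] by blast
  then show ?thesis by auto
qed

text \<open>In a maximal partial transversal, let an edge join \<open>y\<close> to \<open>z\<close>,
  where the orbit of \<open>y\<close> meets \<open>Z\<close>. If the orbit of \<open>z\<close>
  missed \<open>Z\<close>, a translate of the edge would start in \<open>Z\<close>, and its other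
  end could be added. So the orbits that meet \<open>Z\<close> spread along all edges from
  \<open>y0\<close>.\<close>

lemma transversal_exists: "\<exists>Z. partial_transversal Z \<and> (\<forall>y\<in>Y. \<exists>g\<in>carrier G. act g y \<in> Z)"
proof -
  obtain Z where Z: "partial_transversal Z" and max: "\<And>Z'. partial_transversal Z' \<Longrightarrow> Z \<subseteq> Z' \<Longrightarrow> Z' = Z"
    using maximal_partial_transversal by blast
  have ZY: "Z \<subseteq> Y" and y0Z: "y0 \<in> Z"
    and conn: "\<And>z. z \<in> Z \<Longrightarrow> (y0, z) \<in> ((E \<inter> Z \<times> Z) \<union> (E \<inter> Z \<times> Z)\<inverse>)\<^sup>*"
    and indep: "\<And>z g. z \<in> Z \<Longrightarrow> g \<in> carrier G \<Longrightarrow> act g z \<in> Z \<Longrightarrow> g = \<one>"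
    using partial_transversalD[OF Z] by blast+
  have orbit_step: "\<exists>g\<in>carrier G. act g z \<in> Z"
    if y: "g \<in> carrier G" "act g y \<in> Z" and yz: "(y, z) \<in> E \<union> E\<inverse>" for g y z
  proof (rule ccontr)
    assume none: "\<not> ?thesis"
    define z' where "z' = act g z"
    have zY: "z \<in> Y" "y \<in> Y" using yz E_subset by auto
    then have z'Y: "z' \<in> Y" using y act_closed by (simp add: z'_def)
    have none': "act h z' \<notin> Z" if "h \<in> carrier G" for h
      using none m_closed[OF that y(1)] act_mult[OF that y(1) zY(1)] by (metis z'_def)
    have edge: "(act g y, z') \<in> E \<union> E\<inverse>" using yz E_act[OF y(1)] by (auto simp: z'_def)
    let ?Z = "insert z' Z"
    have mono: "((E \<inter> Z \<times> Z) \<union> (E \<inter> Z \<times> Z)\<inverse>)\<^sup>* \<subseteq> ((E \<inter> ?Z \<times> ?Z) \<union> (E \<inter> ?Z \<times> ?Z)\<inverse>)\<^sup>*"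
      by (rule rtrancl_mono) blast
    have "(act g y, z') \<in> (E \<inter> ?Z \<times> ?Z) \<union> (E \<inter> ?Z \<times> ?Z)\<inverse>" using edge y(2) by blast
    with mono conn[OF y(2)] have "(y0, z') \<in> ((E \<inter> ?Z \<times> ?Z) \<union> (E \<inter> ?Z \<times> ?Z)\<inverse>)\<^sup>*"
      by (meson rtrancl.rtrancl_into_rtrancl subsetD)
    then have conn': "(y0, x) \<in> ((E \<inter> ?Z \<times> ?Z) \<union> (E \<inter> ?Z \<times> ?Z)\<inverse>)\<^sup>*" if "x \<in> ?Z" for x
      using conn mono that by blast
    have "h = \<one>" if x: "x \<in> ?Z" "act h x \<in> ?Z" and h: "h \<in> carrier G" for h x
    proof -
      consider "x \<in> Z" "act h x \<in> Z" | "x = z'" "act h x \<in> Z" | "x \<in> Z" "act h x = z'" | "x = z'" "act h x = z'"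
        using x by blast
      then show ?thesis
      proof cases
        case 3
        then have "act (inv h) z' = x" using act_inv_act[OF h, of x] ZY by auto
        then show ?thesis using none'[of "inv h"] h 3 by simp
      next
        case 4
        then show ?thesis using act_free[OF h z'Y] by simp
      next
        case 1
        then show ?thesis using indep h by simp
      next
        case 2
        then show ?thesis using none'[OF h] by simp
      qed
    qed
    then have "partial_transversal ?Z"
      using ZY z'Y y0Z conn' unfolding partial_transversal_def by blast
    then have "?Z = Z" by (rule max) blast
    then show False using none'[OF one_closed] z'Y by (auto simp: act_one)
  qed
  have "\<exists>g\<in>carrier G. act g y \<in> Z" if "y \<in> Y" for y
    using connected[OF that]
  proof induction
    case base
    then show ?case using y0Z y0 by (intro bexI[of _ \<one>]) (auto simp: act_one)
  next
    case (step y z)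
    from step.IH obtain g where "g \<in> carrier G" "act g y \<in> Z" by blast
    then show ?case using step(2) by (rule orbit_step)
  qed
  then show ?thesis using Z by blast
qed

text \<open>A connected transversal \<open>Z\<close> gives an equivariant map \<open>h\<close> from the tree to the group.  The nontrivial
  differences of \<open>h\<close> along edges form a basis \<open>B\<close>: integrating them in the free group on \<open>B\<close> yields
  \<open>\<Theta>\<close>, which inverts the evaluation of words.\<close>

theorem is_free_group_if_free_tree_action: "is_free_group G"
proof -
  obtain Z where Z: "partial_transversal Z" and cover: "\<And>y. y \<in> Y \<Longrightarrow> \<exists>g\<in>carrier G. act g y \<in> Z"
    using transversal_exists by blast
  have ZY: "Z \<subseteq> Y" and y0Z: "y0 \<in> Z"
    and conn: "\<And>z. z \<in> Z \<Longrightarrow> (y0, z) \<in> ((E \<inter> Z \<times> Z) \<union> (E \<inter> Z \<times> Z)\<inverse>)\<^sup>*"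
    and indep: "\<And>z g. z \<in> Z \<Longrightarrow> g \<in> carrier G \<Longrightarrow> act g z \<in> Z \<Longrightarrow> g = \<one>"
    using partial_transversalD[OF Z] by blast+
  \<comment> \<open>\<open>q y\<close> brings \<open>y\<close> into \<open>Z\<close> and is unique
    with this property; its inverse \<open>h y\<close> names the translate of \<open>Z\<close> that
    contains \<open>y\<close>, which is why \<open>h\<close> is equivariant.\<close>
  define q where "q = (\<lambda>y. SOME g. g \<in> carrier G \<and> act g y \<in> Z)"
  define h where "h = (\<lambda>y. inv (q y))"
  have q: "q y \<in> carrier G" "act (q y) y \<in> Z" if "y \<in> Y" for y
    using someI_ex[of "\<lambda>g. g \<in> carrier G \<and> act g y \<in> Z"] cover[OF that] by (auto simp: q_def)
  have q_eq: "q y = g" if "y \<in> Y" "g \<in> carrier G" "act g y \<in> Z" for y g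
  proof -
    have "act (g \<otimes> inv (q y)) (act (q y) y) = act g y"
      using that q act_mult act_inv_act act_closed by simp
    then have "g \<otimes> inv (q y) = \<one>" using that q indep[of "act (q y) y" "g \<otimes> inv (q y)"] by simp
    then show ?thesis using q that by (metis inv_solve_right' l_one r_inv inv_closed one_closed)
  qed
  have h_closed: "h y \<in> carrier G" if "y \<in> Y" for y using q that by (simp add: h_def)
  have h_act: "h (act g y) = g \<otimes> h y" if "g \<in> carrier G" "y \<in> Y" for g y
  proof -
    have "q (act g y) = q y \<otimes> inv g"
      using that q act_closed act_inv_act by (intro q_eq) (auto simp: act_mult)
    then show ?thesis using that q by (simp add: h_def inv_mult_group)
  qed
  have h_Z: "h y = \<one>" if "y \<in> Z" for y
    using q_eq[of y \<one>] that ZY by (auto simp: h_def act_one)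
  have Z_h: "y \<in> Z" if "y \<in> Y" "h y = \<one>" for y
  proof -
    have "q y = \<one>" using that q[of y] by (simp add: h_def inv_eq_1_iff)
    then show ?thesis using q(2)[OF that(1)] that by (simp add: act_one)
  qed
  define lab where "lab = (\<lambda>y z. inv (h y) \<otimes> h z)"
  have lab_closed: "lab y z \<in> carrier G" if "y \<in> Y" "z \<in> Y" for y z
    using that h_closed by (simp add: lab_def)
  have lab_act: "lab (act g y) (act g z) = lab y z" if "g \<in> carrier G" "y \<in> Y" "z \<in> Y" for g y z
  proof -
    have "inv g \<otimes> (g \<otimes> h z) = h z" using that h_closed by (simp add: m_assoc[symmetric])
    then show ?thesis using that h_closed by (simp add: lab_def h_act inv_mult_group m_assoc)
  qed
  have h_lab: "h z = h y \<otimes> lab y z" if "y \<in> Y" "z \<in> Y" for y z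
    using that h_closed by (simp add: lab_def m_assoc[symmetric])
  \<comment> \<open>Edges labelled by the identity stay inside one translate of \<open>Z\<close>.
    They contribute no generator, and the potential will be constant along them.\<close>
  define B where "B = {lab y z | y z. (y, z) \<in> E} - {\<one>}"
  have B: "B \<subseteq> carrier G" using lab_closed E_subset by (auto simp: B_def)
  let ?F = "free_group B"
  interpret F: group ?F by (rule group_free_group)
  define c where "c = (\<lambda>y z. if lab y z = \<one> then \<one>\<^bsub>?F\<^esub> else free_class B [(lab y z, True)])"
  have lab_B: "lab y z \<in> B" if "(y, z) \<in> E" "lab y z \<noteq> \<one>" for y z using that by (auto simp: B_def)
  have c_closed: "c y z \<in> carrier ?F" if "(y, z) \<in> E" for y z
    using lab_B[OF that] by (auto simp: c_def intro: free_class_mem)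
  obtain \<Theta>0 where \<Theta>0: "\<And>y. y \<in> Y \<Longrightarrow> \<Theta>0 y \<in> carrier ?F"
      "\<And>y z. (y, z) \<in> E \<Longrightarrow> \<Theta>0 z = \<Theta>0 y \<otimes>\<^bsub>?F\<^esub> c y z"
    using potential[OF B, of c] c_closed by blast
  define \<Theta> where "\<Theta> = (\<lambda>y. inv\<^bsub>?F\<^esub> \<Theta>0 y0 \<otimes>\<^bsub>?F\<^esub> \<Theta>0 y)"
  have \<Theta>: "\<Theta> y \<in> carrier ?F" if "y \<in> Y" for y using \<Theta>0(1) that y0 by (simp add: \<Theta>_def)
  have \<Theta>_step: "\<Theta> z = \<Theta> y \<otimes>\<^bsub>?F\<^esub> c y z" if "(y, z) \<in> E" for y z
    using \<Theta>0(1) \<Theta>0(2)[OF that] c_closed[OF that] that E_subset y0 by (auto simp: \<Theta>_def F.m_assoc)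
  have \<Theta>_y0: "\<Theta> y0 = \<one>\<^bsub>?F\<^esub>" using \<Theta>0(1) y0 by (simp add: \<Theta>_def)
  \<comment> \<open>The labels are invariant under the action and left multiplication preserves
    potentials, so both sides are potentials of \<open>c\<close>; they agree at \<open>y0\<close>
    because \<open>\<Theta> y0\<close> is trivial.\<close>
  have \<Theta>_act: "\<Theta> (act g y) = \<Theta> (act g y0) \<otimes>\<^bsub>?F\<^esub> \<Theta> y" if g: "g \<in> carrier G" and y: "y \<in> Y" for g y
  proof (rule potential_unique[where f = "\<lambda>y. \<Theta> (act g y)" and c = c and
        g = "\<lambda>y. \<Theta> (act g y0) \<otimes>\<^bsub>?F\<^esub> \<Theta> y", OF group_free_group connected[OF y] y0 E_subset])
    show "\<Theta> (act g z) = \<Theta> (act g x) \<otimes>\<^bsub>?F\<^esub> c x z \<and>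
        \<Theta> (act g y0) \<otimes>\<^bsub>?F\<^esub> \<Theta> z = \<Theta> (act g y0) \<otimes>\<^bsub>?F\<^esub> \<Theta> x \<otimes>\<^bsub>?F\<^esub> c x z" if xz: "(x, z) \<in> E" for x z
    proof
      have "c (act g x) (act g z) = c x z" using lab_act[OF g] xz E_subset by (auto simp: c_def)
      then show "\<Theta> (act g z) = \<Theta> (act g x) \<otimes>\<^bsub>?F\<^esub> c x z" using \<Theta>_step[OF E_act[OF g xz]] by simp
      show "\<Theta> (act g y0) \<otimes>\<^bsub>?F\<^esub> \<Theta> z = \<Theta> (act g y0) \<otimes>\<^bsub>?F\<^esub> \<Theta> x \<otimes>\<^bsub>?F\<^esub> c x z"
        using \<Theta>_step[OF xz] c_closed[OF xz] \<Theta> xz E_subset act_closed[OF g y0] by (auto simp: F.m_assoc)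
    qed
  qed (use \<Theta> act_closed g y0 c_closed \<Theta>_y0 in auto)
  have \<Theta>_Z: "\<Theta> z = \<one>\<^bsub>?F\<^esub>" if z: "z \<in> Z" for z
  proof (rule potential_unique[where f = \<Theta> and g = "\<lambda>_. \<one>\<^bsub>?F\<^esub>" and c = "\<lambda>_ _. \<one>\<^bsub>?F\<^esub>",
        OF group_free_group conn[OF z] y0Z])
    show "\<Theta> z = \<Theta> y \<otimes>\<^bsub>?F\<^esub> \<one>\<^bsub>?F\<^esub> \<and> \<one>\<^bsub>?F\<^esub> = \<one>\<^bsub>?F\<^esub> \<otimes>\<^bsub>?F\<^esub> \<one>\<^bsub>?F\<^esub>" if "(y, z) \<in> E \<inter> Z \<times> Z" for y z
      using that \<Theta>_step[of y z] h_Z by (auto simp: c_def lab_def)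
  qed (use \<Theta> ZY \<Theta>_y0 in auto)
  \<comment> \<open>Evaluating a generator returns the label of its edge, hence both sides are
    potentials of \<open>lab\<close>. This will give injectivity of \<Phi>.\<close>
  have eval: "free_eval G (\<Theta> y) = h y" if y: "y \<in> Y" for y
  proof (rule potential_unique[where f = "\<lambda>y. free_eval G (\<Theta> y)" and g = h and c = lab,
        OF group_axioms connected[OF y] y0 E_subset])
    have eval_closed: "fold (\<lambda>(b, x) g. g \<otimes> (if x then b else inv b)) w g \<in> carrier G"
      if "w \<in> lists (B \<times> UNIV)" "g \<in> carrier G" for w g
      using that B by (induction w arbitrary: g) auto
    show "free_eval G (\<Theta> z) \<in> carrier G" if z: "z \<in> Y" for z
    proof -
      obtain w where "w \<in> lists (B \<times> UNIV)" "\<Theta> z = free_class B w"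
        using \<Theta>[OF z] by (rule free_group_cases)
      then show ?thesis using eval_closed by (simp add: free_eval_class[OF B])
    qed
    show "free_eval G (\<Theta> z) = free_eval G (\<Theta> y) \<otimes> lab y z \<and> h z = h y \<otimes> lab y z" if yz: "(y, z) \<in> E" for y z
    proof
      have yzY: "y \<in> Y" "z \<in> Y" using yz E_subset by auto
      then show "h z = h y \<otimes> lab y z" by (rule h_lab)
      obtain w where w: "w \<in> lists (B \<times> UNIV)" "\<Theta> y = free_class B w"
        using \<Theta>[OF yzY(1)] by (rule free_group_cases)
      show "free_eval G (\<Theta> z) = free_eval G (\<Theta> y) \<otimes> lab y z"
      proof (cases "lab y z = \<one>")
        case True
        then show ?thesis using \<Theta>_step[OF yz] \<Theta>[OF yzY(1)] w eval_closed
          by (simp add: c_def free_eval_class[OF B])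
      next
        case False
        then have "\<Theta> z = free_class B (w @ [(lab y z, True)])"
          using \<Theta>_step[OF yz] w lab_B[OF yz] by (simp add: c_def free_group_mult)
        then show ?thesis using w lab_B[OF yz False] by (simp add: free_eval_class[OF B])
      qed
    qed
    show "free_eval G (\<Theta> y0) = h y0"
      using h_Z[OF y0Z] \<Theta>_y0 by (simp add: free_group_one free_eval_class[OF B])
  qed (use h_closed lab_closed E_subset in auto)
  define \<Phi> where "\<Phi> = (\<lambda>g. \<Theta> (act g y0))"
  have hom: "\<Phi> \<in> hom G ?F"
  proof (rule homI)
    fix g k assume gk: "g \<in> carrier G" "k \<in> carrier G"
    then show "\<Phi> (g \<otimes> k) = \<Phi> g \<otimes>\<^bsub>?F\<^esub> \<Phi> k"
      using \<Theta>_act[OF gk(1) act_closed[OF gk(2) y0]] y0 by (simp add: \<Phi>_def act_mult)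
  qed (use \<Theta> act_closed y0 in \<open>simp add: \<Phi>_def\<close>)
  interpret \<Phi>: group_hom G ?F \<Phi> by unfold_locales (rule hom)
  have "free_eval G (\<Phi> g) = g" if "g \<in> carrier G" for g
    using eval[OF act_closed[OF that y0]] h_act[OF that y0] h_Z[OF y0Z] that by (simp add: \<Phi>_def)
  then have inj: "inj_on \<Phi> (carrier G)" by (rule inj_on_inverseI[where f = \<Phi> and g = "free_eval G"])
  have "free_class B [(b, True)] \<in> \<Phi> ` carrier G" if b: "b \<in> B" for b
  proof -
    obtain y1 z1 where yz1: "b = lab y1 z1" "(y1, z1) \<in> E" "b \<noteq> \<one>" using b unfolding B_def by blast
    have yzY1: "y1 \<in> Y" "z1 \<in> Y" using yz1 E_subset by auto
    \<comment> \<open>Surjectivity: an edge with label \<open>b\<close> is translated so that it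
      starts in \<open>Z\<close>. Then \<Theta> at its far end \<open>z\<close> is the generator
      \<open>b\<close>. Since \<open>z\<close> lies in the translate of \<open>Z\<close> by
      \<open>b\<close>, where \<Theta> is constant, this value is also
      \<open>\<Phi> b\<close>.\<close>
    define y z where "y = act (inv (h y1)) y1" and "z = act (inv (h y1)) z1"
    have yz: "(y, z) \<in> E" and yY: "y \<in> Y" "z \<in> Y" and lab: "lab y z = b"
      using yz1 yzY1 E_act act_closed lab_act h_closed by (auto simp: y_def z_def)
    have hy: "h y = \<one>" using yzY1 h_act h_closed by (simp add: y_def)
    have hz: "h z = b" using h_lab[OF yY] hy lab B b by auto
    have bG: "b \<in> carrier G" using B b by auto
    have "\<Theta> y = \<one>\<^bsub>?F\<^esub>" using \<Theta>_Z Z_h yY hy by simp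
    then have "\<Theta> z = free_class B [(b, True)]"
      using \<Theta>_step[OF yz] lab yz1(3) c_closed[OF yz] by (simp add: c_def)
    moreover have "act (inv b) z \<in> Z" using yY bG hz h_act by (intro Z_h act_closed) auto
    then have "\<Theta> (act b (act (inv b) z)) = \<Phi> b"
      using \<Theta>_act[OF bG, of "act (inv b) z"] \<Theta>_Z ZY bG act_closed y0 \<Theta> by (auto simp: \<Phi>_def)
    then have "\<Theta> z = \<Phi> b" using act_inv_act[of "inv b" z] bG yY by simp
    ultimately show ?thesis using bG by auto
  qed
  then have "\<Phi> ` carrier G = carrier ?F"
    using \<Phi>.img_is_subgroup subgroup_free_group_eq by blast
  then have "\<Phi> \<in> iso G ?F" using hom inj by (simp add: iso_def bij_betw_def)
  then have "?F \<cong> G" by (meson iso_sym is_isoI)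
  then show ?thesis using B by (auto simp: is_free_group_def)
qed

end

section \<open>Potentials on trees\<close>

lemma bidirected_simps [simp]:
  "verts (bidirected T) = verts T" "arcs (bidirected T) = arcs T \<times> UNIV"
  "tail (bidirected T) (e, x) = (if x then tail T e else head T e)"
  "head (bidirected T) (e, x) = (if x then head T e else tail T e)"
  by (simp_all add: bidirected_def)

lemma wf_digraph_bidirected:
  assumes "wf_digraph T"
  shows "wf_digraph (bidirected T)"
proof -
  interpret wf_digraph T by fact
  show ?thesis by unfold_locales auto
qed

section \<open>Removing an arc disconnects a tree\<close>

context wf_digraph
begin

text \<open>Cutting out closed subwalks adds no arcs. The control over arcs matters later, when a
  path has to avoid a given arc.\<close>

lemma apath_subset_of_awalk:
  assumes "awalk u p v"
  shows "\<exists>q. apath u q v \<and> set q \<subseteq> set p"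
  using assms
proof (induction p rule: length_induct)
  case (1 p)
  show ?case
  proof (cases "distinct (awalk_verts u p)")
    case True
    then show ?thesis using 1(2) by (auto simp: apath_def)
  next
    case False
    then obtain q r s w where *: "p = q @ r @ s" "0 < length r" "awalk u q w" "awalk w s v"
      using awalk_not_distinct_decomp[OF 1(2)] by blast
    have "awalk u (q @ s) v" using *(3,4) awlast_if_cas by (auto elim: awalkE)
    moreover have "length (q @ s) < length p" using *(1,2) by simp
    ultimately obtain t where "apath u t v" "set t \<subseteq> set (q @ s)" using 1(1) by blast
    then show ?thesis using *(1) by auto
  qed
qed

lemma arc_ends_in_awalk_verts:
  assumes "awalk u p v" "a \<in> set p"
  shows "tail G a \<in> set (awalk_verts u p)" "head G a \<in> set (awalk_verts u p)"
  using assms set_awalk_verts[OF assms(1)] by auto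

end

text \<open>If an underlying arc occurred again later, in either direction, both of its ends would
  be among the later vertices, so the path would return to the vertex where it first used the
  arc.\<close>

lemma apath_bidirected_distinct:
  assumes "wf_digraph T" and "pre_digraph.apath (bidirected T) u p v"
  shows "distinct (map fst p)"
proof -
  interpret wf_digraph "bidirected T" using assms(1) by (rule wf_digraph_bidirected)
  show ?thesis using assms(2)
  proof (induction p arbitrary: u)
    case (Cons a p)
    then have p: "apath (head (bidirected T) a) p v"
      and a: "tail (bidirected T) a \<notin> set (awalk_verts (head (bidirected T) a) p)"
      by (auto simp: apath_Cons_iff)
    have "fst a \<notin> fst ` set p"
    proof
      assume "fst a \<in> fst ` set p"
      then obtain y where y: "(fst a, y) \<in> set p" by force
      obtain x where x: "a = (fst a, x)" by (cases a) auto
      note xy = y x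
      have "awalk (head (bidirected T) a) p v" using p by (rule awalkI_apath)
      from arc_ends_in_awalk_verts[OF this xy(1)]
      have "tail (bidirected T) (fst a, x) \<in> set (awalk_verts (head (bidirected T) a) p)"
        by (simp split: if_splits)
      then show False using a xy(2) by metis
    qed
    then show ?case using Cons.IH[OF p] by simp
  qed simp
qed

text \<open>Otherwise a path in \<open>A\<close> from the head of \<open>e\<close> back to its tail,
  closed up by \<open>e\<close>, would be a cycle with distinct underlying arcs.\<close>

lemma tree_arc_is_bridge:
  assumes wf: "wf_digraph T" and tree: "unoriented_tree T" and A: "A \<subseteq> arcs T" and e: "e \<in> arcs T - A"
  shows "(head T e, tail T e) \<notin>
    ({(tail T a, head T a) | a. a \<in> A} \<union> {(head T a, tail T a) | a. a \<in> A})\<^sup>*" (is "_ \<notin> ?R\<^sup>*")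
proof
  interpret T: wf_digraph T by fact
  interpret wf_digraph "bidirected T" using wf by (rule wf_digraph_bidirected)
  let ?B = "bidirected T"
  assume "(head T e, tail T e) \<in> ?R\<^sup>*"
  then have "\<exists>p. awalk (head T e) p (tail T e) \<and> fst ` set p \<subseteq> A"
  proof (induction rule: converse_rtrancl_induct)
    case base
    show ?case using e by (intro exI[of _ "[]"]) (auto simp: awalk_Nil_iff)
  next
    case (step u w)
    then obtain p where p: "awalk w p (tail T e)" "fst ` set p \<subseteq> A" by blast
    from step.hyps(1) obtain a x where a: "a \<in> A" "u = tail ?B (a, x)" "w = head ?B (a, x)"
    proof -
      assume *: "\<And>a x. a \<in> A \<Longrightarrow> u = tail ?B (a, x) \<Longrightarrow> w = head ?B (a, x) \<Longrightarrow> thesis"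
      from step.hyps(1) obtain a where "a \<in> A"
          "(u = tail T a \<and> w = head T a) \<or> (u = head T a \<and> w = tail T a)" by blast
      then show thesis using *[of a True] *[of a False] by auto
    qed
    then have "awalk u ((a, x) # p) (tail T e)" using p A by (auto simp: awalk_Cons_iff)
    then show ?case using p(2) a(1) by (intro exI[of _ "(a, x) # p"]) simp
  qed
  then obtain p where "awalk (head T e) p (tail T e)" "fst ` set p \<subseteq> A" by blast
  then obtain p where p: "apath (head T e) p (tail T e)" "fst ` set p \<subseteq> A"
    using apath_subset_of_awalk by (meson image_mono order_trans)
  have aw: "awalk (head T e) p (tail T e)" using p(1) by (rule awalkI_apath)
  have last: "awlast (head T e) p = tail T e" using aw by blast
  have cyc: "awalk (head T e) (p @ [(e, True)]) (head T e)"
    using aw last e by (simp add: awalk_Cons_iff awalk_Nil_iff)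
  have "awalk_verts (head T e) (p @ [(e, True)]) = awalk_verts (head T e) p @ [head T e]"
    using awalk_verts_append[OF cyc] last by simp
  moreover have "awalk_verts (head T e) p = head T e # tl (awalk_verts (head T e) p)"
    using aw awalk_verts_non_Nil by (metis awalkE list.collapse)
  moreover have "distinct (awalk_verts (head T e) p)" using p(1) by (simp add: apath_def)
  ultimately have "distinct (tl (awalk_verts (head T e) (p @ [(e, True)])))"
    by (cases "awalk_verts (head T e) p") auto
  then have "cycle (p @ [(e, True)])" using cyc unfolding cycle_def by blast
  moreover have "e \<notin> fst ` set p" using p(2) e by blast
  then have "distinct (map fst (p @ [(e, True)]))" using apath_bidirected_distinct[OF wf p(1)] by simp
  ultimately show False using tree unfolding unoriented_tree_def by blast
qed

text \<open>Arcs are added one by one. A new arc \<open>e\<close> may violate the equation, which is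
  repaired by a left multiplication on the component of its head with respect to the old arcs. The
  old equations survive left multiplication, and the tail of \<open>e\<close> is not in that
  component because \<open>e\<close> is a bridge.\<close>

lemma tree_potential:
  assumes wf: "wf_digraph T" and tree: "unoriented_tree T" and fin: "finite (arcs T)"
    and "group F" and c: "\<And>e. e \<in> arcs T \<Longrightarrow> c e \<in> carrier F"
  shows "\<exists>P. (\<forall>v. P v \<in> carrier F) \<and> (\<forall>e\<in>arcs T. P (head T e) = P (tail T e) \<otimes>\<^bsub>F\<^esub> c e)"
proof -
  interpret F: group F by fact
  have "\<exists>P. (\<forall>v. P v \<in> carrier F) \<and> (\<forall>e\<in>A. P (head T e) = P (tail T e) \<otimes>\<^bsub>F\<^esub> c e)"
    if "finite A" "A \<subseteq> arcs T" for A
    using that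
  proof (induction A)
    case empty
    show ?case by (intro exI[of _ "\<lambda>_. \<one>\<^bsub>F\<^esub>"]) simp
  next
    case (insert e A)
    then obtain P where P: "\<And>v. P v \<in> carrier F"
        "\<And>a. a \<in> A \<Longrightarrow> P (head T a) = P (tail T a) \<otimes>\<^bsub>F\<^esub> c a" by auto
    let ?R = "{(tail T a, head T a) | a. a \<in> A} \<union> {(head T a, tail T a) | a. a \<in> A}"
    \<comment> \<open>The factor that the equation at \<open>e\<close> dictates when only the value
      at the head is changed.\<close>
    let ?k = "P (tail T e) \<otimes>\<^bsub>F\<^esub> c e \<otimes>\<^bsub>F\<^esub> inv\<^bsub>F\<^esub> P (head T e)"
    define C where "C = {v. (head T e, v) \<in> ?R\<^sup>*}"
    define P' where "P' = (\<lambda>v. if v \<in> C then ?k \<otimes>\<^bsub>F\<^esub> P v else P v)"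
    have ce: "c e \<in> carrier F" using insert.prems c by simp
    have tl: "tail T e \<notin> C"
      using tree_arc_is_bridge[OF wf tree, of A e] insert by (auto simp: C_def)
    have hd: "head T e \<in> C" by (simp add: C_def)
    have same: "tail T a \<in> C \<longleftrightarrow> head T a \<in> C" if "a \<in> A" for a
    proof -
      have "(tail T a, head T a) \<in> ?R" "(head T a, tail T a) \<in> ?R" using that by blast+
      then show ?thesis unfolding C_def mem_Collect_eq by (meson rtrancl.rtrancl_into_rtrancl)
    qed
    have "P' (head T a) = P' (tail T a) \<otimes>\<^bsub>F\<^esub> c a" if a: "a \<in> A" for a
      using same[OF a] P c[of a] a insert.prems ce by (auto simp: P'_def F.m_assoc)
    moreover have "P' (head T e) = P' (tail T e) \<otimes>\<^bsub>F\<^esub> c e"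
      using hd tl P(1) ce by (simp add: P'_def F.m_assoc)
    moreover have "P' v \<in> carrier F" for v using P(1) ce by (simp add: P'_def)
    ultimately show ?case by auto
  qed
  from this[OF fin] show ?thesis by simp
qed

lemma connected_propagate:
  assumes conn: "Digraph_Component.connected T" and "u \<in> verts T" "v \<in> verts T" "Q u"
    and step: "\<And>e. e \<in> arcs T \<Longrightarrow> Q (tail T e) \<longleftrightarrow> Q (head T e)"
  shows "Q v"
proof -
  let ?M = "with_proj (mk_symmetric T)"
  have "u \<rightarrow>\<^sup>*\<^bsub>?M\<^esub> v"
    using conn assms(2,3) unfolding connected_def strongly_connected_def by (simp add: mk_symmetric_def)
  then have "(u, v) \<in> (arcs_ends ?M)\<^sup>*" unfolding reachable_def by (rule rtrancl_on_rtranclI)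
  then show ?thesis
  proof induction
    case (step y z)
    then obtain e where "e \<in> arcs T" "(y, z) = (tail T e, head T e) \<or> (y, z) = (head T e, tail T e)"
      by (auto simp: arcs_ends_def arc_to_ends_def mk_symmetric_def)
    then show ?case using assms(5) step.IH by auto
  qed fact
qed

section \<open>Decompositions as a graph of groups\<close>

lemma (in group) inv_mult_cancel:
  assumes "x \<in> carrier G" "y \<in> carrier G"
  shows "inv x \<otimes> (x \<otimes> y) = y" "x \<otimes> (inv x \<otimes> y) = y"
  using assms by (simp_all add: m_assoc[symmetric])

locale graph_decomposition = group G for G :: "('a, 'm) monoid_scheme" (structure) +
  fixes T :: "('v, 'e, 'g, 'h) group_graph" and T' :: "('v, 'e) pre_digraph"
    and \<phi> :: "('v, 'e, 'g) letter list set \<Rightarrow> 'a"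
  assumes graph_of_groups: "graph_of_groups T"
    and fin_digraph: "fin_digraph (graph T)"
    and maximal_subtree: "maximal_subtree T' (graph T)"
    and iso: "\<phi> \<in> iso (fundamental_group T T') G"
begin

sublocale gog: graph_of_groups T
  by (rule graph_of_groups)

sublocale fin_digraph "graph T"
  by (rule fin_digraph)

abbreviation "V \<equiv> verts (graph T)"
abbreviation "A \<equiv> arcs (graph T)"
abbreviation "VG \<equiv> vgroup T"
abbreviation "EG \<equiv> egroup T"
abbreviation "src \<equiv> tail (graph T)"
abbreviation "tgt \<equiv> head (graph T)"
abbreviation "letters \<equiv> pi1_letters T"
abbreviation "cong \<equiv> word_congruence (pi1_letters T) (pi1_relations T T')"

definition val :: "('v, 'e, 'g) letter list \<Rightarrow> 'a" where
  "val w = \<phi> (cong `` {w})"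

definition \<iota> :: "'v \<Rightarrow> 'g \<Rightarrow> 'a" where
  "\<iota> v a = val [Vert v a]"

text \<open>The stable letter of \<open>e\<close>, which is trivial on the maximal subtree by
  \<open>t_tree\<close>.\<close>

definition t :: "'e \<Rightarrow> 'a" where
  "t e = val [Edge e True]"

lemma \<iota>_eq: "\<iota> v a = \<phi> (vgroup_to_pi1 T T' v a)"
  by (simp add: \<iota>_def val_def vgroup_to_pi1_def)

lemma tree_T': "unoriented_tree T'"
  using maximal_subtree by (simp add: maximal_subtree_def)

lemma wf_T': "wf_digraph T'"
  and T'_arcs: "arcs T' \<subseteq> A"
  and T'_verts: "verts T' = V"
  and T'_tail: "tail T' = src"
  and T'_head: "head T' = tgt"
  using maximal_subtree by (auto simp: maximal_subtree_def spanning_def subgraph_def compatible_def)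

lemma finite_T': "finite (arcs T')"
  using T'_arcs finite_arcs by (rule finite_subset)

lemma V_nonempty: "V \<noteq> {}"
  using gog.connected by (auto simp: Digraph_Component.connected_def strongly_connected_def mk_symmetric_def)

lemma group_vgroup: "v \<in> V \<Longrightarrow> group (VG v)"
  by (rule gog.group_vgroup)

lemma group_egroup: "e \<in> A \<Longrightarrow> group (EG e)"
  by (rule gog.group_egroup)

lemma to_tail_hom: "e \<in> A \<Longrightarrow> to_tail T e \<in> hom (EG e) (VG (src e))"
  and to_tail_inj: "e \<in> A \<Longrightarrow> inj_on (to_tail T e) (carrier (EG e))"
  and to_head_hom: "e \<in> A \<Longrightarrow> to_head T e \<in> hom (EG e) (VG (tgt e))"
  and to_head_inj: "e \<in> A \<Longrightarrow> inj_on (to_head T e) (carrier (EG e))"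
  using gog.to_tail gog.to_head by (auto simp: mon_def)

lemma to_tail_closed: "e \<in> A \<Longrightarrow> a \<in> carrier (EG e) \<Longrightarrow> to_tail T e a \<in> carrier (VG (src e))"
  and to_head_closed: "e \<in> A \<Longrightarrow> a \<in> carrier (EG e) \<Longrightarrow> to_head T e a \<in> carrier (VG (tgt e))"
  using to_tail_hom to_head_hom by (auto simp: hom_def Pi_def)

lemma vert_letter: "v \<in> V \<Longrightarrow> a \<in> carrier (VG v) \<Longrightarrow> Vert v a \<in> letters"
  and edge_letter: "e \<in> A \<Longrightarrow> Edge e x \<in> letters"
  by (auto simp: pi1_letters_def)

lemma letter_cases:
  assumes "l \<in> letters"
  obtains v a where "l = Vert v a" "v \<in> V" "a \<in> carrier (VG v)" | e x where "l = Edge e x" "e \<in> A"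
  using assms by (auto simp: pi1_letters_def)

lemma \<phi>_hom: "\<phi> \<in> hom (fundamental_group T T') G"
  and \<phi>_inj: "inj_on \<phi> (carrier (fundamental_group T T'))"
  and \<phi>_surj: "\<phi> ` carrier (fundamental_group T T') = carrier G"
  using iso by (auto simp: iso_def bij_betw_def)

lemma word_mem: "w \<in> lists letters \<Longrightarrow> cong `` {w} \<in> carrier (fundamental_group T T')"
  unfolding fundamental_group_def by (rule word_class_mem)

lemma val_closed [intro]: "w \<in> lists letters \<Longrightarrow> val w \<in> carrier G"
  unfolding val_def using hom_in_carrier[OF \<phi>_hom word_mem] .

lemma val_append:
  assumes "u \<in> lists letters" "w \<in> lists letters"
  shows "val (u @ w) = val u \<otimes> val w"
proof -
  have "cong `` {u @ w} = cong `` {u} \<otimes>\<^bsub>fundamental_group T T'\<^esub> cong `` {w}"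
    unfolding fundamental_group_def using assms by (rule presented_monoid_mult[symmetric])
  then show ?thesis
    unfolding val_def using hom_mult[OF \<phi>_hom word_mem[OF assms(1)] word_mem[OF assms(2)]] by simp
qed

lemma val_Nil: "val [] = \<one>"
proof -
  have "val [] \<otimes> val [] = val []" using val_append[of "[]" "[]"] by simp
  then show ?thesis using l_cancel_one[of "val []" "val []"] val_closed[of "[]"] by simp
qed

lemma val_Cons:
  assumes "l \<in> letters" "w \<in> lists letters"
  shows "val (l # w) = val [l] \<otimes> val w"
  using val_append[of "[l]" w] assms by simp

lemma val_eq_iff:
  assumes "u \<in> lists letters" "w \<in> lists letters"
  shows "val u = val w \<longleftrightarrow> (u, w) \<in> cong"
proof -
  have "val u = val w \<longleftrightarrow> cong `` {u} = cong `` {w}"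
    unfolding val_def using inj_on_eq_iff[OF \<phi>_inj word_mem[OF assms(1)] word_mem[OF assms(2)]] .
  also have "\<dots> \<longleftrightarrow> (u, w) \<in> cong" using assms by (rule word_class_eq_iff)
  finally show ?thesis .
qed

lemma val_surj:
  assumes "g \<in> carrier G"
  obtains w where "w \<in> lists letters" "val w = g"
proof -
  have "g \<in> \<phi> ` carrier (fundamental_group T T')" using \<phi>_surj assms by simp
  then obtain X where X: "X \<in> carrier (fundamental_group T T')" "\<phi> X = g" by (rule imageE) simp
  from X(1) obtain w where "w \<in> lists letters" "X = cong `` {w}"
    unfolding fundamental_group_def by (rule presented_monoid_cases)
  then show ?thesis using X(2) that by (simp add: val_def)
qed

lemma val_relation: "(u, w) \<in> pi1_relations T T' \<Longrightarrow> u \<in> lists letters \<Longrightarrow> w \<in> lists letters \<Longrightarrow> val u = val w"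
  by (simp add: val_eq_iff word_congruence_relation)

lemma \<iota>_closed [simp]: "v \<in> V \<Longrightarrow> a \<in> carrier (VG v) \<Longrightarrow> \<iota> v a \<in> carrier G"
  unfolding \<iota>_def by (intro val_closed) (simp add: vert_letter)

lemma t_closed [simp]: "e \<in> A \<Longrightarrow> t e \<in> carrier G"
  unfolding t_def by (intro val_closed) (simp add: edge_letter)

lemma \<iota>_hom: "v \<in> V \<Longrightarrow> \<iota> v \<in> hom (VG v) G"
proof (rule homI)
  fix a b assume v: "v \<in> V" and ab: "a \<in> carrier (VG v)" "b \<in> carrier (VG v)"
  interpret vg: group "VG v" using v by (rule group_vgroup)
  have "([Vert v a, Vert v b], [Vert v (a \<otimes>\<^bsub>VG v\<^esub> b)]) \<in> pi1_relations T T'"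
    unfolding pi1_relations_def using v ab by blast
  then have "val [Vert v a, Vert v b] = val [Vert v (a \<otimes>\<^bsub>VG v\<^esub> b)]"
    using v ab by (intro val_relation) (simp_all add: vert_letter)
  moreover have "val [Vert v a, Vert v b] = val [Vert v a] \<otimes> val [Vert v b]"
    using v ab by (intro val_Cons) (simp_all add: vert_letter)
  ultimately show "\<iota> v (a \<otimes>\<^bsub>VG v\<^esub> b) = \<iota> v a \<otimes> \<iota> v b" by (simp add: \<iota>_def)
qed simp

lemma t_inv:
  assumes "e \<in> A"
  shows "val [Edge e False] = inv (t e)"
proof -
  have "([Edge e False, Edge e (\<not> False)], []) \<in> pi1_relations T T'"
    unfolding pi1_relations_def using assms by blast
  then have "val [Edge e False, Edge e True] = val []"
    using assms by (intro val_relation) (simp_all add: edge_letter)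
  moreover have "val [Edge e False, Edge e True] = val [Edge e False] \<otimes> val [Edge e True]"
    using assms by (intro val_Cons) (simp_all add: edge_letter)
  moreover have "val [Edge e False] \<in> carrier G" using assms by (intro val_closed) (simp add: edge_letter)
  ultimately show ?thesis using t_closed[OF assms] by (intro inv_equality[symmetric]) (simp_all add: val_Nil t_def)
qed

lemma edge_relation:
  assumes "e \<in> A" "a \<in> carrier (EG e)"
  shows "\<iota> (src e) (to_tail T e a) \<otimes> t e = t e \<otimes> \<iota> (tgt e) (to_head T e a)"
proof -
  let ?l = "Vert (src e) (to_tail T e a)" and ?r = "Vert (tgt e) (to_head T e a)"
  have l: "?l \<in> letters" "?r \<in> letters" "Edge e True \<in> letters"
    using assms to_tail_closed to_head_closed by (auto intro: vert_letter edge_letter)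
  have "([?l, Edge e True], [Edge e True, ?r]) \<in> pi1_relations T T'"
    unfolding pi1_relations_def using assms by blast
  then have "val [?l, Edge e True] = val [Edge e True, ?r]"
    using l by (intro val_relation) simp_all
  then show ?thesis using val_Cons[of ?l "[Edge e True]"] val_Cons[of "Edge e True" "[?r]"] l
    by (simp add: \<iota>_def t_def)
qed

lemma t_tree:
  assumes "e \<in> arcs T'"
  shows "t e = \<one>"
proof -
  have "([Edge e True], []) \<in> pi1_relations T T'" unfolding pi1_relations_def using assms by blast
  then have "val [Edge e True] = val []"
    using assms T'_arcs by (intro val_relation) (simp_all add: edge_letter subsetD)
  then show ?thesis by (simp add: t_def val_Nil)
qed

text \<open>The pairs \<open>(g, v)\<close> stand for the vertices of the Bass-Serre tree, and this is its connectedness.\<close>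

lemma tree_induct:
  assumes u: "u \<in> V" "g \<in> carrier G" "Q g u" and v: "v \<in> V" "h \<in> carrier G"
    and vert: "\<And>g v a. v \<in> V \<Longrightarrow> g \<in> carrier G \<Longrightarrow> a \<in> carrier (VG v) \<Longrightarrow> Q g v \<Longrightarrow> Q (g \<otimes> \<iota> v a) v"
    and edge: "\<And>g e. e \<in> A \<Longrightarrow> g \<in> carrier G \<Longrightarrow> Q g (src e) \<longleftrightarrow> Q (g \<otimes> t e) (tgt e)"
  shows "Q h v"
proof -
  \<comment> \<open>For fixed \<open>g\<close> the pairs \<open>(g, x)\<close> form a copy of the
    maximal subtree, because its stable letters are trivial; so the vertex may be changed
    freely.\<close>
  have change: "Q g y" if "x \<in> V" "y \<in> V" "g \<in> carrier G" "Q g x" for g x y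
  proof (rule connected_propagate[of T' x y "Q g"])
    show "Digraph_Component.connected T'" using tree_T' by (simp add: unoriented_tree_def)
    show "Q g (tail T' e) \<longleftrightarrow> Q g (head T' e)" if "e \<in> arcs T'" for e
    proof -
      have "e \<in> A" using that T'_arcs by blast
      then show ?thesis using edge[of e g] \<open>g \<in> carrier G\<close> t_tree[OF that] by (simp add: T'_tail T'_head)
    qed
  qed (use that in \<open>simp_all add: T'_verts\<close>)
  have letter: "Q (g \<otimes> val [l]) y" if l: "l \<in> letters" and g: "g \<in> carrier G" "y \<in> V" "Q g y" for g l y
    using l
  proof (rule letter_cases)
    fix x a assume x: "l = Vert x a" "x \<in> V" "a \<in> carrier (VG x)"
    then have "Q (g \<otimes> \<iota> x a) x" using vert change g by blast
    then have "Q (g \<otimes> \<iota> x a) y" using change[of x y "g \<otimes> \<iota> x a"] x g by simp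
    then show ?thesis using x by (simp add: \<iota>_def)
  next
    fix e b assume e: "l = Edge e b" "e \<in> A"
    have ends: "src e \<in> V" "tgt e \<in> V" using e(2) by auto
    show ?thesis
    proof (cases b)
      case True
      have "Q (g \<otimes> t e) (tgt e)" using edge[OF e(2) g(1)] change[OF g(2) ends(1) g(1,3)] by blast
      then have "Q (g \<otimes> t e) y" using change[OF ends(2) g(2), of "g \<otimes> t e"] g e by simp
      then show ?thesis using True e by (simp add: t_def)
    next
      case False
      have *: "g \<otimes> inv (t e) \<in> carrier G" "g \<otimes> inv (t e) \<otimes> t e = g" using g e by (simp_all add: m_assoc)
      then have "Q (g \<otimes> inv (t e)) (src e)" using edge[OF e(2) *(1)] change[OF g(2) ends(2) g(1,3)] by simp
      then have "Q (g \<otimes> inv (t e)) y" using change[OF ends(1) g(2) *(1)] by simp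
      then show ?thesis using False e t_inv by simp
    qed
  qed
  have word: "Q (g \<otimes> val w) y" if "w \<in> lists letters" "g \<in> carrier G" "y \<in> V" "Q g y" for g w y
    using that
  proof (induction w arbitrary: g)
    case Nil
    then show ?case by (simp add: val_Nil)
  next
    case (Cons l w)
    have l: "val [l] \<in> carrier G" using Cons.hyps by (intro val_closed) simp
    have gl: "Q (g \<otimes> val [l]) y" using Cons.hyps(1) Cons.prems by (rule letter)
    have "Q (g \<otimes> val [l] \<otimes> val w) y"
      by (rule Cons.IH[OF m_closed[OF Cons.prems(1) l] Cons.prems(2) gl])
    moreover have "g \<otimes> val [l] \<otimes> val w = g \<otimes> val (l # w)"
      using val_Cons[OF Cons.hyps(1,2)] Cons.prems(1) l val_closed[OF Cons.hyps(2)] by (simp add: m_assoc)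
    ultimately show ?case by (simp only:)
  qed
  have "inv g \<otimes> h \<in> carrier G" using u v by simp
  then obtain w where w: "w \<in> lists letters" "val w = inv g \<otimes> h" by (rule val_surj)
  have "g \<otimes> (inv g \<otimes> h) = h" using u v by (simp add: inv_mult_cancel)
  then have "Q h u" using word[OF w(1) u(2,1,3)] w(2) by simp
  then show ?thesis by (rule change[OF u(1) v])
qed

lemma tree_potential_T':
  assumes "group F" "\<And>e. e \<in> A \<Longrightarrow> c e \<in> carrier F"
  shows "\<exists>P. (\<forall>v. P v \<in> carrier F) \<and> (\<forall>e\<in>arcs T'. P (tgt e) = P (src e) \<otimes>\<^bsub>F\<^esub> c e)"
  using tree_potential[OF wf_T' tree_T' finite_T' assms(1), of c] assms(2) T'_arcs
  by (auto simp: T'_tail T'_head)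

lemma pi1_relation_cases:
  assumes "(u, w) \<in> pi1_relations T T'"
  obtains
    (one) v where "v \<in> V" "u = [Vert v \<one>\<^bsub>VG v\<^esub>]" "w = []"
  | (mult) v a b where "v \<in> V" "a \<in> carrier (VG v)" "b \<in> carrier (VG v)"
      "u = [Vert v a, Vert v b]" "w = [Vert v (a \<otimes>\<^bsub>VG v\<^esub> b)]"
  | (inv) e x where "e \<in> A" "u = [Edge e x, Edge e (\<not> x)]" "w = []"
  | (conj) e a where "e \<in> A" "a \<in> carrier (EG e)"
      "u = [Vert (src e) (to_tail T e a), Edge e True]" "w = [Edge e True, Vert (tgt e) (to_head T e a)]"
  | (tree) e where "e \<in> arcs T'" "u = [Edge e True]" "w = []"
  using assms unfolding pi1_relations_def by blast

text \<open>The universal property of the fundamental group, for right actions on a set.\<close>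

lemma act_eq_if_val_eq:
  assumes words: "u \<in> lists letters" "w \<in> lists letters" "val u = val w" and x: "x \<in> \<Omega>"
    and vert_closed: "\<And>v a x. v \<in> V \<Longrightarrow> a \<in> carrier (VG v) \<Longrightarrow> x \<in> \<Omega> \<Longrightarrow> act (Vert v a) x \<in> \<Omega>"
    and edge_closed: "\<And>e b x. e \<in> A \<Longrightarrow> x \<in> \<Omega> \<Longrightarrow> act (Edge e b) x \<in> \<Omega>"
    and one: "\<And>v x. v \<in> V \<Longrightarrow> x \<in> \<Omega> \<Longrightarrow> act (Vert v \<one>\<^bsub>VG v\<^esub>) x = x"
    and mult: "\<And>v a b x. v \<in> V \<Longrightarrow> a \<in> carrier (VG v) \<Longrightarrow> b \<in> carrier (VG v) \<Longrightarrow> x \<in> \<Omega> \<Longrightarrow>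
        act (Vert v b) (act (Vert v a) x) = act (Vert v (a \<otimes>\<^bsub>VG v\<^esub> b)) x"
    and inv: "\<And>e b x. e \<in> A \<Longrightarrow> x \<in> \<Omega> \<Longrightarrow> act (Edge e (\<not> b)) (act (Edge e b) x) = x"
    and conj: "\<And>e a x. e \<in> A \<Longrightarrow> a \<in> carrier (EG e) \<Longrightarrow> x \<in> \<Omega> \<Longrightarrow>
        act (Edge e True) (act (Vert (src e) (to_tail T e a)) x) =
        act (Vert (tgt e) (to_head T e a)) (act (Edge e True) x)"
    and tree: "\<And>e x. e \<in> arcs T' \<Longrightarrow> x \<in> \<Omega> \<Longrightarrow> act (Edge e True) x = x"
  shows "fold act u x = fold act w x"
proof (rule fold_word_congruence[where \<Omega> = \<Omega> and A = letters and R = "pi1_relations T T'"])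
  show "(u, w) \<in> cong" using words val_eq_iff by blast
  show "act l x \<in> \<Omega>" if "l \<in> letters" "x \<in> \<Omega>" for l x
    using that(1) by (rule letter_cases) (use that vert_closed edge_closed in simp_all)
  show "fold act u x = fold act w x" if "(u, w) \<in> pi1_relations T T'" and x: "x \<in> \<Omega>" for u w x
    using that(1)
  proof (cases rule: pi1_relation_cases)
    case (conj e a)
    then show ?thesis using assms(10)[OF conj(1,2) x] by simp
  qed (use x one mult inv tree in simp_all)
qed (rule x)

text \<open>Words act from the right on pairs \<open>(g, f)\<close>: the first coordinate follows
  their value in the group, the second collects \<open>c\<close> along the way. The defining
  relations act trivially, so the second coordinate reached from \<open>(\<one>, 1)\<close> depends
  only on the value of the word. Invariance of \<open>c\<close> under the edge groups is what the
  conjugation relations need.\<close>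

lemma tree_simply_connected:
  assumes F: "group F"
    and c: "\<And>g e. g \<in> carrier G \<Longrightarrow> e \<in> A \<Longrightarrow> c g e \<in> carrier F"
    and c_inv: "\<And>g e a. g \<in> carrier G \<Longrightarrow> e \<in> A \<Longrightarrow> a \<in> carrier (EG e) \<Longrightarrow>
        c (g \<otimes> \<iota> (src e) (to_tail T e a)) e = c g e"
  shows "\<exists>\<Theta>. (\<forall>g\<in>carrier G. \<forall>v\<in>V. \<Theta> g v \<in> carrier F) \<and>
      (\<forall>g\<in>carrier G. \<forall>v\<in>V. \<forall>a\<in>carrier (VG v). \<Theta> (g \<otimes> \<iota> v a) v = \<Theta> g v) \<and>
      (\<forall>g\<in>carrier G. \<forall>e\<in>A. \<Theta> (g \<otimes> t e) (tgt e) = \<Theta> g (src e) \<otimes>\<^bsub>F\<^esub> c g e)"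
proof -
  interpret F: group F by (rule F)
  \<comment> \<open>\<open>P g\<close> integrates \<open>c\<close> over the copy of the maximal
    subtree at \<open>g\<close>, so that the relations killing its arcs will hold.\<close>
  have "\<forall>g. \<exists>P. g \<in> carrier G \<longrightarrow>
      (\<forall>v. P v \<in> carrier F) \<and> (\<forall>e\<in>arcs T'. P (tgt e) = P (src e) \<otimes>\<^bsub>F\<^esub> c g e)"
    using tree_potential_T'[OF F] c by metis
  then obtain P where P: "\<And>g v. g \<in> carrier G \<Longrightarrow> P g v \<in> carrier F"
    and P_tree: "\<And>g e. g \<in> carrier G \<Longrightarrow> e \<in> arcs T' \<Longrightarrow> P g (tgt e) = P g (src e) \<otimes>\<^bsub>F\<^esub> c g e"
    by metis
  \<comment> \<open>The change between the copies of the subtree at \<open>g\<close> and at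
    \<open>g \<otimes> t e\<close>: up to the starting point of the edge by \<open>P\<close>, across
    it by \<open>c\<close>, and back by the inverse of \<open>P\<close>. A vertex letter leads
    through a vertex common to both copies, without a factor \<open>c\<close>.\<close>
  define fwd where "fwd = (\<lambda>g e. P g (src e) \<otimes>\<^bsub>F\<^esub> c g e \<otimes>\<^bsub>F\<^esub> inv\<^bsub>F\<^esub> P (g \<otimes> t e) (tgt e))"
  define \<delta> where "\<delta> = (\<lambda>l g. case l of
      Vert v a \<Rightarrow> P g v \<otimes>\<^bsub>F\<^esub> inv\<^bsub>F\<^esub> P (g \<otimes> \<iota> v a) v
    | Edge e b \<Rightarrow> (if b then fwd g e else inv\<^bsub>F\<^esub> fwd (g \<otimes> inv t e) e))"
  define act where "act = (\<lambda>l (g, f). (g \<otimes> val [l], f \<otimes>\<^bsub>F\<^esub> \<delta> l g))"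
  have fwd: "fwd g e \<in> carrier F" if "g \<in> carrier G" "e \<in> A" for g e
    using that P c by (simp add: fwd_def)
  have \<delta>_vert: "\<delta> (Vert v a) g \<in> carrier F" if "g \<in> carrier G" "v \<in> V" "a \<in> carrier (VG v)" for g v a
    using that P by (simp add: \<delta>_def)
  have \<delta>_edge: "\<delta> (Edge e b) g \<in> carrier F" if "g \<in> carrier G" "e \<in> A" for g e b
    using that fwd by (simp add: \<delta>_def)
  have act_vert: "act (Vert v a) (g, f) = (g \<otimes> \<iota> v a, f \<otimes>\<^bsub>F\<^esub> (P g v \<otimes>\<^bsub>F\<^esub> inv\<^bsub>F\<^esub> P (g \<otimes> \<iota> v a) v))" for v a g f
    by (simp add: act_def \<delta>_def \<iota>_def)
  have act_True: "act (Edge e True) (g, f) = (g \<otimes> t e, f \<otimes>\<^bsub>F\<^esub> fwd g e)" for e g f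
    by (simp add: act_def \<delta>_def t_def)
  have act_False: "act (Edge e False) (g, f) = (g \<otimes> inv t e, f \<otimes>\<^bsub>F\<^esub> inv\<^bsub>F\<^esub> fwd (g \<otimes> inv t e) e)"
    if "e \<in> A" for e g f
    using t_inv[OF that] by (simp add: act_def \<delta>_def)
  have eq: "fold act u x = fold act w x"
    if words: "u \<in> lists letters" "w \<in> lists letters" "val u = val w" and x: "x \<in> carrier G \<times> carrier F" for u w x
    using words x
  proof (rule act_eq_if_val_eq)
    fix x assume x: "x \<in> carrier G \<times> carrier F"
    then obtain g f where gf: "x = (g, f)" and g: "g \<in> carrier G" and f: "f \<in> carrier F" by blast
    show "act (Vert v a) x \<in> carrier G \<times> carrier F" if "v \<in> V" "a \<in> carrier (VG v)" for v a
      using that g f P by (simp add: gf act_vert)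
    show "act (Edge e b) x \<in> carrier G \<times> carrier F" if "e \<in> A" for e b
      using that g f fwd by (cases b) (simp_all add: gf act_True act_False)
    show "act (Vert v \<one>\<^bsub>VG v\<^esub>) x = x" if v: "v \<in> V" for v
    proof -
      have "\<iota> v \<one>\<^bsub>VG v\<^esub> = \<one>" using hom_one[OF \<iota>_hom[OF v] group_vgroup[OF v]] is_group by simp
      then show ?thesis using g f P by (simp add: gf act_vert)
    qed
    show "act (Vert v b) (act (Vert v a) x) = act (Vert v (a \<otimes>\<^bsub>VG v\<^esub> b)) x"
      if v: "v \<in> V" "a \<in> carrier (VG v)" "b \<in> carrier (VG v)" for v a b
    proof -
      have "\<iota> v (a \<otimes>\<^bsub>VG v\<^esub> b) = \<iota> v a \<otimes> \<iota> v b" using hom_mult[OF \<iota>_hom] v by blast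
      then show ?thesis
        using g f P v by (simp add: gf act_vert m_assoc F.m_assoc F.inv_mult_cancel)
    qed
    show "act (Edge e (\<not> b)) (act (Edge e b) x) = x" if e: "e \<in> A" for e b
      using e g f fwd
      by (cases b) (simp_all add: gf act_True act_False m_assoc F.m_assoc)
    show "act (Edge e True) (act (Vert (src e) (to_tail T e a)) x) =
        act (Vert (tgt e) (to_head T e a)) (act (Edge e True) x)"
      if e: "e \<in> A" and a: "a \<in> carrier (EG e)" for e a
    proof -
      have ends: "src e \<in> V" "tgt e \<in> V" using e by auto
      have car: "\<iota> (src e) (to_tail T e a) \<in> carrier G" "\<iota> (tgt e) (to_head T e a) \<in> carrier G"
        using ends e a to_tail_closed to_head_closed by simp_all
      have rel: "g \<otimes> (\<iota> (src e) (to_tail T e a) \<otimes> t e) = g \<otimes> (t e \<otimes> \<iota> (tgt e) (to_head T e a))"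
        using edge_relation[OF e a] by simp
      show ?thesis
        using g f P car e a c c_inv rel
        by (simp add: gf act_vert act_True fwd_def m_assoc F.m_assoc F.inv_mult_cancel)
    qed
    show "act (Edge e True) x = x" if e: "e \<in> arcs T'" for e
    proof -
      have "e \<in> A" using e T'_arcs by blast
      then show ?thesis
        using g f P c P_tree[OF g e] t_tree[OF e] by (simp add: gf act_True fwd_def)
    qed
  qed
  have fst_fold: "fold act w (g, f) \<in> carrier G \<times> carrier F \<and> fst (fold act w (g, f)) = g \<otimes> val w"
    if "w \<in> lists letters" "g \<in> carrier G" "f \<in> carrier F" for w g f
    using that
  proof (induction w arbitrary: g f)
    case Nil
    then show ?case by (simp add: val_Nil)
  next
    case (Cons l w)
    have l: "val [l] \<in> carrier G" using Cons.hyps by (intro val_closed) simp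
    have w: "val w \<in> carrier G" using Cons.hyps by (intro val_closed)
    have "\<delta> l g \<in> carrier F"
      using Cons.hyps(1) by (rule letter_cases) (use \<delta>_vert \<delta>_edge Cons.prems in simp_all)
    then show ?case using Cons.IH[of "g \<otimes> val [l]" "f \<otimes>\<^bsub>F\<^esub> \<delta> l g"] Cons.prems val_Cons[OF Cons.hyps(1,2)] l w
      by (simp add: act_def m_assoc)
  qed
  define word where "word = (\<lambda>g. SOME w. w \<in> lists letters \<and> val w = g)"
  have word: "word g \<in> lists letters" "val (word g) = g" if g: "g \<in> carrier G" for g
  proof -
    obtain w where "w \<in> lists letters \<and> val w = g" using val_surj[OF g] by blast
    then have "word g \<in> lists letters \<and> val (word g) = g" unfolding word_def by (rule someI)
    then show "word g \<in> lists letters" "val (word g) = g" by auto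
  qed
  \<comment> \<open>The cocycle on the whole group that extends \<open>\<delta>\<close> from the
    letters; it is the potential before its correction by \<open>P\<close> inside each copy of the
    subtree.\<close>
  define D where "D = (\<lambda>g. snd (fold act (word g) (\<one>, \<one>\<^bsub>F\<^esub>)))"
  have D: "D g \<in> carrier F" if "g \<in> carrier G" for g
    using fst_fold[OF word(1)[OF that], of \<one> "\<one>\<^bsub>F\<^esub>"] by (auto simp: D_def)
  have fold_word: "fold act (word g) (\<one>, \<one>\<^bsub>F\<^esub>) = (g, D g)" if "g \<in> carrier G" for g
    using fst_fold[OF word(1)[OF that], of \<one> "\<one>\<^bsub>F\<^esub>"] word(2)[OF that] that by (simp add: D_def prod_eq_iff)
  have D_step: "D (g \<otimes> val [l]) = D g \<otimes>\<^bsub>F\<^esub> \<delta> l g" if g: "g \<in> carrier G" and l: "l \<in> letters" for g l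
  proof -
    have gl: "g \<otimes> val [l] \<in> carrier G" using g l by (intro m_closed val_closed) simp_all
    have "val (word (g \<otimes> val [l])) = val (word g @ [l])"
      using word(2)[OF gl] word[OF g] val_append[of "word g" "[l]"] l by simp
    then have "fold act (word (g \<otimes> val [l])) (\<one>, \<one>\<^bsub>F\<^esub>) = fold act (word g @ [l]) (\<one>, \<one>\<^bsub>F\<^esub>)"
      using word(1)[OF g] word(1)[OF gl] l by (intro eq) simp_all
    then show ?thesis using fold_word[OF g] fold_word[OF gl] by (simp add: act_def)
  qed
  define \<Theta> where "\<Theta> = (\<lambda>g v. D g \<otimes>\<^bsub>F\<^esub> P g v)"
  have "\<Theta> g v \<in> carrier F" if "g \<in> carrier G" for g v using that D P by (simp add: \<Theta>_def)
  moreover have "\<Theta> (g \<otimes> \<iota> v a) v = \<Theta> g v"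
    if "g \<in> carrier G" "v \<in> V" "a \<in> carrier (VG v)" for g v a
    using that D_step[of g "Vert v a"] D P
    by (simp add: \<Theta>_def \<delta>_def vert_letter \<iota>_def[symmetric] F.m_assoc)
  moreover have "\<Theta> (g \<otimes> t e) (tgt e) = \<Theta> g (src e) \<otimes>\<^bsub>F\<^esub> c g e" if "g \<in> carrier G" "e \<in> A" for g e
    using that D_step[of g "Edge e True"] D P c
    by (simp add: \<Theta>_def \<delta>_def fwd_def edge_letter t_def[symmetric] F.m_assoc)
  ultimately show ?thesis by blast
qed

end

section \<open>The vertex groups embed\<close>

lemma (in group) eq_if_mult_inv_eq_one:
  assumes "x \<in> carrier G" "y \<in> carrier G" "x \<otimes> inv y = \<one>"
  shows "x = y"
proof -
  have "x = x \<otimes> (inv y \<otimes> y)" using assms(1,2) by simp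
  also have "\<dots> = x \<otimes> inv y \<otimes> y" using assms(1,2) by (intro m_assoc[symmetric]) simp_all
  finally show ?thesis using assms by simp
qed

text \<open>Free right actions on the natural numbers with infinitely many orbits; the sequence \<open>s\<close> meets
  every orbit at most once.\<close>

definition free_nat_action :: "('c, 'm) monoid_scheme \<Rightarrow> ('c \<Rightarrow> nat \<Rightarrow> nat) \<Rightarrow> bool" where
  "free_nat_action C \<rho> \<longleftrightarrow>
     (\<forall>a\<in>carrier C. \<forall>b\<in>carrier C. \<forall>n. \<rho> (a \<otimes>\<^bsub>C\<^esub> b) n = \<rho> b (\<rho> a n)) \<and>
     (\<forall>n. \<rho> \<one>\<^bsub>C\<^esub> n = n) \<and>
     (\<forall>a\<in>carrier C. \<forall>n. \<rho> a n = n \<longrightarrow> a = \<one>\<^bsub>C\<^esub>) \<and>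
     (\<exists>s. \<forall>m n :: nat. \<forall>a\<in>carrier C. \<rho> a (s m) = s n \<longrightarrow> m = n)"

lemma free_nat_actionD:
  assumes "free_nat_action C \<rho>"
  shows "a \<in> carrier C \<Longrightarrow> b \<in> carrier C \<Longrightarrow> \<rho> (a \<otimes>\<^bsub>C\<^esub> b) n = \<rho> b (\<rho> a n)"
    and "\<rho> \<one>\<^bsub>C\<^esub> n = n"
    and "a \<in> carrier C \<Longrightarrow> \<rho> a n = n \<Longrightarrow> a = \<one>\<^bsub>C\<^esub>"
    and "\<exists>s. \<forall>m n :: nat. \<forall>a\<in>carrier C. \<rho> a (s m) = s n \<longrightarrow> m = n"
proof -
  note * = assms[unfolded free_nat_action_def]
  show "a \<in> carrier C \<Longrightarrow> b \<in> carrier C \<Longrightarrow> \<rho> (a \<otimes>\<^bsub>C\<^esub> b) n = \<rho> b (\<rho> a n)"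
    by (rule conjunct1[OF *, rule_format])
  show "\<rho> \<one>\<^bsub>C\<^esub> n = n"
    by (rule conjunct1[OF conjunct2[OF *], rule_format])
  show "a \<in> carrier C \<Longrightarrow> \<rho> a n = n \<Longrightarrow> a = \<one>\<^bsub>C\<^esub>"
    by (rule conjunct1[OF conjunct2[OF conjunct2[OF *]], rule_format])
  show "\<exists>s. \<forall>m n :: nat. \<forall>a\<in>carrier C. \<rho> a (s m) = s n \<longrightarrow> m = n"
    by (rule conjunct2[OF conjunct2[OF conjunct2[OF *]]])
qed

text \<open>Countably many copies of \<open>C\<close> under right multiplication, renumbered by a
  bijection with the natural numbers; the orbits are represented by the identities of the
  copies.\<close>

lemma free_nat_action_exists:
  fixes C :: "('c, 'm) monoid_scheme"
  assumes "group C" and "countable (carrier C)"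
  shows "\<exists>\<rho>. free_nat_action C \<rho>"
proof -
  interpret group C by fact
  let ?S = "(UNIV :: nat set) \<times> carrier C"
  have "carrier C \<noteq> {}" using one_closed by blast
  then have "infinite ?S" by (simp add: finite_cartesian_product_iff)
  moreover have "countable ?S" using assms(2) by simp
  ultimately obtain \<beta> where "bij_betw \<beta> ?S (UNIV :: nat set)"
    using countableE_infinite[of ?S] by blast
  then have inj: "inj_on \<beta> ?S" and surj: "\<beta> ` ?S = UNIV" by (auto simp: bij_betw_def)
  define \<gamma> where "\<gamma> = the_inv_into ?S \<beta>"
  have \<gamma>\<beta>: "\<gamma> (\<beta> (n, x)) = (n, x)" if "x \<in> carrier C" for n x
    unfolding \<gamma>_def using inj that by (intro the_inv_into_f_f) simp_all
  have \<beta>\<gamma>: "\<beta> (\<gamma> n) = n" for n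
    unfolding \<gamma>_def using inj surj by (intro f_the_inv_into_f) simp_all
  have \<gamma>: "snd (\<gamma> n) \<in> carrier C" for n
  proof -
    have "\<gamma> n \<in> ?S" unfolding \<gamma>_def by (rule the_inv_into_into[OF inj _ subset_refl]) (simp add: surj)
    then show ?thesis by auto
  qed
  define \<rho> where "\<rho> = (\<lambda>a n. \<beta> (fst (\<gamma> n), snd (\<gamma> n) \<otimes>\<^bsub>C\<^esub> a))"
  have \<gamma>\<rho>: "\<gamma> (\<rho> a n) = (fst (\<gamma> n), snd (\<gamma> n) \<otimes>\<^bsub>C\<^esub> a)" if "a \<in> carrier C" for a n
    unfolding \<rho>_def using that \<gamma> by (intro \<gamma>\<beta>) simp
  show ?thesis
    unfolding free_nat_action_def
  proof (intro exI[of _ \<rho>] conjI ballI allI impI exI[of _ "\<lambda>n. \<beta> (n, \<one>\<^bsub>C\<^esub>)"])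
    fix a b n assume ab: "a \<in> carrier C" "b \<in> carrier C"
    have "\<rho> b (\<rho> a n) = \<beta> (fst (\<gamma> n), snd (\<gamma> n) \<otimes>\<^bsub>C\<^esub> a \<otimes>\<^bsub>C\<^esub> b)"
      unfolding \<rho>_def[THEN fun_cong, of b] \<gamma>\<rho>[OF ab(1)] by simp
    then show "\<rho> (a \<otimes>\<^bsub>C\<^esub> b) n = \<rho> b (\<rho> a n)"
      unfolding \<rho>_def[THEN fun_cong, of "a \<otimes>\<^bsub>C\<^esub> b"] using ab \<gamma> by (simp add: m_assoc)
  next
    show "\<rho> \<one>\<^bsub>C\<^esub> n = n" for n unfolding \<rho>_def using \<gamma>[of n] by (simp add: \<beta>\<gamma>)
  next
    fix a n assume a: "a \<in> carrier C" "\<rho> a n = n"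
    have "snd (\<gamma> n) \<otimes>\<^bsub>C\<^esub> a = snd (\<gamma> n)" using \<gamma>\<rho>[OF a(1), of n] unfolding a(2) by (metis snd_conv)
    then show "a = \<one>\<^bsub>C\<^esub>" using l_cancel_one[OF \<gamma> a(1)] by simp
  next
    fix m n a assume a: "a \<in> carrier C" "\<rho> a (\<beta> (m, \<one>\<^bsub>C\<^esub>)) = \<beta> (n, \<one>\<^bsub>C\<^esub>)"
    show "m = n"
      using \<gamma>\<rho>[OF a(1), of "\<beta> (m, \<one>\<^bsub>C\<^esub>)"] unfolding a(2) by (simp add: \<gamma>\<beta>)
  qed
qed

text \<open>Injectivity of \<open>f\<close> preserves freeness. Orbits of the smaller group lie
  inside orbits of the larger one, so the same sequence \<open>s\<close> still meets each at most
  once.\<close>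

lemma free_nat_action_pullback:
  assumes "group C" "group D" and f: "f \<in> hom C D" "inj_on f (carrier C)" and \<rho>: "free_nat_action D \<rho>"
  shows "free_nat_action C (\<lambda>a. \<rho> (f a))"
proof -
  interpret C: group C by fact
  interpret D: group D by fact
  interpret f: group_hom C D f by unfold_locales (rule f)
  have one: "a = \<one>\<^bsub>C\<^esub>" if "a \<in> carrier C" "f a = \<one>\<^bsub>D\<^esub>" for a
    using inj_onD[OF f(2), of a "\<one>\<^bsub>C\<^esub>"] that by simp
  obtain s :: "nat \<Rightarrow> nat" where s: "\<forall>m n. \<forall>a\<in>carrier D. \<rho> a (s m) = s n \<longrightarrow> m = n"
    using free_nat_actionD(4)[OF \<rho>] by (rule exE)
  show ?thesis
    unfolding free_nat_action_def
  proof (intro conjI ballI allI impI exI[of _ s])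
    fix a b n assume ab: "a \<in> carrier C" "b \<in> carrier C"
    show "\<rho> (f (a \<otimes>\<^bsub>C\<^esub> b)) n = \<rho> (f b) (\<rho> (f a) n)"
      unfolding f.hom_mult[OF ab] using ab by (intro free_nat_actionD(1)[OF \<rho>] f.hom_closed)
  next
    show "\<rho> (f \<one>\<^bsub>C\<^esub>) n = n" for n
      unfolding f.hom_one by (rule free_nat_actionD(2)[OF \<rho>])
  next
    fix a n assume a: "a \<in> carrier C" "\<rho> (f a) n = n"
    show "a = \<one>\<^bsub>C\<^esub>"
      by (rule one[OF a(1) free_nat_actionD(3)[OF \<rho> f.hom_closed[OF a(1)] a(2)]])
  next
    fix m n a assume "a \<in> carrier C" "\<rho> (f a) (s m) = s n"
    then show "m = n" using s[rule_format, OF f.hom_closed] by blast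
  qed
qed

text \<open>By freeness each orbit is a copy of \<open>C\<close> once a base point is chosen, here
  its least element. The base points form an infinite set of natural numbers and can be enumerated,
  so the action is isomorphic to the standard one on \<open>nat \<times> C\<close>.\<close>

lemma free_nat_action_trivialization:
  assumes "group C" and \<rho>: "free_nat_action C \<rho>"
  shows "\<exists>\<beta>. bij_betw \<beta> ((UNIV :: nat set) \<times> carrier C) (UNIV :: nat set) \<and>
           (\<forall>n. \<forall>x\<in>carrier C. \<forall>a\<in>carrier C. \<beta> (n, x \<otimes>\<^bsub>C\<^esub> a) = \<rho> a (\<beta> (n, x)))"
proof -
  interpret group C by fact
  have mult: "\<And>a b n. a \<in> carrier C \<Longrightarrow> b \<in> carrier C \<Longrightarrow> \<rho> (a \<otimes>\<^bsub>C\<^esub> b) n = \<rho> b (\<rho> a n)"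
    and one: "\<And>n. \<rho> \<one>\<^bsub>C\<^esub> n = n" and free: "\<And>a n. a \<in> carrier C \<Longrightarrow> \<rho> a n = n \<Longrightarrow> a = \<one>\<^bsub>C\<^esub>"
    by (fact free_nat_actionD[OF \<rho>])+
  obtain s :: "nat \<Rightarrow> nat" where s_all: "\<forall>m n. \<forall>a\<in>carrier C. \<rho> a (s m) = s n \<longrightarrow> m = n"
    using free_nat_actionD(4)[OF \<rho>] by (rule exE)
  note s = s_all[rule_format]
  define Orb where "Orb = (\<lambda>n. (\<lambda>a. \<rho> a n) ` carrier C)"
  define rep where "rep = (\<lambda>n. LEAST m. m \<in> Orb n)"
  have self: "n \<in> Orb n" for n unfolding Orb_def using one[of n, symmetric] one_closed by (rule image_eqI)
  have rep: "rep n \<in> Orb n" for n unfolding rep_def using self by (rule LeastI)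
  have act_back: "\<rho> (inv\<^bsub>C\<^esub> a) (\<rho> a n) = n" if "a \<in> carrier C" for a n
    using mult[OF that inv_closed[OF that], of n] that by (simp add: one)
  have Orb_act: "Orb (\<rho> a n) = Orb n" if a: "a \<in> carrier C" for a n
  proof
    show "Orb (\<rho> a n) \<subseteq> Orb n"
    proof
      fix m assume "m \<in> Orb (\<rho> a n)"
      then obtain b where b: "b \<in> carrier C" "m = \<rho> b (\<rho> a n)" by (auto simp: Orb_def)
      then have "m = \<rho> (a \<otimes>\<^bsub>C\<^esub> b) n" using mult[OF a b(1)] by simp
      then show "m \<in> Orb n" unfolding Orb_def using a b(1) by blast
    qed
    show "Orb n \<subseteq> Orb (\<rho> a n)"
    proof
      fix m assume "m \<in> Orb n"
      then obtain b where b: "b \<in> carrier C" "m = \<rho> b n" by (auto simp: Orb_def)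
      then have "m = \<rho> (inv\<^bsub>C\<^esub> a \<otimes>\<^bsub>C\<^esub> b) (\<rho> a n)"
        using mult[of "inv\<^bsub>C\<^esub> a" b "\<rho> a n"] a by (simp add: act_back)
      then show "m \<in> Orb (\<rho> a n)" unfolding Orb_def using a b(1) by blast
    qed
  qed
  have Orb_rep: "Orb (rep n) = Orb n" for n
  proof -
    obtain a where "a \<in> carrier C" "rep n = \<rho> a n" using rep[of n] unfolding Orb_def by blast
    then show ?thesis using Orb_act[of a n] by simp
  qed
  have rep_cong: "rep m = rep n" if "Orb m = Orb n" for m n using that by (simp add: rep_def)
  have rep_act: "rep (\<rho> a n) = rep n" if "a \<in> carrier C" for a n
    by (rule rep_cong[OF Orb_act[OF that]])
  have rep_rep: "rep (rep n) = rep n" for n by (rule rep_cong[OF Orb_rep])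
  \<comment> \<open>The only use of \<open>s\<close>: there are infinitely many orbits, so that all
    natural numbers are needed to enumerate their representatives.\<close>
  have "inj (\<lambda>n. rep (s n))"
  proof (rule injI)
    fix m n assume "rep (s m) = rep (s n)"
    then have "s n \<in> Orb (s m)" using Orb_rep[of "s m"] Orb_rep[of "s n"] self[of "s n"] by simp
    then show "m = n" using s by (auto simp: Orb_def)
  qed
  then have "infinite (range (\<lambda>n. rep (s n)))" by (rule range_inj_infinite)
  moreover have "range (\<lambda>n. rep (s n)) \<subseteq> range rep" by blast
  ultimately have inf: "infinite (range rep)" by (rule infinite_super[rotated])
  define r where "r = enumerate (range rep)"
  have r: "bij_betw r UNIV (range rep)" unfolding r_def using inf by (rule bij_enumerate)
  have rep_r: "rep (r n) = r n" for n
  proof -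
    have "r n \<in> range rep" using r by (auto simp: bij_betw_def)
    then show ?thesis using rep_rep by auto
  qed
  define \<beta> where "\<beta> = (\<lambda>(n, x). \<rho> x (r n))"
  have "inj_on \<beta> (UNIV \<times> carrier C)"
  proof (rule inj_onI, clarify)
    fix m n x y assume xy: "x \<in> carrier C" "y \<in> carrier C" and eq: "\<beta> (m, x) = \<beta> (n, y)"
    have "rep (\<rho> x (r m)) = rep (\<rho> y (r n))" using eq by (simp add: \<beta>_def)
    then have "r m = r n" using xy by (simp add: rep_act rep_r)
    then have mn: "m = n" using r by (auto simp: bij_betw_def inj_on_def)
    have "\<rho> (x \<otimes>\<^bsub>C\<^esub> inv\<^bsub>C\<^esub> y) (r m) = r m"
      using mult[OF xy(1) inv_closed[OF xy(2)], of "r m"] eq act_back[OF xy(2), of "r n"] by (simp add: \<beta>_def mn)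
    then have "x \<otimes>\<^bsub>C\<^esub> inv\<^bsub>C\<^esub> y = \<one>\<^bsub>C\<^esub>" using xy by (intro free) simp_all
    then have "x = y" using eq_if_mult_inv_eq_one xy by blast
    then show "m = n \<and> x = y" using mn by simp
  qed
  moreover have "n \<in> \<beta> ` (UNIV \<times> carrier C)" for n
  proof -
    obtain m where m: "rep n = r m" using r by (metis bij_betw_imp_surj_on rangeE rangeI)
    have "n \<in> Orb (r m)" using self[of n] Orb_rep[of n] m by simp
    then obtain x where "x \<in> carrier C" "n = \<rho> x (r m)" by (auto simp: Orb_def)
    then show ?thesis by (intro image_eqI[of _ _ "(m, x)"]) (simp_all add: \<beta>_def)
  qed
  ultimately have "bij_betw \<beta> (UNIV \<times> carrier C) UNIV" unfolding bij_betw_def by blast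
  moreover have "\<beta> (n, x \<otimes>\<^bsub>C\<^esub> a) = \<rho> a (\<beta> (n, x))" if "x \<in> carrier C" "a \<in> carrier C" for n x a
    using mult[OF that] by (simp add: \<beta>_def)
  ultimately show ?thesis by blast
qed

text \<open>Both actions are isomorphic to the standard one. This will identify the two actions of
  an edge group that are restricted from the adjacent vertex groups.\<close>

lemma free_nat_action_unique:
  fixes C :: "('c, 'm) monoid_scheme"
  assumes C: "group C" and \<rho>: "free_nat_action C \<rho>" and \<rho>': "free_nat_action C \<rho>'"
  shows "\<exists>\<tau>. bij \<tau> \<and> (\<forall>a\<in>carrier C. \<forall>n. \<tau> (\<rho> a n) = \<rho>' a (\<tau> n))"
proof -
  interpret group C by (rule C)
  obtain \<beta> \<beta>' :: "nat \<times> 'c \<Rightarrow> nat" where \<beta>: "bij_betw \<beta> (UNIV \<times> carrier C) UNIV"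
      "\<And>n x a. x \<in> carrier C \<Longrightarrow> a \<in> carrier C \<Longrightarrow> \<beta> (n, x \<otimes>\<^bsub>C\<^esub> a) = \<rho> a (\<beta> (n, x))"
    and \<beta>': "bij_betw \<beta>' (UNIV \<times> carrier C) UNIV"
      "\<And>n x a. x \<in> carrier C \<Longrightarrow> a \<in> carrier C \<Longrightarrow> \<beta>' (n, x \<otimes>\<^bsub>C\<^esub> a) = \<rho>' a (\<beta>' (n, x))"
    using free_nat_action_trivialization[OF C \<rho>] free_nat_action_trivialization[OF C \<rho>'] by blast
  define \<gamma> where "\<gamma> = the_inv_into (UNIV \<times> carrier C) \<beta>"
  have \<gamma>: "bij_betw \<gamma> UNIV (UNIV \<times> carrier C)"
    unfolding \<gamma>_def using \<beta>(1) by (rule bij_betw_the_inv_into)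
  have inj: "inj_on \<beta> (UNIV \<times> carrier C)" using \<beta>(1) by (rule bij_betw_imp_inj_on)
  have "bij (\<beta>' \<circ> \<gamma>)" using \<gamma> \<beta>'(1) by (rule bij_betw_trans)
  moreover have "(\<beta>' \<circ> \<gamma>) (\<rho> a n) = \<rho>' a ((\<beta>' \<circ> \<gamma>) n)" if a: "a \<in> carrier C" for a n
  proof -
    have "n \<in> \<beta> ` (UNIV \<times> carrier C)" using \<beta>(1) by (simp add: bij_betw_def)
    then obtain m x where n: "n = \<beta> (m, x)" and x: "x \<in> carrier C" by blast
    have "\<gamma> n = (m, x)" "\<gamma> (\<beta> (m, x \<otimes>\<^bsub>C\<^esub> a)) = (m, x \<otimes>\<^bsub>C\<^esub> a)"
      unfolding \<gamma>_def n using inj x a by (intro the_inv_into_f_f; simp)+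
    then show ?thesis using \<beta>(2)[OF x a, of m] \<beta>'(2)[OF x a, of m] by (simp add: n)
  qed
  ultimately show ?thesis by blast
qed

context graph_decomposition
begin

text \<open>Two elements with the same image must act in the same way under any action that respects
  the relations; in the action built here each vertex group acts freely, up to conjugation by the
  bijection \<open>Q v\<close>.\<close>

lemma \<iota>_inj:
  assumes countable: "\<And>v. v \<in> V \<Longrightarrow> countable (carrier (VG v))" and v: "v \<in> V"
  shows "inj_on (\<iota> v) (carrier (VG v))"
proof -
  have "\<forall>v. \<exists>\<rho>. v \<in> V \<longrightarrow> free_nat_action (VG v) \<rho>"
    using free_nat_action_exists group_vgroup countable by blast
  then obtain \<rho> where \<rho>: "\<And>v. v \<in> V \<Longrightarrow> free_nat_action (VG v) (\<rho> v)" by metis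
  have \<rho>_mult: "\<And>v a b n. v \<in> V \<Longrightarrow> a \<in> carrier (VG v) \<Longrightarrow> b \<in> carrier (VG v) \<Longrightarrow>
        \<rho> v (a \<otimes>\<^bsub>VG v\<^esub> b) n = \<rho> v b (\<rho> v a n)"
    and \<rho>_one: "\<And>v n. v \<in> V \<Longrightarrow> \<rho> v \<one>\<^bsub>VG v\<^esub> n = n"
    and \<rho>_free: "\<And>v a n. v \<in> V \<Longrightarrow> a \<in> carrier (VG v) \<Longrightarrow> \<rho> v a n = n \<Longrightarrow> a = \<one>\<^bsub>VG v\<^esub>"
    by (fact free_nat_actionD(1-3)[OF \<rho>])+
  have "\<exists>\<tau>. bij \<tau> \<and> (\<forall>a\<in>carrier (EG e). \<forall>n.
      \<tau> (\<rho> (src e) (to_tail T e a) n) = \<rho> (tgt e) (to_head T e a) (\<tau> n))" if e: "e \<in> A" for e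
  proof -
    have ends: "src e \<in> V" "tgt e \<in> V" using e by auto
    show ?thesis
      by (rule free_nat_action_unique[OF group_egroup[OF e]
            free_nat_action_pullback[OF group_egroup[OF e] group_vgroup[OF ends(1)]
              to_tail_hom[OF e] to_tail_inj[OF e] \<rho>[OF ends(1)]]
            free_nat_action_pullback[OF group_egroup[OF e] group_vgroup[OF ends(2)]
              to_head_hom[OF e] to_head_inj[OF e] \<rho>[OF ends(2)]]])
  qed
  then have "\<forall>e. \<exists>\<tau>. e \<in> A \<longrightarrow> bij \<tau> \<and> (\<forall>a\<in>carrier (EG e). \<forall>n.
      \<tau> (\<rho> (src e) (to_tail T e a) n) = \<rho> (tgt e) (to_head T e a) (\<tau> n))" by blast
  then obtain \<tau> where \<tau>_bij: "\<And>e. e \<in> A \<Longrightarrow> bij (\<tau> e)"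
    and \<tau>: "\<And>e a n. e \<in> A \<Longrightarrow> a \<in> carrier (EG e) \<Longrightarrow>
        \<tau> e (\<rho> (src e) (to_tail T e a) n) = \<rho> (tgt e) (to_head T e a) (\<tau> e n)"
    by metis
  let ?B = "BijGroup (UNIV :: nat set)"
  have carrier_B: "f \<in> carrier ?B \<longleftrightarrow> bij f" for f by (simp add: BijGroup_def Bij_def)
  \<comment> \<open>The isomorphisms \<open>\<tau> e\<close> need not be identities on the maximal
    subtree, although its letters have to act trivially. Conjugating the action of each vertex group
    by a potential \<open>Q v\<close> in the group of bijections absorbs them.\<close>
  have "\<exists>Q. (\<forall>v. Q v \<in> carrier ?B) \<and> (\<forall>e\<in>arcs T'. Q (tgt e) = Q (src e) \<otimes>\<^bsub>?B\<^esub> inv_into UNIV (\<tau> e))"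
    using \<tau>_bij by (intro tree_potential_T' group_BijGroup) (simp add: carrier_B bij_imp_bij_inv)
  then obtain Q where Q0: "\<And>v. Q v \<in> carrier ?B"
    and Q1: "\<And>e. e \<in> arcs T' \<Longrightarrow> Q (tgt e) = Q (src e) \<otimes>\<^bsub>?B\<^esub> inv_into UNIV (\<tau> e)"
    by blast
  have Q_bij: "bij (Q v)" for v using Q0 carrier_B by blast
  have Q_tree: "Q (tgt e) = Q (src e) \<circ> inv_into UNIV (\<tau> e)" if e: "e \<in> arcs T'" for e
  proof -
    have "bij (inv_into UNIV (\<tau> e))" using \<tau>_bij e T'_arcs by (blast intro: bij_imp_bij_inv)
    then show ?thesis
      using Q1[OF e] Q0 by (simp add: BijGroup_def Bij_def compose_def fun_eq_iff)
  qed
  define R where "R = (\<lambda>v. inv_into UNIV (Q v))"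
  define \<sigma> where "\<sigma> = (\<lambda>e. inv_into UNIV (\<tau> e))"
  have RQ: "R v (Q v n) = n" and QR: "Q v (R v n) = n" for v n
    using Q_bij[of v] by (simp_all add: R_def bij_is_inj bij_is_surj surj_f_inv_f)
  have \<sigma>\<tau>: "\<sigma> e (\<tau> e n) = n" and \<tau>\<sigma>: "\<tau> e (\<sigma> e n) = n" if "e \<in> A" for e n
    using \<tau>_bij[OF that] by (simp_all add: \<sigma>_def bij_is_inj bij_is_surj surj_f_inv_f)
  define act where "act = (\<lambda>l n. case l of
      Vert v a \<Rightarrow> Q v (\<rho> v a (R v n))
    | Edge e b \<Rightarrow> (if b then Q (tgt e) (\<tau> e (R (src e) n)) else Q (src e) (\<sigma> e (R (tgt e) n))))"
  have act_vert: "act (Vert v a) n = Q v (\<rho> v a (R v n))" for v a n by (simp add: act_def)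
  have act_True: "act (Edge e True) n = Q (tgt e) (\<tau> e (R (src e) n))" for e n by (simp add: act_def)
  have act_False: "act (Edge e False) n = Q (src e) (\<sigma> e (R (tgt e) n))" for e n by (simp add: act_def)
  show ?thesis
  proof (rule inj_onI)
    fix a b assume ab: "a \<in> carrier (VG v)" "b \<in> carrier (VG v)" and eq: "\<iota> v a = \<iota> v b"
    interpret vg: group "VG v" using v by (rule group_vgroup)
    have "[Vert v a] \<in> lists letters" "[Vert v b] \<in> lists letters" "val [Vert v a] = val [Vert v b]"
      using v ab eq by (simp_all add: vert_letter \<iota>_def)
    then have "fold act [Vert v a] n = fold act [Vert v b] n" for n
    proof (rule act_eq_if_val_eq[where \<Omega> = UNIV])
      show "act (Vert w \<one>\<^bsub>VG w\<^esub>) n = n" if "w \<in> V" for w n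
        using that by (simp add: act_vert \<rho>_one QR)
      show "act (Vert w y) (act (Vert w x) n) = act (Vert w (x \<otimes>\<^bsub>VG w\<^esub> y)) n"
        if "w \<in> V" "x \<in> carrier (VG w)" "y \<in> carrier (VG w)" for w x y n
        using that by (simp add: act_vert \<rho>_mult RQ)
      show "act (Edge e (\<not> x)) (act (Edge e x) n) = n" if "e \<in> A" for e x n
        using that by (cases x) (simp_all add: act_True act_False RQ QR \<sigma>\<tau> \<tau>\<sigma>)
      show "act (Edge e True) (act (Vert (src e) (to_tail T e x)) n) =
          act (Vert (tgt e) (to_head T e x)) (act (Edge e True) n)"
        if "e \<in> A" "x \<in> carrier (EG e)" for e x n
        using that by (simp add: act_vert act_True RQ \<tau>)
      show "act (Edge e True) n = n" if e: "e \<in> arcs T'" for e n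
      proof -
        have "e \<in> A" using e T'_arcs by blast
        moreover have "Q (tgt e) = Q (src e) \<circ> \<sigma> e" using Q_tree[OF e] by (simp add: \<sigma>_def)
        ultimately show ?thesis by (simp add: act_True \<sigma>\<tau> QR)
      qed
    qed simp_all
    \<comment> \<open>The point \<open>Q v 0\<close> undoes the conjugation: what remains is that
      \<open>a\<close> and \<open>b\<close> move 0 to the same point under the free action
      \<open>\<rho> v\<close>.\<close>
    then have "act (Vert v a) (Q v 0) = act (Vert v b) (Q v 0)" by simp
    then have "R v (Q v (\<rho> v a 0)) = R v (Q v (\<rho> v b 0))" by (simp add: act_vert RQ)
    then have *: "\<rho> v a 0 = \<rho> v b 0" by (simp add: RQ)
    have "\<rho> v (a \<otimes>\<^bsub>VG v\<^esub> inv\<^bsub>VG v\<^esub> b) 0 = \<rho> v (inv\<^bsub>VG v\<^esub> b) (\<rho> v b 0)"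
      using \<rho>_mult[OF v ab(1) vg.inv_closed[OF ab(2)], of 0] * by simp
    also have "\<dots> = \<rho> v (b \<otimes>\<^bsub>VG v\<^esub> inv\<^bsub>VG v\<^esub> b) 0"
      using \<rho>_mult[OF v ab(2) vg.inv_closed[OF ab(2)], of 0] by simp
    also have "\<dots> = 0" using ab(2) v by (simp add: \<rho>_one)
    finally have "a \<otimes>\<^bsub>VG v\<^esub> inv\<^bsub>VG v\<^esub> b = \<one>\<^bsub>VG v\<^esub>"
      using ab by (intro \<rho>_free[OF v]) simp_all
    then show "a = b" using vg.eq_if_mult_inv_eq_one ab by blast
  qed
qed

end

section \<open>Subgroups acting freely on the Bass-Serre tree\<close>

context graph_decomposition
begin

text \<open>The coset of the vertex group, tagged with \<open>v\<close>: different vertex groups may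
  have the same image in \<open>G\<close>, and then their cosets coincide as sets.\<close>

definition tree_vertex :: "'a \<Rightarrow> 'v \<Rightarrow> 'v \<times> 'a set" where
  "tree_vertex g v = (v, (\<lambda>a. g \<otimes> \<iota> v a) ` carrier (VG v))"

definition tree_edges :: "('v \<times> 'a set) rel" where
  "tree_edges = {(tree_vertex g (src e), tree_vertex (g \<otimes> t e) (tgt e)) | g e. g \<in> carrier G \<and> e \<in> A}"

lemma \<iota>_one: "v \<in> V \<Longrightarrow> \<iota> v \<one>\<^bsub>VG v\<^esub> = \<one>"
  using hom_one[OF \<iota>_hom group_vgroup] is_group by blast

lemma \<iota>_mult: "v \<in> V \<Longrightarrow> a \<in> carrier (VG v) \<Longrightarrow> b \<in> carrier (VG v) \<Longrightarrow>
    \<iota> v (a \<otimes>\<^bsub>VG v\<^esub> b) = \<iota> v a \<otimes> \<iota> v b"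
  using hom_mult[OF \<iota>_hom] by blast

lemma \<iota>_inv:
  assumes "v \<in> V" "a \<in> carrier (VG v)"
  shows "\<iota> v (inv\<^bsub>VG v\<^esub> a) = inv (\<iota> v a)"
proof -
  interpret vg: group "VG v" using assms(1) by (rule group_vgroup)
  interpret group_hom "VG v" G "\<iota> v" by unfold_locales (rule \<iota>_hom[OF assms(1)])
  show ?thesis using assms(2) by (rule hom_inv)
qed

lemma tree_vertex_vert:
  assumes v: "v \<in> V" and g: "g \<in> carrier G" and a: "a \<in> carrier (VG v)"
  shows "tree_vertex (g \<otimes> \<iota> v a) v = tree_vertex g v"
proof -
  interpret vg: group "VG v" using v by (rule group_vgroup)
  have "(\<lambda>b. g \<otimes> \<iota> v a \<otimes> \<iota> v b) ` carrier (VG v) = (\<lambda>b. g \<otimes> \<iota> v b) ` carrier (VG v)" (is "?L = ?R")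
  proof
    show "?L \<subseteq> ?R"
    proof (rule image_subsetI)
      fix b assume b: "b \<in> carrier (VG v)"
      then have "g \<otimes> \<iota> v a \<otimes> \<iota> v b = g \<otimes> \<iota> v (a \<otimes>\<^bsub>VG v\<^esub> b)"
        using v g a by (simp add: \<iota>_mult m_assoc)
      then show "g \<otimes> \<iota> v a \<otimes> \<iota> v b \<in> ?R"
        using a b by (intro image_eqI[of _ _ "a \<otimes>\<^bsub>VG v\<^esub> b"]) simp_all
    qed
    show "?R \<subseteq> ?L"
    proof (rule image_subsetI)
      fix b assume b: "b \<in> carrier (VG v)"
      then have "g \<otimes> \<iota> v b = g \<otimes> \<iota> v a \<otimes> \<iota> v (inv\<^bsub>VG v\<^esub> a \<otimes>\<^bsub>VG v\<^esub> b)"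
        using v g a by (simp add: \<iota>_mult \<iota>_inv m_assoc inv_mult_cancel)
      then show "g \<otimes> \<iota> v b \<in> ?L"
        using a b by (intro image_eqI[of _ _ "inv\<^bsub>VG v\<^esub> a \<otimes>\<^bsub>VG v\<^esub> b"]) simp_all
    qed
  qed
  then show ?thesis by (simp add: tree_vertex_def)
qed

lemma tree_vertex_eqD:
  assumes "tree_vertex g v = tree_vertex h w" and v: "v \<in> V" and h: "h \<in> carrier G"
  shows "w = v \<and> (\<exists>a\<in>carrier (VG v). h = g \<otimes> \<iota> v a)"
proof -
  interpret vg: group "VG v" using v by (rule group_vgroup)
  have w: "w = v" using assms(1) by (simp add: tree_vertex_def)
  have "h \<otimes> \<iota> v \<one>\<^bsub>VG v\<^esub> \<in> snd (tree_vertex h v)" unfolding tree_vertex_def by simp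
  then have "h \<in> snd (tree_vertex g v)" using assms(1) w h v by (simp add: \<iota>_one)
  then show ?thesis using w by (auto simp: tree_vertex_def)
qed

text \<open>The stabiliser in \<open>H\<close> of the tree vertex at \<open>(g, v)\<close> is the
  intersection of \<open>H\<close> with a conjugate of the vertex group, so the hypothesis says that
  \<open>H\<close> acts freely on the vertices of the Bass-Serre tree.\<close>

lemma is_free_group_if_trivial_intersections:
  assumes H: "subgroup H G"
    and trivial: "\<And>g v a. g \<in> carrier G \<Longrightarrow> v \<in> V \<Longrightarrow> a \<in> carrier (VG v) \<Longrightarrow>
        g \<otimes> \<iota> v a \<otimes> inv g \<in> H \<Longrightarrow> g \<otimes> \<iota> v a \<otimes> inv g = \<one>"
  shows "is_free_group (G\<lparr>carrier := H\<rparr>)"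
proof -
  interpret H: subgroup H G by (rule H)
  obtain v0 where v0: "v0 \<in> V" using V_nonempty by blast
  define Y where "Y = {tree_vertex g v | g v. g \<in> carrier G \<and> v \<in> V}"
  define act where "act = (\<lambda>h (v :: 'v, C). (v, (\<lambda>x. h \<otimes> x) ` C))"
  have act: "act h (tree_vertex g v) = tree_vertex (h \<otimes> g) v"
    if "h \<in> carrier G" "g \<in> carrier G" "v \<in> V" for h g v
  proof -
    have "h \<otimes> (g \<otimes> \<iota> v a) = h \<otimes> g \<otimes> \<iota> v a" if "a \<in> carrier (VG v)" for a
      using that \<open>h \<in> carrier G\<close> \<open>g \<in> carrier G\<close> \<open>v \<in> V\<close> by (simp add: m_assoc)
    then show ?thesis by (simp add: act_def tree_vertex_def image_image)
  qed
  have Y: "tree_vertex g v \<in> Y" if "g \<in> carrier G" "v \<in> V" for g v using that by (auto simp: Y_def)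
  have Y_cases: "\<exists>g v. y = tree_vertex g v \<and> g \<in> carrier G \<and> v \<in> V" if "y \<in> Y" for y
    using that by (simp add: Y_def)
  have edge_cases: "\<exists>g e. y = tree_vertex g (src e) \<and> z = tree_vertex (g \<otimes> t e) (tgt e) \<and> g \<in> carrier G \<and> e \<in> A"
    if "(y, z) \<in> tree_edges" for y z
    using that by (auto simp: tree_edges_def)
  have edgeI: "(tree_vertex g (src e), tree_vertex (g \<otimes> t e) (tgt e)) \<in> tree_edges"
    if "g \<in> carrier G" "e \<in> A" for g e
    using that by (auto simp: tree_edges_def)
  have ends: "src e \<in> V" "tgt e \<in> V" if "e \<in> A" for e using that by auto
  let ?H = "G\<lparr>carrier := H\<rparr>"
  interpret free_tree_action ?H Y act tree_edges "tree_vertex \<one> v0"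
  proof (intro free_tree_action.intro free_tree_action_axioms.intro)
    show "group ?H" using H is_group by (rule subgroup.subgroup_is_group)
    show "tree_vertex \<one> v0 \<in> Y" using v0 by (intro Y) simp_all
    show "act h y \<in> Y" if h: "h \<in> carrier ?H" and y: "y \<in> Y" for h y
    proof -
      obtain g v where "y = tree_vertex g v" "g \<in> carrier G" "v \<in> V" using Y_cases[OF y] by blast
      then show ?thesis using h Y[of "h \<otimes> g" v] by (simp add: act)
    qed
    show "act \<one>\<^bsub>?H\<^esub> y = y" if y: "y \<in> Y" for y
    proof -
      obtain g v where "y = tree_vertex g v" "g \<in> carrier G" "v \<in> V" using Y_cases[OF y] by blast
      then show ?thesis by (simp add: act)
    qed
    show "act (h \<otimes>\<^bsub>?H\<^esub> k) y = act h (act k y)"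
      if h: "h \<in> carrier ?H" and k: "k \<in> carrier ?H" and y: "y \<in> Y" for h k y
    proof -
      obtain g v where "y = tree_vertex g v" "g \<in> carrier G" "v \<in> V" using Y_cases[OF y] by blast
      then show ?thesis using h k by (simp add: act m_assoc)
    qed
    show "h = \<one>\<^bsub>?H\<^esub>" if h: "h \<in> carrier ?H" and y: "y \<in> Y" and fixed: "act h y = y" for h y
    proof -
      obtain g v where gv: "y = tree_vertex g v" "g \<in> carrier G" "v \<in> V" using Y_cases[OF y] by blast
      have hG: "h \<in> H" "h \<in> carrier G" using h by simp_all
      have "tree_vertex g v = tree_vertex (h \<otimes> g) v" using fixed act[OF hG(2) gv(2,3)] gv(1) by simp
      from tree_vertex_eqD[OF this gv(3)] obtain a where a: "a \<in> carrier (VG v)" "h \<otimes> g = g \<otimes> \<iota> v a"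
        using hG gv by auto
      have "g \<otimes> \<iota> v a \<otimes> inv g = h" using a(2)[symmetric] hG gv by (simp add: m_assoc)
      then show ?thesis using trivial[OF gv(2,3) a(1)] hG by simp
    qed
    show "tree_edges \<subseteq> Y \<times> Y"
    proof (rule subrelI)
      fix y z assume "(y, z) \<in> tree_edges"
      then obtain g e where "y = tree_vertex g (src e)" "z = tree_vertex (g \<otimes> t e) (tgt e)" "g \<in> carrier G" "e \<in> A"
        using edge_cases by blast
      then show "(y, z) \<in> Y \<times> Y" using Y[of g "src e"] Y[of "g \<otimes> t e" "tgt e"] ends by simp
    qed
    show "(act h y, act h z) \<in> tree_edges" if h: "h \<in> carrier ?H" and yz: "(y, z) \<in> tree_edges" for h y z
    proof -
      obtain g e where *: "y = tree_vertex g (src e)" "z = tree_vertex (g \<otimes> t e) (tgt e)" "g \<in> carrier G" "e \<in> A"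
        using edge_cases[OF yz] by blast
      have hG: "h \<in> carrier G" using h by simp
      have "act h y = tree_vertex (h \<otimes> g) (src e)" using * hG ends by (simp add: act)
      moreover have "act h z = tree_vertex (h \<otimes> g \<otimes> t e) (tgt e)" using * hG ends by (simp add: act m_assoc)
      ultimately show ?thesis using edgeI[of "h \<otimes> g" e] * hG by simp
    qed
    show "(tree_vertex \<one> v0, y) \<in> (tree_edges \<union> tree_edges\<inverse>)\<^sup>*" if y: "y \<in> Y" for y
    proof -
      obtain g v where gv: "y = tree_vertex g v" "g \<in> carrier G" "v \<in> V" using Y_cases[OF y] by blast
      have "(tree_vertex \<one> v0, tree_vertex g v) \<in> (tree_edges \<union> tree_edges\<inverse>)\<^sup>*"
      proof (rule tree_induct[of v0 \<one> "\<lambda>g v. (tree_vertex \<one> v0, tree_vertex g v) \<in> (tree_edges \<union> tree_edges\<inverse>)\<^sup>*" v g])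
        fix k e assume ke: "e \<in> A" "k \<in> carrier G"
        have "(tree_vertex k (src e), tree_vertex (k \<otimes> t e) (tgt e)) \<in> tree_edges \<union> tree_edges\<inverse>"
          "(tree_vertex (k \<otimes> t e) (tgt e), tree_vertex k (src e)) \<in> tree_edges \<union> tree_edges\<inverse>"
          using edgeI[OF ke(2,1)] by simp_all
        then show "(tree_vertex \<one> v0, tree_vertex k (src e)) \<in> (tree_edges \<union> tree_edges\<inverse>)\<^sup>* \<longleftrightarrow>
            (tree_vertex \<one> v0, tree_vertex (k \<otimes> t e) (tgt e)) \<in> (tree_edges \<union> tree_edges\<inverse>)\<^sup>*"
          by (meson rtrancl.rtrancl_into_rtrancl)
      qed (use v0 gv in \<open>simp_all add: tree_vertex_vert\<close>)
      then show ?thesis using gv(1) by simp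
    qed
    show "\<exists>\<Theta>. (\<forall>y\<in>Y. \<Theta> y \<in> carrier (free_group B)) \<and>
        (\<forall>y z. (y, z) \<in> tree_edges \<longrightarrow> \<Theta> z = \<Theta> y \<otimes>\<^bsub>free_group B\<^esub> c y z)"
      if c: "\<And>y z. (y, z) \<in> tree_edges \<Longrightarrow> c y z \<in> carrier (free_group B)" for B :: "'a set" and c
    proof -
      \<comment> \<open>The labelling lifted to pairs \<open>(g, e)\<close>. By
        \<open>edge_relation\<close>, multiplying \<open>g\<close> by an element of the edge group
        changes neither end of the edge.\<close>
      define c' where "c' = (\<lambda>g e. c (tree_vertex g (src e)) (tree_vertex (g \<otimes> t e) (tgt e)))"
      have "c' (g \<otimes> \<iota> (src e) (to_tail T e a)) e = c' g e"
        if g: "g \<in> carrier G" and e: "e \<in> A" and a: "a \<in> carrier (EG e)" for g e a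
      proof -
        have car: "to_tail T e a \<in> carrier (VG (src e))" "to_head T e a \<in> carrier (VG (tgt e))"
          using e a to_tail_closed to_head_closed by simp_all
        have "g \<otimes> \<iota> (src e) (to_tail T e a) \<otimes> t e = g \<otimes> t e \<otimes> \<iota> (tgt e) (to_head T e a)"
          using edge_relation[OF e a] g e ends car by (simp add: m_assoc)
        then show ?thesis
          using g e ends car by (simp add: c'_def tree_vertex_vert)
      qed
      moreover have "c' g e \<in> carrier (free_group B)" if "g \<in> carrier G" "e \<in> A" for g e
        unfolding c'_def by (rule c[OF edgeI[OF that]])
      ultimately obtain \<Theta> where \<Theta>: "\<forall>g\<in>carrier G. \<forall>v\<in>V. \<Theta> g v \<in> carrier (free_group B)"
          "\<forall>g\<in>carrier G. \<forall>v\<in>V. \<forall>a\<in>carrier (VG v). \<Theta> (g \<otimes> \<iota> v a) v = \<Theta> g v"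
          "\<forall>g\<in>carrier G. \<forall>e\<in>A. \<Theta> (g \<otimes> t e) (tgt e) = \<Theta> g (src e) \<otimes>\<^bsub>free_group B\<^esub> c' g e"
        using tree_simply_connected[OF group_free_group, of c' B] by blast
      \<comment> \<open>Descent to cosets: any representative may be chosen, because \<Theta> is
        invariant under the vertex group.\<close>
      define \<Theta>' where "\<Theta>' = (\<lambda>y. \<Theta> (SOME g. g \<in> carrier G \<and> y = tree_vertex g (fst y)) (fst y))"
      have \<Theta>': "\<Theta>' (tree_vertex g v) = \<Theta> g v" if g: "g \<in> carrier G" and v: "v \<in> V" for g v
      proof -
        let ?P = "\<lambda>k. k \<in> carrier G \<and> tree_vertex g v = tree_vertex k v"
        define k where "k = (SOME k. ?P k)"
        have k: "k \<in> carrier G" "tree_vertex g v = tree_vertex k v"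
          using someI[of ?P g] g unfolding k_def by blast+
        obtain a where "a \<in> carrier (VG v)" "k = g \<otimes> \<iota> v a"
          using tree_vertex_eqD[OF k(2) v k(1)] by blast
        then have "\<Theta> k v = \<Theta> g v" using \<Theta>(2) g v by simp
        moreover have "fst (tree_vertex g v) = v" by (simp add: tree_vertex_def)
        ultimately show ?thesis unfolding \<Theta>'_def k_def by simp
      qed
      show ?thesis
      proof (intro exI[of _ \<Theta>'] conjI ballI allI impI)
        fix y assume "y \<in> Y"
        then obtain g v where "y = tree_vertex g v" "g \<in> carrier G" "v \<in> V" using Y_cases by blast
        then show "\<Theta>' y \<in> carrier (free_group B)" using \<Theta>(1) \<Theta>' by simp
      next
        fix y z assume "(y, z) \<in> tree_edges"
        then obtain g e where *: "y = tree_vertex g (src e)" "z = tree_vertex (g \<otimes> t e) (tgt e)" "g \<in> carrier G" "e \<in> A"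
          using edge_cases by blast
        then show "\<Theta>' z = \<Theta>' y \<otimes>\<^bsub>free_group B\<^esub> c y z"
          using \<Theta>(3) \<Theta>' ends by (simp add: c'_def)
      qed
    qed
  qed
  show ?thesis by (rule is_free_group_if_free_tree_action)
qed

end

text \<open>\<open>undistorted\<close> supplies some generating sets \<open>S1\<close>,
  \<open>T1\<close> and speaks of the image of \<open>A\<close>. The Lipschitz property of
  homomorphisms changes \<open>S\<close> into \<open>S1\<close>, and, applied to the inverse of
  \<open>i\<close> on its image, changes \<open>T1\<close> into \<open>U\<close>; there injectivity
  enters.\<close>

lemma undistorted_quasi_isometric:
  assumes "fg_group G S" "fg_group A U" and i: "i \<in> hom A G" "inj_on i (carrier A)"
    and und: "undistorted G (i ` carrier A)"
  shows "\<exists>k c :: real. 1 \<le> k \<and> 0 \<le> c \<and> (\<forall>x\<in>carrier A. \<forall>y\<in>carrier A.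
      real (edge_distance (cayley_edges A U) x y) / k - c \<le> real (edge_distance (cayley_edges G S) (i x) (i y)) \<and>
      real (edge_distance (cayley_edges G S) (i x) (i y)) \<le> k * real (edge_distance (cayley_edges A U) x y) + c)"
proof -
  interpret G: fg_group G S by fact
  interpret A: fg_group A U by fact
  let ?I = "i ` carrier A"
  let ?GI = "G\<lparr>carrier := ?I\<rparr>"
  from und obtain S1 T1 k1 c1 f where sub: "subgroup ?I G"
    and S1: "finite S1" "generating_set G S1" and T1: "finite T1" "generating_set ?GI T1"
    and k1: "1 \<le> k1" and c1: "0 \<le> c1"
    and f: "\<forall>h\<in>?I. f (vertex_point h) = vertex_point h"
    and qi: "quasi_isometric_embedding k1 c1 (cayley_graph ?GI T1) (cayley_dist ?GI T1)
        (cayley_graph G S1) (cayley_dist G S1) f"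
    unfolding undistorted_def by blast
  interpret G1: fg_group G S1 by unfold_locales (fact S1)+
  interpret I: group ?GI using sub G.is_group by (rule subgroup.subgroup_is_group)
  interpret I: fg_group ?GI T1 by unfold_locales (fact T1)+
  have iso: "i \<in> iso A ?GI" using i by (auto simp: iso_def hom_def bij_betw_def)
  then have inv_hom: "inv_into (carrier A) i \<in> hom ?GI A"
    using A.iso_set_sym[OF iso] by (simp add: iso_def)
  obtain L0 where L0: "1 \<le> L0" "\<And>x y. x \<in> carrier A \<Longrightarrow> y \<in> carrier A \<Longrightarrow> G.d (i x) (i y) \<le> L0 * A.d x y"
    using hom_word_dist_le[OF A.fg_group_axioms G.fg_group_axioms i(1)] by blast
  obtain L1 where L1: "1 \<le> L1" "\<And>x y. x \<in> ?I \<Longrightarrow> y \<in> ?I \<Longrightarrow>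
      A.d (inv_into (carrier A) i x) (inv_into (carrier A) i y) \<le> L1 * I.d x y"
    using hom_word_dist_le[OF I.fg_group_axioms A.fg_group_axioms inv_hom] by auto
  have "(\<lambda>x. x) \<in> hom G G" by (simp add: hom_def)
  then obtain L2 where L2: "1 \<le> L2" "\<And>x y. x \<in> carrier G \<Longrightarrow> y \<in> carrier G \<Longrightarrow> G1.d x y \<le> L2 * G.d x y"
    using hom_word_dist_le[OF G.fg_group_axioms G1.fg_group_axioms] by blast
  \<comment> \<open>\<open>c\<close> dominates the additive errors below: \<open>c1\<close> and 2
    inside the factor \<open>k1\<close>, and another 2 outside it, all scaled by \<open>L1\<close>.
    Next, \<open>k\<close> is a sum in order to exceed both the factor \<open>L0\<close> of the
    upper bound and the factor \<open>L1 * k1 * L2\<close> of the lower one.\<close>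
  define c where "c = real L1 * (k1 * (c1 + 4) + 2)"
  define k where "k = real L0 + real L1 * k1 * real L2"
  have nn: "0 \<le> real L1 * k1 * real L2" using k1 by simp
  have k: "1 \<le> k" "real L0 \<le> k" "real L1 * k1 * real L2 \<le> k" using L0(1) nn by (simp_all add: k_def)
  have c: "0 \<le> c" using k1 c1 by (simp add: c_def)
  have "A.d x y / k - c \<le> G.d (i x) (i y) \<and> G.d (i x) (i y) \<le> k * A.d x y + c"
    if x: "x \<in> carrier A" and y: "y \<in> carrier A" for x y
  proof
    have ix: "i x \<in> ?I" "i y \<in> ?I" using x y by blast+
    have iG: "i x \<in> carrier G" "i y \<in> carrier G" using ix subgroup.subset[OF sub] by blast+
    have "real (G.d (i x) (i y)) \<le> real L0 * A.d x y"
      using L0(2)[OF x y] by (metis of_nat_le_iff of_nat_mult)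
    also have "\<dots> \<le> k * A.d x y" using k(2) by (rule mult_right_mono) simp
    finally show "G.d (i x) (i y) \<le> k * A.d x y + c" using c by linarith
    have "A.d x y \<le> L1 * I.d (i x) (i y)"
      using L1(2)[OF ix] inv_into_f_f[OF i(2)] x y by simp
    then have 1: "real (A.d x y) \<le> real L1 * I.d (i x) (i y)" by (metis of_nat_le_iff of_nat_mult)
    let ?x = "vertex_point (i x)" and ?y = "vertex_point (i y)"
    have vx: "?x \<in> cayley_graph ?GI T1" "?y \<in> cayley_graph ?GI T1" using ix by (auto intro: I.vertex_point_mem)
    then have "cayley_dist ?GI T1 ?x ?y / k1 - c1 \<le> cayley_dist G S1 (f ?x) (f ?y)"
      using qi unfolding quasi_isometric_embedding_def by blast
    then have "cayley_dist ?GI T1 ?x ?y / k1 \<le> cayley_dist G S1 ?x ?y + c1"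
      using f ix by (simp add: diff_le_eq)
    also have "\<dots> \<le> real (G1.d (i x) (i y)) + (c1 + 2)"
      using G1.cayley_dist_vertex[OF iG] by linarith
    also have "\<dots> \<le> real L2 * G.d (i x) (i y) + (c1 + 2)"
      using L2(2)[OF iG] by (metis add_le_cancel_right of_nat_le_iff of_nat_mult)
    finally have "cayley_dist ?GI T1 ?x ?y \<le> k1 * (real L2 * G.d (i x) (i y) + (c1 + 2))"
      using k1 by (simp add: divide_le_eq mult.commute)
    moreover have "\<bar>cayley_dist ?GI T1 ?x ?y - real (I.d (i x) (i y))\<bar> \<le> 2"
      using ix by (intro I.cayley_dist_vertex) simp_all
    ultimately have "real (I.d (i x) (i y)) \<le> k1 * (real L2 * G.d (i x) (i y) + (c1 + 2)) + 2"
      by linarith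
    then have "real L1 * I.d (i x) (i y) \<le> real L1 * (k1 * (real L2 * G.d (i x) (i y) + (c1 + 2)) + 2)"
      by (rule mult_left_mono) simp
    also have "\<dots> \<le> real L1 * k1 * real L2 * G.d (i x) (i y) + c"
      using k1 by (simp add: c_def algebra_simps)
    also have "\<dots> \<le> k * G.d (i x) (i y) + c"
      using mult_right_mono[OF k(3), of "real (G.d (i x) (i y))"] by simp
    also have "\<dots> \<le> k * (G.d (i x) (i y) + c)"
      using mult_right_mono[OF k(1) c] by (simp add: distrib_left)
    finally have "real (A.d x y) \<le> k * (G.d (i x) (i y) + c)" using 1 by linarith
    then have "real (A.d x y) / k \<le> G.d (i x) (i y) + c"
      using k(1) by (simp add: divide_le_eq mult.commute)
    then show "A.d x y / k - c \<le> G.d (i x) (i y)" by (simp only: diff_le_eq)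
  qed
  then show ?thesis using k(1) c by blast
qed

text \<open>By the pigeonhole principle infinitely many elements are mapped into one of the finitely
  many cosets of \<open>K\<close>; their quotients by a fixed one of them are mapped into
  \<open>K\<close>.\<close>

lemma infinite_vimage_finite_index:
  assumes "group C" "group D" and f: "f \<in> hom C D" and inf: "infinite (carrier C)"
    and K: "subgroup K D" and fin: "finite_index D K"
  shows "infinite {a \<in> carrier C. f a \<in> K}"
proof -
  interpret C: group C by fact
  interpret D: group D by fact
  interpret f: group_hom C D f by unfold_locales (rule f)
  interpret K: subgroup K D by (rule K)
  let ?F = "\<lambda>a. K #>\<^bsub>D\<^esub> f a"
  have "?F ` carrier C \<subseteq> rcosets\<^bsub>D\<^esub> K" unfolding RCOSETS_def using f.hom_closed by blast
  then have "finite (?F ` carrier C)" using fin unfolding finite_index_def by (rule finite_subset)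
  from pigeonhole_infinite[OF inf this] obtain b where b: "b \<in> carrier C"
      and infb: "infinite {a \<in> carrier C. ?F a = ?F b}" by blast
  have "(\<lambda>a. a \<otimes>\<^bsub>C\<^esub> inv\<^bsub>C\<^esub> b) ` {a \<in> carrier C. ?F a = ?F b} \<subseteq> {a \<in> carrier C. f a \<in> K}"
  proof (rule image_subsetI)
    fix a assume "a \<in> {a \<in> carrier C. ?F a = ?F b}"
    then have a: "a \<in> carrier C" and eq: "?F a = ?F b" by auto
    have "f a \<in> ?F b" using D.rcos_self[OF _ K, of "f a"] a eq by simp
    then obtain y where y: "y \<in> K" "f a = y \<otimes>\<^bsub>D\<^esub> f b" unfolding r_coset_def by blast
    then have "f (a \<otimes>\<^bsub>C\<^esub> inv\<^bsub>C\<^esub> b) = y" using a b by (simp add: D.m_assoc)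
    then show "a \<otimes>\<^bsub>C\<^esub> inv\<^bsub>C\<^esub> b \<in> {a \<in> carrier C. f a \<in> K}" using a b y by simp
  qed
  moreover have "inj_on (\<lambda>a. a \<otimes>\<^bsub>C\<^esub> inv\<^bsub>C\<^esub> b) {a \<in> carrier C. ?F a = ?F b}"
    using b by (intro inj_onI) simp
  then have "infinite ((\<lambda>a. a \<otimes>\<^bsub>C\<^esub> inv\<^bsub>C\<^esub> b) ` {a \<in> carrier C. ?F a = ?F b})"
    using infb by (simp only: finite_image_iff not_False_eq_True)
  ultimately show ?thesis by (rule infinite_super)
qed

section \<open>Intersections with vertex groups: passage along edges, and torsion\<close>

context graph_decomposition
begin

text \<open>The set \<open>K g\<close> of \<open>undistorted_map\<close> for the map
  \<open>\<iota> v\<close>, without the metric data, so that different vertices can be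
  compared.\<close>

definition stab :: "'a set \<Rightarrow> 'a \<Rightarrow> 'v \<Rightarrow> 'g set" where
  "stab H g v = {x \<in> carrier (VG v). g \<otimes> \<iota> v x \<otimes> inv g \<in> H}"

text \<open>An infinite \<open>stab\<close> at one end of an edge has finite index there, so the
  infinite edge group meets it in an infinite set. The edge relation makes that set lie, through the
  other injection, in the \<open>stab\<close> at the other end. A change of coset representative
  conjugates \<open>stab\<close> by an element of the vertex group.\<close>

lemma infinite_stab_propagate:
  assumes H: "subgroup H G"
    and fin: "\<And>g v. g \<in> carrier G \<Longrightarrow> v \<in> V \<Longrightarrow> infinite (stab H g v) \<Longrightarrow>
        subgroup (stab H g v) (VG v) \<and> finite_index (VG v) (stab H g v)"
    and edges: "\<And>e. e \<in> A \<Longrightarrow> infinite (carrier (EG e))"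
    and "u \<in> V" "g \<in> carrier G" "infinite (stab H g u)" and "v \<in> V" "h \<in> carrier G"
  shows "infinite (stab H h v)"
proof (rule tree_induct[where Q = "\<lambda>g v. infinite (stab H g v)"])
  fix g v a assume v: "v \<in> V" and g: "g \<in> carrier G" and a: "a \<in> carrier (VG v)"
    and inf: "infinite (stab H g v)"
  interpret vg: group "VG v" using v by (rule group_vgroup)
  let ?f = "\<lambda>x. inv\<^bsub>VG v\<^esub> a \<otimes>\<^bsub>VG v\<^esub> x \<otimes>\<^bsub>VG v\<^esub> a"
  have "?f ` stab H g v \<subseteq> stab H (g \<otimes> \<iota> v a) v"
  proof (rule image_subsetI)
    fix x assume "x \<in> stab H g v"
    then have x: "x \<in> carrier (VG v)" "g \<otimes> \<iota> v x \<otimes> inv g \<in> H" by (auto simp: stab_def)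
    have "\<iota> v (?f x) = inv (\<iota> v a) \<otimes> \<iota> v x \<otimes> \<iota> v a" using v a x by (simp add: \<iota>_mult \<iota>_inv)
    then have "g \<otimes> \<iota> v a \<otimes> \<iota> v (?f x) \<otimes> inv (g \<otimes> \<iota> v a) = g \<otimes> \<iota> v x \<otimes> inv g"
      using v a x g by (simp add: inv_mult_group m_assoc inv_mult_cancel)
    then show "?f x \<in> stab H (g \<otimes> \<iota> v a) v" using x a by (simp add: stab_def)
  qed
  moreover have "inj_on ?f (stab H g v)" using a by (intro inj_onI) (simp add: stab_def)
  then have "infinite (?f ` stab H g v)" using inf by (simp only: finite_image_iff not_False_eq_True)
  ultimately show "infinite (stab H (g \<otimes> \<iota> v a) v)" by (rule infinite_super)
next
  fix g e assume e: "e \<in> A" and g: "g \<in> carrier G"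
  have ends: "src e \<in> V" "tgt e \<in> V" using e by auto
  have gt: "g \<otimes> t e \<in> carrier G" using g e by simp
  have mem: "to_tail T e a \<in> stab H g (src e) \<longleftrightarrow> to_head T e a \<in> stab H (g \<otimes> t e) (tgt e)"
    if a: "a \<in> carrier (EG e)" for a
  proof -
    have car: "to_tail T e a \<in> carrier (VG (src e))" "to_head T e a \<in> carrier (VG (tgt e))"
      using e a to_tail_closed to_head_closed by simp_all
    let ?x = "\<iota> (src e) (to_tail T e a)" and ?y = "\<iota> (tgt e) (to_head T e a)"
    have xy: "?x \<in> carrier G" "?y \<in> carrier G" using ends car by simp_all
    have "g \<otimes> t e \<otimes> ?y \<otimes> inv (g \<otimes> t e) = g \<otimes> (t e \<otimes> ?y) \<otimes> (inv (t e) \<otimes> inv g)"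
      using g e xy by (simp add: inv_mult_group m_assoc)
    also have "\<dots> = g \<otimes> ?x \<otimes> inv g"
      using g e xy by (simp add: edge_relation[OF e a, symmetric] m_assoc inv_mult_cancel)
    finally show ?thesis using car by (simp add: stab_def)
  qed
  show "infinite (stab H g (src e)) \<longleftrightarrow> infinite (stab H (g \<otimes> t e) (tgt e))"
  proof
    assume "infinite (stab H g (src e))"
    note * = fin[OF g ends(1) this]
    have "infinite {a \<in> carrier (EG e). to_tail T e a \<in> stab H g (src e)}"
      by (rule infinite_vimage_finite_index[OF group_egroup[OF e] group_vgroup[OF ends(1)]
            to_tail_hom[OF e] edges[OF e]]) (use * in blast)+
    moreover have "inj_on (to_head T e) {a \<in> carrier (EG e). to_tail T e a \<in> stab H g (src e)}"
      by (rule inj_on_subset[OF to_head_inj[OF e]]) simp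
    ultimately have inf: "infinite (to_head T e ` {a \<in> carrier (EG e). to_tail T e a \<in> stab H g (src e)})"
      by (simp only: finite_image_iff not_False_eq_True)
    have "to_head T e ` {a \<in> carrier (EG e). to_tail T e a \<in> stab H g (src e)} \<subseteq>
        stab H (g \<otimes> t e) (tgt e)" using mem by blast
    then show "infinite (stab H (g \<otimes> t e) (tgt e))" using inf by (rule infinite_super)
  next
    assume "infinite (stab H (g \<otimes> t e) (tgt e))"
    note * = fin[OF gt ends(2) this]
    have "infinite {a \<in> carrier (EG e). to_head T e a \<in> stab H (g \<otimes> t e) (tgt e)}"
      by (rule infinite_vimage_finite_index[OF group_egroup[OF e] group_vgroup[OF ends(2)]
            to_head_hom[OF e] edges[OF e]]) (use * in blast)+
    moreover have "inj_on (to_tail T e) {a \<in> carrier (EG e). to_head T e a \<in> stab H (g \<otimes> t e) (tgt e)}"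
      by (rule inj_on_subset[OF to_tail_inj[OF e]]) simp
    ultimately have inf: "infinite (to_tail T e ` {a \<in> carrier (EG e). to_head T e a \<in> stab H (g \<otimes> t e) (tgt e)})"
      by (simp only: finite_image_iff not_False_eq_True)
    have "to_tail T e ` {a \<in> carrier (EG e). to_head T e a \<in> stab H (g \<otimes> t e) (tgt e)} \<subseteq>
        stab H g (src e)" using mem by blast
    then show "infinite (stab H g (src e))" using inf by (rule infinite_super)
  qed
qed (use assms in blast)+

text \<open>The powers of \<open>a\<close> stay in the finite subgroup \<open>stab H g v\<close>, so
  two of them coincide and \<open>a\<close> has finite order; so does its conjugate, which lies in
  the torsion-free group \<open>H\<close>.\<close>

lemma trivial_if_finite_stab:
  assumes H: "subgroup H G" and tf: "torsion_free (G\<lparr>carrier := H\<rparr>)"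
    and g: "g \<in> carrier G" and v: "v \<in> V" and fin: "finite (stab H g v)"
    and sub: "subgroup (stab H g v) (VG v)"
    and a: "a \<in> carrier (VG v)" and aH: "g \<otimes> \<iota> v a \<otimes> inv g \<in> H"
  shows "g \<otimes> \<iota> v a \<otimes> inv g = \<one>"
proof -
  interpret vg: group "VG v" using v by (rule group_vgroup)
  let ?K = "(VG v)\<lparr>carrier := stab H g v\<rparr>"
  interpret K: group ?K using sub vg.is_group by (rule subgroup.subgroup_is_group)
  have "a \<in> stab H g v" using a aH by (simp add: stab_def)
  then have "a [^]\<^bsub>?K\<^esub> n \<in> stab H g v" for n :: nat using K.nat_pow_closed[of a n] by simp
  then have pow: "a [^]\<^bsub>VG v\<^esub> n \<in> stab H g v" for n :: nat
    using vg.nat_pow_consistent[of a n "stab H g v"] by simp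
  then have "range (\<lambda>n :: nat. a [^]\<^bsub>VG v\<^esub> n) \<subseteq> stab H g v" by blast
  then have "finite (range (\<lambda>n :: nat. a [^]\<^bsub>VG v\<^esub> n))" using fin by (rule finite_subset)
  then have "\<not> inj (\<lambda>n :: nat. a [^]\<^bsub>VG v\<^esub> n)" using range_inj_infinite by blast
  then obtain l m :: nat where "a [^]\<^bsub>VG v\<^esub> l = a [^]\<^bsub>VG v\<^esub> m" "l < m"
    unfolding inj_def by (metis linorder_neqE_nat)
  define n where "n = m - l"
  have n: "0 < n" using \<open>l < m\<close> by (simp add: n_def)
  have "a [^]\<^bsub>VG v\<^esub> l \<otimes>\<^bsub>VG v\<^esub> a [^]\<^bsub>VG v\<^esub> n = a [^]\<^bsub>VG v\<^esub> (l + n)"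
    using a by (rule vg.nat_pow_mult)
  also have "\<dots> = a [^]\<^bsub>VG v\<^esub> l"
    using \<open>l < m\<close> \<open>a [^]\<^bsub>VG v\<^esub> l = a [^]\<^bsub>VG v\<^esub> m\<close> by (simp only: n_def le_add_diff_inverse less_imp_le)
  finally have "a [^]\<^bsub>VG v\<^esub> l \<otimes>\<^bsub>VG v\<^esub> a [^]\<^bsub>VG v\<^esub> n = a [^]\<^bsub>VG v\<^esub> l" .
  then have an: "a [^]\<^bsub>VG v\<^esub> n = \<one>\<^bsub>VG v\<^esub>" using a by (simp add: vg.l_cancel_one)
  have "(\<lambda>x. g \<otimes> \<iota> v x \<otimes> inv g) \<in> hom (VG v) G"
  proof (rule homI)
    fix x y assume "x \<in> carrier (VG v)" "y \<in> carrier (VG v)"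
    then show "g \<otimes> \<iota> v (x \<otimes>\<^bsub>VG v\<^esub> y) \<otimes> inv g = g \<otimes> \<iota> v x \<otimes> inv g \<otimes> (g \<otimes> \<iota> v y \<otimes> inv g)"
      using g v by (simp add: \<iota>_mult m_assoc inv_mult_cancel)
  qed (use g v in simp)
  then interpret f: group_hom "VG v" G "\<lambda>x. g \<otimes> \<iota> v x \<otimes> inv g" by unfold_locales
  have "(g \<otimes> \<iota> v a \<otimes> inv g) [^] n = g \<otimes> \<iota> v (a [^]\<^bsub>VG v\<^esub> n) \<otimes> inv g"
    using f.hom_nat_pow[OF a, of n] by simp
  also have "\<dots> = \<one>" using g v by (simp add: an \<iota>_one)
  finally have "(g \<otimes> \<iota> v a \<otimes> inv g) [^]\<^bsub>G\<lparr>carrier := H\<rparr>\<^esub> n = \<one>\<^bsub>G\<lparr>carrier := H\<rparr>\<^esub>"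
    using nat_pow_consistent[of _ n H] by simp
  then show ?thesis using tf n aH unfolding torsion_free_def by auto
qed

end

theorem proposition1p5:
  fixes G :: "('a, 'm) monoid_scheme"
    and T :: "('v, 'e, 'g, 'h) group_graph"
    and T' :: "('v, 'e) pre_digraph"
    and \<phi> :: "('v, 'e, 'g) letter list set \<Rightarrow> 'a"
    and H :: "'a set"
  assumes "group G"
    and "graph_of_groups T" and "fin_digraph (graph T)"
    and "maximal_subtree T' (graph T)"
    and "\<phi> \<in> iso (fundamental_group T T') G"
    and "\<forall>v\<in>verts (graph T).
           finitely_generated (vgroup T v) \<and>
           undistorted G (\<phi> ` vgroup_to_pi1 T T' v ` carrier (vgroup T v)) \<and>
           (\<forall>K. strongly_quasiconvex (vgroup T v) K \<and> infinite K \<longrightarrow> finite_index (vgroup T v) K)"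
    and "\<forall>e\<in>arcs (graph T). infinite (carrier (egroup T e))"
    and "strongly_quasiconvex G H"
    and "torsion_free (G\<lparr>carrier := H\<rparr>)"
    and "\<not> finite_index G H"
  shows "is_free_group (G\<lparr>carrier := H\<rparr>)"
proof -
  interpret graph_decomposition G T T' \<phi>
    using assms(1-5) by (intro graph_decomposition.intro graph_decomposition_axioms.intro)
  \<comment> \<open>The generating set that comes with strong quasiconvexity of \<open>H\<close>
    serves for all vertex groups; undistortedness is converted to it.\<close>
  obtain S where H: "subgroup H G" and S: "finite S" "generating_set G S"
    and Morse: "Morse_subset (cayley_graph G S) (cayley_dist G S) (vertex_point ` H)"
    using assms(8) unfolding strongly_quasiconvex_def by blast
  interpret GS: fg_group G S by unfold_locales (fact S)+
  have Morse_H: "Morse_subset (carrier G) (\<lambda>g h. real (GS.d g h)) H"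
    using subgroup.subset[OF H] Morse by (rule GS.Morse_subset_vertices)
  have fg: "\<exists>U. fg_group (vgroup T v) U" if v: "v \<in> V" for v
  proof -
    obtain U where "finite U" "generating_set (vgroup T v) U"
      using assms(6) v unfolding finitely_generated_def by blast
    then have "fg_group (vgroup T v) U"
      using group_vgroup[OF v] by (intro fg_group.intro fg_group_axioms.intro)
    then show ?thesis ..
  qed
  have inj: "inj_on (\<iota> v) (carrier (vgroup T v))" if "v \<in> V" for v
  proof (rule \<iota>_inj[OF _ that])
    fix w assume "w \<in> V"
    then obtain U where "fg_group (vgroup T w) U" using fg by blast
    then show "countable (carrier (vgroup T w))" by (rule fg_group.countable_carrier)
  qed
  have und_map: "\<exists>U k c. undistorted_map G S (vgroup T v) U (\<iota> v) k c H" if v: "v \<in> V" for v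
  proof -
    obtain U where U: "fg_group (vgroup T v) U" using fg[OF v] ..
    have "\<iota> v ` carrier (vgroup T v) = \<phi> ` vgroup_to_pi1 T T' v ` carrier (vgroup T v)"
      by (simp add: \<iota>_eq image_image)
    then have "undistorted G (\<iota> v ` carrier (vgroup T v))" using assms(6) v by simp
    from undistorted_quasi_isometric[OF GS.fg_group_axioms U \<iota>_hom[OF v] inj[OF v] this]
    obtain k c :: real where kc: "1 \<le> k" "0 \<le> c"
      and qi: "\<And>x y. x \<in> carrier (vgroup T v) \<Longrightarrow> y \<in> carrier (vgroup T v) \<Longrightarrow>
        edge_distance (cayley_edges (vgroup T v) U) x y / k - c \<le> GS.d (\<iota> v x) (\<iota> v y) \<and>
        GS.d (\<iota> v x) (\<iota> v y) \<le> k * edge_distance (cayley_edges (vgroup T v) U) x y + c"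
      by blast
    have "undistorted_map G S (vgroup T v) U (\<iota> v) k c H"
      by (intro undistorted_map.intro undistorted_map_axioms.intro GS.fg_group_axioms U \<iota>_hom[OF v]
          kc qi H Morse_H)
    then show ?thesis by blast
  qed
  have stab: "strongly_quasiconvex (vgroup T v) (stab H g v)" "subgroup (stab H g v) (vgroup T v)"
    if v: "v \<in> V" and g: "g \<in> carrier G" for v g
  proof -
    obtain U k c where "undistorted_map G S (vgroup T v) U (\<iota> v) k c H" using und_map[OF v] by blast
    then interpret um: undistorted_map G S "vgroup T v" U "\<iota> v" k c H .
    have "um.K g = stab H g v" by (simp add: um.K_def stab_def)
    then show "strongly_quasiconvex (vgroup T v) (stab H g v)" "subgroup (stab H g v) (vgroup T v)"
      using um.strongly_quasiconvex_K[OF g] um.subgroup_K[OF g] by simp_all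
  qed
  have fin_index: "finite_index (vgroup T v) (stab H g v)"
    if "v \<in> V" "g \<in> carrier G" "infinite (stab H g v)" for v g
    using assms(6)[rule_format, OF that(1)] stab(1)[OF that(1,2)] that(3) by simp
  have fin: "finite (stab H g v)" if g: "g \<in> carrier G" and v: "v \<in> V" for g v
  proof (rule ccontr)
    assume inf: "infinite (stab H g v)"
    \<comment> \<open>From here on only the conjugates of this one vertex group matter: its cosets
      already cover \<open>G\<close>.\<close>
    have all: "infinite (stab H h v)" if "h \<in> carrier G" for h
    proof (rule infinite_stab_propagate[OF H _ _ v g inf v that])
      fix k w assume "k \<in> carrier G" "w \<in> V" "infinite (stab H k w)"
      then show "subgroup (stab H k w) (vgroup T w) \<and> finite_index (vgroup T w) (stab H k w)"
        using stab(2) fin_index by simp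
    qed (use assms(7) in simp)
    obtain U k c where "undistorted_map G S (vgroup T v) U (\<iota> v) k c H" using und_map[OF v] by blast
    then interpret um: undistorted_map G S "vgroup T v" U "\<iota> v" k c H .
    have K: "um.K h = stab H h v" for h by (simp add: um.K_def stab_def)
    have "stab H g v \<subseteq> carrier (vgroup T v)" by (auto simp: stab_def)
    then have "infinite (carrier (vgroup T v))" using inf by (rule infinite_super)
    then have "finite_index G H"
      by (rule um.finite_index_if_all_finite_index) (simp add: K fin_index[OF v _ all])
    then show False using assms(10) by simp
  qed
  show ?thesis
  proof (rule is_free_group_if_trivial_intersections[OF H])
    fix g v a assume *: "g \<in> carrier G" "v \<in> V" "a \<in> carrier (vgroup T v)"
      "g \<otimes>\<^bsub>G\<^esub> \<iota> v a \<otimes>\<^bsub>G\<^esub> inv\<^bsub>G\<^esub> g \<in> H"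
    show "g \<otimes>\<^bsub>G\<^esub> \<iota> v a \<otimes>\<^bsub>G\<^esub> inv\<^bsub>G\<^esub> g = \<one>\<^bsub>G\<^esub>"
      by (rule trivial_if_finite_stab[OF H assms(9) *(1,2) fin[OF *(1,2)] stab(2)[OF *(2,1)] *(3,4)])
  qed
qed

end
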